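(* Let $m\ge 2$ and $N\ge 1$ be integers. For each $i\in\{1,\dots,m\}$ let $X_i\subseteq\mathbb{R}^N$ be a $C^2$ sub-manifold of dimension $d_i$, and let $\mu_i$ be a probability measure compactly supported in $X_i$ such that $\mu_i\in L^\infty(\mathcal{H}^{d_i}_{X_i})$, i.e. $\mu_i$ is absolutely continuous with respect to the $d_i$-dimensional Hausdorff measure on $X_i$ with essentially bounded density. Let $\mathbf{X}=X_1\times\cdots\times X_m$ and let $c:\mathbf{X}\to\mathbb{R}_+$ be of class $C^2$. Then there exist constants $\varepsilon_0>0$ and $C^*\ge0$ such that for every $\varepsilon\in(0,\varepsilon_0]$, $$\mathsf{MOT}_\varepsilon\le \mathsf{MOT}_0+\frac12\Bigl(\sum_{i=1}^m d_i-\max_{1\le i\le m}d_i\Bigr)\,\varepsilon\log(1/\varepsilon)+C^*\varepsilon.$$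
   Context: $\Pi(\mu_1,\dots,\mu_m)$ denotes the set of Borel probability measures $\gamma$ on $\mathbf{X}=X_1\times\cdots\times X_m$ whose $i$-th marginal is $\mu_i$ for every $i\in\{1,\dots,m\}$. For probability measures $p,q$, the Boltzmann–Shannon relative entropy is $\mathrm{Ent}(p\,|\,q)=\int\rho\log\rho\,\mathrm{d}q$ if $p=\rho q$ (i.e. $p$ is absolutely continuous with respect to $q$ with density $\rho$), and $\mathrm{Ent}(p\,|\,q)=+\infty$ otherwise. For $\varepsilon>0$, $$\mathsf{MOT}_\varepsilon=\inf\Bigl\{\int_{\mathbf{X}}c\,\mathrm{d}\gamma+\varepsilon\,\mathrm{Ent}\bigl(\gamma\,|\,\otimes_{i=1}^m\mu_i\bigr)\;:\;\gamma\in\Pi(\mu_1,\dots,\mu_m)\Bigr\},$$ and $$\mathsf{MOT}_0=\inf\Bigl\{\int_{\mathbf{X}}c\,\mathrm{d}\gamma\;:\;\gamma\in\Pi(\mu_1,\dots,\mu_m)\Bigr\}.$$ *)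

theory Defs
  imports "HOL-Probability.Probability"
begin

section \<open>Submanifolds and functions of class \<open>C\<^sup>2\<close>\<close>

definition C2_on :: "'a::euclidean_space set \<Rightarrow> ('a \<Rightarrow> 'b::euclidean_space) \<Rightarrow> bool" where
  "C2_on U f \<longleftrightarrow> open U \<and>
    (\<exists>(f' :: 'a \<Rightarrow> ('a, 'b) blinfun) (f'' :: 'a \<Rightarrow> ('a, ('a, 'b) blinfun) blinfun).
       (\<forall>x\<in>U. (f has_derivative blinfun_apply (f' x)) (at x)) \<and>
       (\<forall>x\<in>U. (f' has_derivative blinfun_apply (f'' x)) (at x)) \<and>
       continuous_on U f'')"

text \<open>Embedded submanifolds without boundary, described by \<open>C\<^sup>2\<close> diffeomorphisms of the ambient
  space which flatten the set locally onto a linear subspace of dimension \<open>d\<close>.\<close>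

definition C2_submanifold :: "nat \<Rightarrow> 'a::euclidean_space set \<Rightarrow> bool" where
  "C2_submanifold d M \<longleftrightarrow>
    (\<forall>p\<in>M. \<exists>U V (\<phi> :: 'a \<Rightarrow> 'a) \<psi> S.
       p \<in> U \<and> homeomorphism U V \<phi> \<psi> \<and> C2_on U \<phi> \<and> C2_on V \<psi> \<and>
       subspace S \<and> dim S = d \<and> \<phi> ` (U \<inter> M) = V \<inter> S)"

text \<open>A function on a submanifold \<open>M\<close> of a Euclidean space is of class \<open>C\<^sup>2\<close> if near each point of
  \<open>M\<close> it is the restriction of a \<open>C\<^sup>2\<close> function on an open set of the ambient space. Values of \<open>f\<close>
  outside \<open>M\<close> are irrelevant.\<close>

definition C2_on_submanifold :: "'a::euclidean_space set \<Rightarrow> ('a \<Rightarrow> 'b::euclidean_space) \<Rightarrow> bool" where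
  "C2_on_submanifold M f \<longleftrightarrow>
    (\<forall>p\<in>M. \<exists>U g. p \<in> U \<and> C2_on U g \<and> (\<forall>x\<in>U \<inter> M. g x = f x))"

section \<open>Hausdorff measure\<close>

text \<open>The empty set is treated separately because \<open>0 ^ 0 = 1\<close>, and boundedness is required
  because \<^const>\<open>diameter\<close> is unspecified on unbounded sets. With the factor \<^const>\<open>unit_ball_vol\<close>
  the measure agrees with the Lebesgue measure on \<open>d\<close>-dimensional Euclidean space.\<close>

definition hausdorff_content :: "nat \<Rightarrow> real \<Rightarrow> 'a::euclidean_space set \<Rightarrow> ennreal" where
  "hausdorff_content d \<delta> A =
    (INF U \<in> {U :: nat \<Rightarrow> 'a set. A \<subseteq> (\<Union>j. U j) \<and> (\<forall>j. bounded (U j) \<and> diameter (U j) \<le> \<delta>)}.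
       \<Sum>j. if U j = {} then 0 else ennreal (unit_ball_vol (real d) * (diameter (U j) / 2) ^ d))"

definition hausdorff_outer :: "nat \<Rightarrow> 'a::euclidean_space set \<Rightarrow> ennreal" where
  "hausdorff_outer d A = (SUP \<delta>\<in>{0<..}. hausdorff_content d \<delta> A)"

text \<open>The lemma \<open>emeasure_hausdorff_measure\<close> below shows that \<^const>\<open>measure_of\<close> does not degenerate
  here, since the outer measure is countably additive on Borel sets.\<close>

definition hausdorff_measure :: "nat \<Rightarrow> 'a::euclidean_space measure" where
  "hausdorff_measure d = measure_of UNIV (sets borel) (hausdorff_outer d)"

lemma hausdorff_content_mono: "A \<subseteq> B \<Longrightarrow> hausdorff_content d \<delta> A \<le> hausdorff_content d \<delta> B"
  unfolding hausdorff_content_def by (intro INF_superset_mono) auto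

lemma hausdorff_content_le_outer: "\<delta> > 0 \<Longrightarrow> hausdorff_content d \<delta> A \<le> hausdorff_outer d A"
  unfolding hausdorff_outer_def by (intro SUP_upper) auto

lemma hausdorff_content_antimono:
  "\<delta> \<le> \<epsilon> \<Longrightarrow> hausdorff_content d \<epsilon> A \<le> hausdorff_content d \<delta> A"
  unfolding hausdorff_content_def by (intro INF_superset_mono) (auto intro: order_trans)

lemma hausdorff_outer_mono: "A \<subseteq> B \<Longrightarrow> hausdorff_outer d A \<le> hausdorff_outer d B"
  unfolding hausdorff_outer_def by (intro SUP_mono) (auto intro: hausdorff_content_mono)

lemma hausdorff_outer_empty [simp]: "hausdorff_outer d {} = 0"
proof -
  have "hausdorff_content d \<delta> {} \<le> 0" if "\<delta> > 0" for \<delta>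
    unfolding hausdorff_content_def
    by (rule INF_lower2[of "\<lambda>_. {}"]) (use that in auto)
  then show ?thesis unfolding hausdorff_outer_def
    by (auto simp: SUP_eq_iff)
qed

lemma hausdorff_content_subadditive:
  "hausdorff_content d \<delta> (\<Union>i. A i) \<le> (\<Sum>i::nat. hausdorff_content d \<delta> (A i))"
proof (rule ennreal_le_epsilon)
  fix e :: real assume e: "0 < e" and fin: "(\<Sum>i. hausdorff_content d \<delta> (A i)) < top"
  define h :: "'a set \<Rightarrow> ennreal" where
    "h U = (if U = {} then 0 else ennreal (unit_ball_vol (real d) * (diameter U / 2) ^ d))" for U
  have "\<exists>U. A i \<subseteq> (\<Union>j. U j) \<and> (\<forall>j. bounded (U j) \<and> diameter (U j) \<le> \<delta>) \<and>
      (\<Sum>j::nat. h (U j)) \<le> hausdorff_content d \<delta> (A i) + ennreal (e * (1/2) ^ Suc i)" for i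
  proof -
    have "hausdorff_content d \<delta> (A i) < top"
      using fin by (metis ennreal_suminf_lessD)
    then have "hausdorff_content d \<delta> (A i) < hausdorff_content d \<delta> (A i) + ennreal (e * (1/2) ^ Suc i)"
      using e by (simp add: ennreal_add_left_cancel_less[where b=0, simplified] less_top ennreal_zero_less_mult_iff)
    then show ?thesis
      unfolding hausdorff_content_def INF_less_iff h_def by (auto intro: less_imp_le)
  qed
  then obtain U where U: "\<And>i. A i \<subseteq> (\<Union>j. U i j)" "\<And>i j. bounded (U i j) \<and> diameter (U i j) \<le> \<delta>"
    "\<And>i. (\<Sum>j::nat. h (U i j)) \<le> hausdorff_content d \<delta> (A i) + ennreal (e * (1/2) ^ Suc i)"
    by metis
  define W where "W k = (case prod_decode k of (i, j) \<Rightarrow> U i j)" for k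
  have W: "W (prod_encode (i, j)) = U i j" for i j
    by (simp add: W_def)
  have "hausdorff_content d \<delta> (\<Union>i. A i) \<le> (\<Sum>k. h (W k))"
    unfolding hausdorff_content_def h_def
  proof (rule INF_lower, safe)
    fix x i assume "x \<in> A i"
    then obtain j where "x \<in> U i j" using U(1)[of i] by blast
    then show "x \<in> (\<Union>k. W k)" using W[of i j] by (metis UN_I UNIV_I)
  qed (use U(2) in \<open>auto simp: W_def split: prod.splits\<close>)
  also have "\<dots> = (\<Sum>i. \<Sum>j. h (U i j))"
    using suminf_ennreal_2dimen[of "\<lambda>i. \<Sum>j. h (U i j)" "\<lambda>p. h (case p of (i, j) \<Rightarrow> U i j)"]
    by (simp add: W_def comp_def)
  also have "\<dots> \<le> (\<Sum>i. hausdorff_content d \<delta> (A i) + ennreal (e * (1/2) ^ Suc i))"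
    by (intro suminf_le U) auto
  also have "\<dots> = (\<Sum>i. hausdorff_content d \<delta> (A i)) + (\<Sum>i. ennreal (e * (1/2) ^ Suc i))"
    by (simp add: suminf_add)
  also have "(\<Sum>i. ennreal (e * (1/2) ^ Suc i)) = ennreal e"
    using e sums_mult[OF power_half_series, of e]
    by (intro sums_unique[symmetric]) (auto simp: sums_ennreal)
  finally show "hausdorff_content d \<delta> (\<Union>i. A i) \<le> (\<Sum>i. hausdorff_content d \<delta> (A i)) + ennreal e" .
qed

lemma hausdorff_outer_subadditive:
  "hausdorff_outer d (\<Union>i. A i) \<le> (\<Sum>i::nat. hausdorff_outer d (A i))"
  unfolding hausdorff_outer_def[of d "\<Union>i. A i"]
  by (intro SUP_least order_trans[OF hausdorff_content_subadditive] suminf_le hausdorff_content_le_outer)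
     auto

lemma outer_measure_space_hausdorff: "outer_measure_space UNIV (hausdorff_outer d)"
  by (auto simp: outer_measure_space_def positive_def increasing_def countably_subadditive_def
      intro: hausdorff_outer_mono hausdorff_outer_subadditive)

lemma hausdorff_outer_subadditive2:
  "hausdorff_outer d (A \<union> B) \<le> hausdorff_outer d A + hausdorff_outer d B"
  using hausdorff_outer_subadditive[of d "binaryset A B"]
    suminf_binaryset_eq[of "hausdorff_outer d" A B]
  by (simp add: UN_binaryset_eq)

lemma hausdorff_outer_separated:
  assumes r: "r > 0" and sep: "\<And>x y. x \<in> A \<Longrightarrow> y \<in> B \<Longrightarrow> r \<le> dist x y"
  shows "hausdorff_outer d A + hausdorff_outer d B \<le> hausdorff_outer d (A \<union> B)"
proof -
  define h :: "'a set \<Rightarrow> ennreal" where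
    "h U = (if U = {} then 0 else ennreal (unit_ball_vol (real d) * (diameter U / 2) ^ d))" for U
  have key: "hausdorff_content d \<delta> A + hausdorff_content d \<delta> B \<le> hausdorff_outer d (A \<union> B)"
    if "\<delta> > 0" for \<delta>
  proof -
    define \<eta> where "\<eta> = min \<delta> (r/2)"
    have \<eta>: "\<eta> > 0" "\<eta> \<le> \<delta>" "\<eta> < r" using r that by (auto simp: \<eta>_def)
    have "hausdorff_content d \<delta> A + hausdorff_content d \<delta> B \<le> (\<Sum>j. h (U j))"
      if U: "A \<union> B \<subseteq> (\<Union>j. U j)" "\<And>j. bounded (U j) \<and> diameter (U j) \<le> \<eta>" for U :: "nat \<Rightarrow> 'a set"
    proof -
      define P where "P j = (if U j \<inter> A = {} then {} else U j)" for j
      define Q where "Q j = (if U j \<inter> A = {} then U j else {})" for j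
      have "hausdorff_content d \<delta> A \<le> (\<Sum>j. h (P j))"
        unfolding hausdorff_content_def h_def
      proof (rule INF_lower, safe)
        fix x assume "x \<in> A"
        then obtain j where "x \<in> U j" using U(1) by blast
        then show "x \<in> (\<Union>k. P k)" using \<open>x \<in> A\<close> by (auto simp: P_def intro!: exI[of _ j])
      next
        fix j show "bounded (P j)" "diameter (P j) \<le> \<delta>"
          using U(2)[of j] \<eta> \<open>\<delta> > 0\<close> by (auto simp: P_def intro: order_trans)
      qed
      moreover have "hausdorff_content d \<delta> B \<le> (\<Sum>j. h (Q j))"
        unfolding hausdorff_content_def h_def
      proof (rule INF_lower, safe)
        fix x assume x: "x \<in> B"
        then obtain j where j: "x \<in> U j" using U(1) by blast
        have "U j \<inter> A = {}"
        proof (rule ccontr)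
          assume "U j \<inter> A \<noteq> {}"
          then obtain y where y: "y \<in> U j" "y \<in> A" by blast
          have "dist y x \<le> \<eta>"
            using diameter_bounded_bound[of "U j" y x] U(2)[of j] y j by auto
          then show False using sep[OF y(2) x] \<eta> by auto
        qed
        then show "x \<in> (\<Union>k. Q k)" using j by (auto simp: Q_def intro!: exI[of _ j])
      next
        fix j show "bounded (Q j)" "diameter (Q j) \<le> \<delta>"
          using U(2)[of j] \<eta> \<open>\<delta> > 0\<close> by (auto simp: Q_def intro: order_trans)
      qed
      moreover have "(\<Sum>j. h (P j)) + (\<Sum>j. h (Q j)) = (\<Sum>j. h (U j))"
        by (subst suminf_add) (auto intro!: suminf_cong simp: P_def Q_def h_def)
      ultimately show ?thesis by (metis add_mono)
    qed
    then have "hausdorff_content d \<delta> A + hausdorff_content d \<delta> B \<le> hausdorff_content d \<eta> (A \<union> B)"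
      unfolding hausdorff_content_def[of d \<eta>] h_def by (intro INF_greatest) auto
    then show ?thesis using hausdorff_content_le_outer[OF \<eta>(1)] order_trans by blast
  qed
  have "hausdorff_outer d A + hausdorff_outer d B =
      (SUP \<delta>\<in>{0<..}. hausdorff_content d \<delta> A + hausdorff_content d \<delta> B)"
    unfolding hausdorff_outer_def
  proof (rule SUP_add_directed_ennreal[symmetric])
    fix i j :: real assume "i \<in> {0<..}" "j \<in> {0<..}"
    then show "\<exists>k\<in>{0<..}. hausdorff_content d i A + hausdorff_content d j B
        \<le> hausdorff_content d k A + hausdorff_content d k B"
      by (intro bexI[of _ "min i j"] add_mono hausdorff_content_antimono) auto
  qed
  also have "\<dots> \<le> hausdorff_outer d (A \<union> B)"
    by (intro SUP_least key) auto
  finally show ?thesis .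
qed

lemma closed_hausdorff_lambda_system:
  fixes C :: "'a::euclidean_space set"
  assumes "closed C"
  shows "C \<in> lambda_system UNIV UNIV (hausdorff_outer d)"
proof (cases "C = {}")
  case True then show ?thesis by (simp add: lambda_system_def)
next
  case False
  let ?H = "hausdorff_outer d"
  have "?H (C \<inter> A) + ?H (A - C) \<le> ?H A" for A :: "'a set"
  proof (cases "?H A = top")
    case True then show ?thesis by simp
  next
    case fin: False
    define D where "D n = {x \<in> A. 1 / Suc n \<le> infdist x C}" for n
    define R where "R n = D (Suc n) - D n" for n
    have Dmono: "D n \<subseteq> D (Suc n)" for n
      unfolding D_def by (auto elim!: order_trans[rotated] simp: frac_le)
    have sepD: "?H (C \<inter> A) + ?H (D n) \<le> ?H A" for n
    proof -
      have "?H (C \<inter> A) + ?H (D n) \<le> ?H ((C \<inter> A) \<union> D n)"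
      proof (rule hausdorff_outer_separated[of "1 / Suc n"])
        fix x y assume "x \<in> C \<inter> A" "y \<in> D n"
        then show "1 / Suc n \<le> dist x y"
          using infdist_le[of x C y] by (auto simp: D_def dist_commute)
      qed auto
      also have "\<dots> \<le> ?H A" by (rule hausdorff_outer_mono) (auto simp: D_def)
      finally show ?thesis .
    qed
    have Rsep: "(\<Sum>k<n. ?H (R (2 * k + b))) \<le> ?H (\<Union>k<n. R (2 * k + b))" for n b
    proof (induction n)
      case (Suc n)
      show ?case
      proof (cases "n = 0")
        case True
        then show ?thesis by (simp add: lessThan_Suc)
      next
        case n: False
        have "(\<Sum>k<Suc n. ?H (R (2 * k + b))) \<le> ?H (\<Union>k<n. R (2 * k + b)) + ?H (R (2 * n + b))"
          using Suc by (simp add: add_right_mono)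
        also have "\<dots> \<le> ?H ((\<Union>k<n. R (2 * k + b)) \<union> R (2 * n + b))"
        proof (rule hausdorff_outer_separated)
          show "1 / real (2 * n + b) - 1 / real (Suc (2 * n + b)) > 0"
            using n by (simp add: frac_less2)
        next
          fix x y assume "x \<in> (\<Union>k<n. R (2 * k + b))" and y: "y \<in> R (2 * n + b)"
          then obtain k where k: "k < n" "x \<in> R (2 * k + b)" by auto
          have "1 / real (2 * n + b) \<le> 1 / real (Suc (Suc (2 * k + b)))"
            using k(1) by (intro frac_le) auto
          also have "\<dots> \<le> infdist x C"
            using k(2) by (auto simp: R_def D_def)
          finally have "1 / real (2 * n + b) \<le> infdist x C" .
          moreover have "infdist y C < 1 / real (Suc (2 * n + b))"
            using y by (auto simp: R_def D_def)
          ultimately show "1 / real (2 * n + b) - 1 / real (Suc (2 * n + b)) \<le> dist x y"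
            using infdist_triangle[of x C y] by linarith
        qed
        also have "(\<Union>k<n. R (2 * k + b)) \<union> R (2 * n + b) = (\<Union>k<Suc n. R (2 * k + b))"
          by (auto simp: less_Suc_eq)
        finally show ?thesis .
      qed
    qed simp
    have RA: "R k \<subseteq> A" for k by (auto simp: R_def D_def)
    have half: "(\<Sum>k<n. ?H (R (2 * k + b))) \<le> ?H A" for n b
      by (rule order_trans[OF Rsep hausdorff_outer_mono]) (use RA in auto)
    have "(\<Sum>k<n. ?H (R k)) \<le> ?H A + ?H A" for n
    proof -
      have "(\<Sum>k<n. ?H (R k)) \<le> (\<Sum>k<2 * n. ?H (R k))"
        by (intro sum_mono2) auto
      also have "\<dots> = (\<Sum>k<n. ?H (R (2 * k + 0))) + (\<Sum>k<n. ?H (R (2 * k + 1)))"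
        by (induction n) (auto simp: ac_simps)
      also have "\<dots> \<le> ?H A + ?H A"
        by (intro add_mono half)
      finally show ?thesis .
    qed
    then have "(\<Sum>k. ?H (R k)) \<le> ?H A + ?H A"
      by (intro suminf_le_const) auto
    then have S: "(\<Sum>k. ?H (R k)) \<noteq> top"
      using fin by (auto simp: top_unique)
    have DD: "A - C \<subseteq> D n \<union> (\<Union>k. R (k + n))" for n
    proof
      fix x assume x: "x \<in> A - C"
      then have "infdist x C > 0"
        using False assms infdist_pos_not_in_closed by blast
      then obtain N where "1 / real (Suc N) < infdist x C"
        using nat_approx_posE by blast
      then have ex: "\<exists>N. x \<in> D N" using x by (auto simp: D_def intro!: exI[of _ N])
      define N where "N = (LEAST N. x \<in> D N)"
      have N: "x \<in> D N" using ex unfolding N_def by (rule LeastI_ex)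
      show "x \<in> D n \<union> (\<Union>k. R (k + n))"
      proof (cases "N \<le> n")
        case True
        then show ?thesis using N lift_Suc_mono_le[of D N n] Dmono by auto
      next
        case False
        then obtain k where k: "N = Suc (k + n)"
          by (metis add.commute less_imp_Suc_add not_le)
        then have "x \<notin> D (k + n)"
          using not_less_Least[of "k + n" "\<lambda>N. x \<in> D N"] by (auto simp: N_def)
        then show ?thesis using N k by (auto simp: R_def)
      qed
    qed
    have "?H (C \<inter> A) + ?H (A - C) + (\<Sum>k<n. ?H (R k)) \<le> ?H A + (\<Sum>k. ?H (R k))" for n
    proof -
      have "?H (A - C) \<le> ?H (D n) + (\<Sum>k. ?H (R (k + n)))"
        by (intro order_trans[OF hausdorff_outer_mono[OF DD[of n]]]
            order_trans[OF hausdorff_outer_subadditive2] add_left_mono hausdorff_outer_subadditive)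
      then have "?H (C \<inter> A) + ?H (A - C) + (\<Sum>k<n. ?H (R k))
          \<le> (?H (C \<inter> A) + ?H (D n)) + ((\<Sum>k. ?H (R (k + n))) + (\<Sum>k<n. ?H (R k)))"
        by (simp add: ac_simps add_left_mono)
      also have "(\<Sum>k. ?H (R (k + n))) + (\<Sum>k<n. ?H (R k)) = (\<Sum>k. ?H (R k))"
        by (intro suminf_offset[symmetric]) auto
      finally show ?thesis
        using sepD[of n] by (meson add_right_mono order_trans)
    qed
    then have "?H (C \<inter> A) + ?H (A - C) + (SUP n. \<Sum>k<n. ?H (R k)) \<le> ?H A + (\<Sum>k. ?H (R k))"
      by (subst ennreal_SUP_add_right) (auto intro: SUP_least)
    then have "?H (C \<inter> A) + ?H (A - C) + (\<Sum>k. ?H (R k)) \<le> ?H A + (\<Sum>k. ?H (R k))"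
      by (simp add: suminf_eq_SUP)
    then show ?thesis
      using S by (simp add: ennreal_add_left_cancel_le add.commute[of _ "\<Sum>k. ?H (R k)"])
  qed
  moreover have "?H A \<le> ?H (C \<inter> A) + ?H (A - C)" for A
    using hausdorff_outer_subadditive2[of d "C \<inter> A" "A - C"] by (simp add: Int_Diff_Un Int_commute)
  ultimately show ?thesis
    by (auto simp: lambda_system_def Int_commute[of "- C"] Diff_eq[symmetric] Compl_eq_Diff_UNIV[symmetric]
        intro!: antisym)
qed

lemma emeasure_hausdorff_measure:
  assumes "A \<in> sets borel"
  shows "emeasure (hausdorff_measure d) A = hausdorff_outer d A"
proof -
  let ?L = "lambda_system UNIV UNIV (hausdorff_outer d) :: 'a set set"
  interpret sigma_algebra "UNIV :: 'a set" "UNIV :: 'a set set"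
    using sigma_algebra_Pow[of "UNIV :: 'a set"] by simp
  have ms: "measure_space UNIV ?L (hausdorff_outer d)"
    by (rule caratheodory_lemma[OF outer_measure_space_hausdorff])
  then have "sigma_algebra UNIV ?L" by (simp add: measure_space_def)
  from sigma_algebra.sigma_sets_subset[OF this, of "Collect closed"]
  have sub: "sets (borel :: 'a measure) \<subseteq> ?L"
    unfolding borel_eq_closed
    by (auto simp: closed_hausdorff_lambda_system subset_eq)
  show ?thesis
    unfolding hausdorff_measure_def
  proof (rule emeasure_measure_of_sigma)
    show "sigma_algebra UNIV (sets (borel :: 'a measure))"
      using sets.sigma_algebra_axioms[of "borel :: 'a measure"] by simp
    show "positive (sets borel) (hausdorff_outer d :: 'a set \<Rightarrow> ennreal)"
      by (simp add: positive_def)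
    show "countably_additive (sets borel) (hausdorff_outer d :: 'a set \<Rightarrow> ennreal)"
      using ms sub unfolding measure_space_def countably_additive_def by (meson order_trans subsetD)
  qed (rule assms)
qed

section \<open>Entropic multi-marginal optimal transport\<close>

definition measure_support :: "'a::topological_space measure \<Rightarrow> 'a set" where
  "measure_support M = {x \<in> space M. \<forall>U. open U \<and> x \<in> U \<longrightarrow> emeasure M (U \<inter> space M) > 0}"

definition borel_prob_measure_on :: "'a::topological_space set \<Rightarrow> 'a measure \<Rightarrow> bool" where
  "borel_prob_measure_on X M \<longleftrightarrow> prob_space M \<and> sets M = sets (restrict_space borel X)"

definition bounded_density_wrt :: "'a measure \<Rightarrow> 'a measure \<Rightarrow> bool" where
  "bounded_density_wrt H \<mu> \<longleftrightarrow>
    (\<exists>f \<in> borel_measurable H. (\<exists>K::real. AE x in H. f x \<le> ennreal K) \<and> \<mu> = density H f)"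

text \<open>The product \<open>X\<^sub>1 \<times> \<dots> \<times> X\<^sub>m\<close>, as a subset of the Euclidean space \<open>(\<real>\<^sup>N)\<^sup>m\<close>.\<close>

definition prod_set :: "('m \<Rightarrow> 'a set) \<Rightarrow> ('a ^ 'm::finite) set" where
  "prod_set X = {x. \<forall>i. x $ i \<in> X i}"

definition prod_measure ::
    "('m \<Rightarrow> 'a::euclidean_space set) \<Rightarrow> ('m \<Rightarrow> 'a measure) \<Rightarrow> ('a ^ 'm::finite) measure" where
  "prod_measure X \<mu> = distr (PiM UNIV \<mu>) (restrict_space borel (prod_set X)) vec_lambda"

lemma measurable_vec_lambda_prod_set:
  fixes X :: "'m::finite \<Rightarrow> 'a::euclidean_space set"
  assumes "\<And>i. borel_prob_measure_on (X i) (\<mu> i)"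
  shows "vec_lambda \<in> measurable (PiM UNIV \<mu>) (restrict_space borel (prod_set X))"
proof (rule measurable_restrict_space2)
  have sets: "sets (\<mu> i) = sets (restrict_space borel (X i))" for i
    using assms by (simp add: borel_prob_measure_on_def)
  then have space: "space (\<mu> i) = X i" for i
    by (simp add: sets_eq_imp_space_eq[OF sets] space_restrict_space)
  show "vec_lambda \<in> space (PiM UNIV \<mu>) \<rightarrow> prod_set X"
    by (auto simp: space_PiM prod_set_def space PiE_def Pi_def)
  have "(\<lambda>f. f i) \<in> borel_measurable (PiM UNIV \<mu>)" for i
  proof -
    have "(\<lambda>f. f i) \<in> measurable (PiM UNIV \<mu>) (restrict_space borel (X i))"
      using measurable_component_singleton[of i UNIV \<mu>]
        measurable_cong_sets[OF refl sets[of i], of "PiM UNIV \<mu>"] by simp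
    then show ?thesis by (simp add: measurable_restrict_space2_iff)
  qed
  then have "(\<lambda>f. vec_lambda f \<bullet> b) \<in> borel_measurable (PiM UNIV \<mu>)" for b :: "'a ^ 'm"
    by (simp add: inner_vec_def)
  then show "vec_lambda \<in> borel_measurable (PiM UNIV \<mu>)"
    by (subst borel_measurable_euclidean_space) simp
qed

definition couplings ::
    "('m \<Rightarrow> 'a::euclidean_space set) \<Rightarrow> ('m \<Rightarrow> 'a measure) \<Rightarrow> ('a ^ 'm::finite) measure set" where
  "couplings X \<mu> = {\<gamma>. borel_prob_measure_on (prod_set X) \<gamma> \<and>
     (\<forall>i. distr \<gamma> (restrict_space borel (X i)) (\<lambda>x. x $ i) = \<mu> i)}"

text \<open>The Lebesgue integral with values in the extended reals. It is only used for integrands whose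
  negative part has a finite integral (\<open>\<rho> log \<rho>\<close> is bounded below and the cost is nonnegative).\<close>

definition ext_integral :: "'a measure \<Rightarrow> ('a \<Rightarrow> real) \<Rightarrow> ereal" where
  "ext_integral M f =
    enn2ereal (\<integral>\<^sup>+ x. ennreal (f x) \<partial>M) - enn2ereal (\<integral>\<^sup>+ x. ennreal (- f x) \<partial>M)"

definition rel_entropy :: "'a measure \<Rightarrow> 'a measure \<Rightarrow> ereal" where
  "rel_entropy p q =
    (if sets p = sets q \<and> absolutely_continuous q p
     then ext_integral q (\<lambda>x. let \<rho> = enn2real (RN_deriv q p x) in \<rho> * ln \<rho>)
     else \<infinity>)"

definition MOT ::
    "('m \<Rightarrow> 'a::euclidean_space set) \<Rightarrow> ('m \<Rightarrow> 'a measure) \<Rightarrow> ('a ^ 'm::finite \<Rightarrow> real) \<Rightarrow> real \<Rightarrow> ereal" where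
  "MOT X \<mu> c \<epsilon> =
    (INF \<gamma>\<in>couplings X \<mu>. ext_integral \<gamma> c + ereal \<epsilon> * rel_entropy \<gamma> (prod_measure X \<mu>))"

definition MOT0 ::
    "('m \<Rightarrow> 'a::euclidean_space set) \<Rightarrow> ('m \<Rightarrow> 'a measure) \<Rightarrow> ('a ^ 'm::finite \<Rightarrow> real) \<Rightarrow> ereal" where
  "MOT0 X \<mu> c = (INF \<gamma>\<in>couplings X \<mu>. ext_integral \<gamma> c)"

end

theory Submission
  imports Defs
begin

text \<open>The competitor is a block approximation at scale \<open>\<delta> = \<surd>\<epsilon>\<close> of a nearly optimal plan: each
  marginal is cut into \<open>O (\<delta>\<^sup>-\<^sup>d)\<close> cells of diameter \<open>O (\<delta>)\<close>, and inside each product of cells the plan is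
  replaced by the normalized product measure. Bounding the mass of a block by the mass of its
  cell in the factor \<open>j\<close> of largest dimension, its entropy is at most the sum over \<open>i \<noteq> j\<close> of the
  logarithms of the numbers of cells.

  It remains to show that the cost increases by \<open>O (\<delta>\<^sup>2)\<close> only. Discretizing the marginals on a much
  finer scale yields a discrete plan and potentials with negligible duality gap, and their
  c-transforms \<open>\<phi>\<^sub>i\<close> satisfy \<open>\<phi>\<^sub>i y - \<phi>\<^sub>i x\<^sub>i \<le> c (x with x\<^sub>i replaced by y) - c x\<close> up to this gap on
  the support of the plan. Hence, up to \<open>O (\<delta>\<^sup>2)\<close>, the increment of \<open>c - \<Sum>\<phi>\<^sub>i\<close> over a block is bounded
  by second differences \<open>2 \<phi>\<^sub>i w - \<phi>\<^sub>i (w + v) - \<phi>\<^sub>i (w - v)\<close> in charts. As \<open>\<phi>\<^sub>i\<close> is semiconcave and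
  Lipschitz, these are controlled by discrete Laplacians at lattice points, whose sum over the
  lattice telescopes to \<open>O (\<delta>\<^sup>2\<^sup>-\<^sup>d)\<close>; the bounded density gives each cell mass \<open>O (\<delta>\<^sup>d)\<close>.\<close>

section \<open>Second-order Taylor bounds\<close>

text \<open>The scale balances two errors: with O(\<delta>^-d) cells in a factor, its share of the
  entropy term is \<open>\<epsilon> * d * ln (1 / \<delta>)\<close>, which is d/2 times
  \<open>\<epsilon> * ln (1 / \<epsilon>)\<close>, up to O(\<epsilon>). This is the origin of the
  factor 1/2, and it leaves room for a cost increase of order \<epsilon> only. The obstacle is that
  spreading mass over a block changes the cost by order \<delta> in general. The first-order change
  is matched by the potentials, whose integrals depend on the marginals alone and hence cancel. But
  potentials are semiconcave and may have kinks, so on a single cell the remaining defect can still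
  be of order \<delta>. One-sided curvature limits the total amount of kinks, hence the defect is
  O(\<delta>^2) only on average over the cells; this average is taken with the marginals, and the
  bounded densities make it comparable to the plain average over a lattice. Potentials are taken
  from a finite problem because there they maximise an explicit smooth function. The fine scale may
  depend on \<epsilon> in any way, as only the gap and the oscillation of \<open>c\<close>, both at
  most \<epsilon>, enter the estimate.\<close>

definition taylor_on ::
    "real \<Rightarrow> 'a::real_normed_vector set \<Rightarrow> ('a \<Rightarrow> 'b::real_normed_vector) \<Rightarrow> bool" where
  "taylor_on C S f \<longleftrightarrow> 0 \<le> C \<and>
    (\<forall>x\<in>S. \<exists>A. linear A \<and> (\<forall>h. norm (A h) \<le> C * norm h) \<and>
      (\<forall>y\<in>S. norm (f y - f x - A (y - x)) \<le> C * (norm (y - x))\<^sup>2))"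

lemma taylor_on_nonneg: "taylor_on C S f \<Longrightarrow> 0 \<le> C"
  by (simp add: taylor_on_def)

lemma taylor_onE:
  assumes "taylor_on C S f" "x \<in> S"
  obtains A where "linear A" "\<And>h. norm (A h) \<le> C * norm h"
    "\<And>y. y \<in> S \<Longrightarrow> norm (f y - f x - A (y - x)) \<le> C * (norm (y - x))\<^sup>2"
  using assms unfolding taylor_on_def by blast

lemma taylor_on_mono:
  assumes "taylor_on C S f" "T \<subseteq> S" "C \<le> D"
  shows "taylor_on D T f"
  unfolding taylor_on_def
proof (intro conjI ballI)
  show "0 \<le> D" using assms taylor_on_nonneg[OF assms(1)] by simp
  fix x assume "x \<in> T"
  then obtain A where A: "linear A" "\<And>h. norm (A h) \<le> C * norm h"
    "\<And>y. y \<in> S \<Longrightarrow> norm (f y - f x - A (y - x)) \<le> C * (norm (y - x))\<^sup>2"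
    using taylor_onE[OF assms(1)] assms(2) by blast
  have "C * t \<le> D * t" if "0 \<le> t" for t using that assms(3) by (simp add: mult_right_mono)
  then show "\<exists>A. linear A \<and> (\<forall>h. norm (A h) \<le> D * norm h) \<and>
      (\<forall>y\<in>T. norm (f y - f x - A (y - x)) \<le> D * (norm (y - x))\<^sup>2)"
    using A assms(2) by (meson norm_ge_zero order_trans subsetD zero_le_power2)
qed

lemma taylor_on_cong:
  assumes "taylor_on C S f" "\<And>x. x \<in> S \<Longrightarrow> g x = f x"
  shows "taylor_on C S g"
  using assms unfolding taylor_on_def by simp

lemma taylor_on_lipschitz:
  assumes "taylor_on C S f" "x \<in> S" "y \<in> S" "norm (y - x) \<le> D"
  shows "norm (f y - f x) \<le> C * (1 + D) * norm (y - x)"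
proof -
  obtain A where A: "\<And>h. norm (A h) \<le> C * norm h"
    "norm (f y - f x - A (y - x)) \<le> C * (norm (y - x))\<^sup>2"
    using taylor_onE[OF assms(1,2)] assms(3) by metis
  have C: "0 \<le> C" using taylor_on_nonneg[OF assms(1)] .
  have "norm (f y - f x) \<le> norm (f y - f x - A (y - x)) + norm (A (y - x))"
    using norm_triangle_ineq[of "f y - f x - A (y - x)" "A (y - x)"] by simp
  also have "\<dots> \<le> C * (norm (y - x) * norm (y - x)) + C * norm (y - x)"
    using A(1)[of "y - x"] A(2) by (simp add: power2_eq_square)
  also have "\<dots> \<le> C * (D * norm (y - x)) + C * norm (y - x)"
    using assms(4) C by (intro add_mono mult_left_mono mult_right_mono) auto
  finally show ?thesis by (simp add: algebra_simps)
qed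

text \<open>The linearisation is the composition of the two linearisations. The error has two parts:
  the remainder of \<open>g\<close> at the increment of \<open>f\<close>, where the Lipschitz
  constant of \<open>f\<close> enters squared, and the image of the remainder of \<open>f\<close>.
  The bound \<open>R\<close> on the diameter of \<open>S\<close> supplies that Lipschitz
  constant.\<close>

lemma taylor_on_compose:
  assumes f: "taylor_on C S f" and g: "taylor_on D T g" and "f ` S \<subseteq> T"
    and diam: "\<And>x y. x \<in> S \<Longrightarrow> y \<in> S \<Longrightarrow> norm (y - x) \<le> R"
  shows "taylor_on (C * D + D * (C * (1 + \<bar>R\<bar>))\<^sup>2) S (\<lambda>x. g (f x))"
  unfolding taylor_on_def
proof (intro conjI ballI)
  let ?E = "C * D + D * (C * (1 + \<bar>R\<bar>))\<^sup>2"
  have C: "0 \<le> C" and D: "0 \<le> D" using f g taylor_on_nonneg by blast+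
  then show "0 \<le> ?E" by simp
  fix x assume x: "x \<in> S"
  obtain A where A: "linear A" "\<And>h. norm (A h) \<le> C * norm h"
    "\<And>y. y \<in> S \<Longrightarrow> norm (f y - f x - A (y - x)) \<le> C * (norm (y - x))\<^sup>2"
    using taylor_onE[OF f x] by metis
  have "f x \<in> T" using x assms(3) by auto
  then obtain B where B: "linear B" "\<And>h. norm (B h) \<le> D * norm h"
    "\<And>y. y \<in> T \<Longrightarrow> norm (g y - g (f x) - B (y - f x)) \<le> D * (norm (y - f x))\<^sup>2"
    using taylor_onE[OF g] by metis
  have le: "C * D \<le> ?E" using D by simp
  show "\<exists>A. linear A \<and> (\<forall>h. norm (A h) \<le> ?E * norm h) \<and>
      (\<forall>y\<in>S. norm (g (f y) - g (f x) - A (y - x)) \<le> ?E * (norm (y - x))\<^sup>2)"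
  proof (intro exI[of _ "\<lambda>h. B (A h)"] conjI allI ballI)
    show "linear (\<lambda>h. B (A h))" using linear_compose[OF A(1) B(1)] by (simp add: o_def)
    fix h
    have "norm (B (A h)) \<le> D * (C * norm h)"
      using B(2)[of "A h"] mult_left_mono[OF A(2)[of h] D] by linarith
    also have "\<dots> \<le> ?E * norm h"
      using mult_right_mono[OF le norm_ge_zero[of h]] by (simp add: mult.assoc mult.left_commute)
    finally show "norm (B (A h)) \<le> ?E * norm h" .
  next
    fix y assume y: "y \<in> S"
    have fy: "norm (f y - f x) \<le> C * (1 + \<bar>R\<bar>) * norm (y - x)"
      by (rule taylor_on_lipschitz[OF f x y]) (use diam[OF x y] in linarith)
    have "g (f y) - g (f x) - B (A (y - x)) =
        (g (f y) - g (f x) - B (f y - f x)) + B (f y - f x - A (y - x))"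
      using linear_diff[OF B(1)] by simp
    then have "norm (g (f y) - g (f x) - B (A (y - x))) \<le>
        norm (g (f y) - g (f x) - B (f y - f x)) + norm (B (f y - f x - A (y - x)))"
      by (metis norm_triangle_ineq)
    also have "\<dots> \<le> D * (norm (f y - f x))\<^sup>2 + D * norm (f y - f x - A (y - x))"
      using B(2)[of "f y - f x - A (y - x)"] B(3)[of "f y"] y assms(3) by (intro add_mono) auto
    also have "\<dots> \<le> D * (C * (1 + \<bar>R\<bar>) * norm (y - x))\<^sup>2 + D * (C * (norm (y - x))\<^sup>2)"
      using D fy A(3)[OF y] by (intro add_mono mult_left_mono power_mono) auto
    finally show "norm (g (f y) - g (f x) - B (A (y - x))) \<le> ?E * (norm (y - x))\<^sup>2"
      unfolding power_mult_distrib by (simp only: distrib_right mult.assoc) (simp only: ac_simps)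
  qed
qed

lemma taylor_on_second_difference:
  fixes f :: "'a::real_normed_vector \<Rightarrow> real"
  assumes "taylor_on C S f" "x \<in> S" "x + h \<in> S" "x - h \<in> S"
  shows "\<bar>f (x + h) + f (x - h) - 2 * f x\<bar> \<le> 2 * C * (norm h)\<^sup>2"
proof -
  obtain A where A: "linear A" 
    "\<And>y. y \<in> S \<Longrightarrow> norm (f y - f x - A (y - x)) \<le> C * (norm (y - x))\<^sup>2"
    using taylor_onE[OF assms(1,2)] by metis
  have "\<bar>f (x + h) - f x - A h\<bar> \<le> C * (norm h)\<^sup>2" "\<bar>f (x - h) - f x + A h\<bar> \<le> C * (norm h)\<^sup>2"
    using A(2)[OF assms(3)] A(2)[OF assms(4)] linear_neg[OF A(1), of h] by simp_all
  then show ?thesis by linarith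
qed

text \<open>C2 regularity is used through \<open>taylor_on\<close> from here on: unlike a derivative
  it makes sense on sets that are neither open nor convex, hence it passes to submanifolds, charts
  and slices. Continuity of \<open>f''\<close> at \<open>p\<close> makes \<open>f'\<close> Lipschitz
  on a small ball, and the mean value inequality along segments gives the quadratic
  remainder.\<close>

lemma C2_on_imp_taylor_on:
  fixes f :: "'a::euclidean_space \<Rightarrow> 'b::euclidean_space"
  assumes "C2_on U f" "p \<in> U"
  obtains r C where "r > 0" "ball p r \<subseteq> U" "taylor_on C (ball p r) f"
proof -
  obtain f' :: "'a \<Rightarrow> ('a, 'b) blinfun" and f'' :: "'a \<Rightarrow> ('a, ('a, 'b) blinfun) blinfun" where
    U: "open U" and f': "\<And>x. x \<in> U \<Longrightarrow> (f has_derivative blinfun_apply (f' x)) (at x)"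
    and f'': "\<And>x. x \<in> U \<Longrightarrow> (f' has_derivative blinfun_apply (f'' x)) (at x)"
    and cont: "continuous_on U f''"
    using assms(1) unfolding C2_on_def by blast
  have "isCont f'' p" using U cont assms(2) continuous_on_eq_continuous_at by blast
  then obtain r1 where r1: "r1 > 0" "\<And>x. dist x p < r1 \<Longrightarrow> dist (f'' x) (f'' p) < 1"
    unfolding continuous_at_eps_delta by (metis zero_less_one)
  obtain r2 where r2: "r2 > 0" "ball p r2 \<subseteq> U" using U assms(2) openE by blast
  define r where "r = min r1 r2"
  define B where "B = norm (f'' p) + 1"
  \<comment> \<open>One constant has to bound both slope and remainder: on the ball the slope is at
    most \<open>norm (f' p) + B * r\<close>, and the remainder carries the factor
    \<open>B\<close>.\<close>
  define C where "C = B + norm (f' p) + B * r"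
  have r: "r > 0" "ball p r \<subseteq> U" using r1 r2 by (auto simp: r_def)
  have B0: "0 \<le> B" by (simp add: B_def)
  have B: "norm (f'' x) \<le> B" if "x \<in> ball p r" for x
  proof -
    have "dist x p < r1" using that by (simp add: r_def dist_commute)
    then have "dist (f'' x) (f'' p) < 1" by (rule r1(2))
    then show ?thesis using norm_triangle_ineq2[of "f'' x" "f'' p"] by (simp add: B_def dist_norm)
  qed
  have lip: "norm (f' x - f' y) \<le> B * norm (x - y)" if "x \<in> ball p r" "y \<in> ball p r" for x y
  proof (rule differentiable_bound[of "ball p r"])
    fix z assume z: "z \<in> ball p r"
    show "(f' has_derivative blinfun_apply (f'' z)) (at z within ball p r)"
      using f'' r(2) z has_derivative_at_withinI by blast
    show "onorm (blinfun_apply (f'' z)) \<le> B" using B[OF z] by (simp add: norm_blinfun.rep_eq)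
  qed (use that in auto)
  have CB: "B \<le> C" using r by (simp add: C_def B_def)
  have "taylor_on C (ball p r) f"
    unfolding taylor_on_def
  proof (intro conjI ballI)
    show "0 \<le> C" using r B0 by (simp add: C_def)
    fix x assume x: "x \<in> ball p r"
    show "\<exists>A. linear A \<and> (\<forall>h. norm (A h) \<le> C * norm h) \<and>
        (\<forall>y\<in>ball p r. norm (f y - f x - A (y - x)) \<le> C * (norm (y - x))\<^sup>2)"
    proof (intro exI[of _ "blinfun_apply (f' x)"] conjI allI ballI)
      show "linear (blinfun_apply (f' x))" by (simp add: bounded_linear.linear blinfun.bounded_linear_right)
      have "norm (f' x) \<le> norm (f' p) + B * r"
      proof -
        have "norm (f' x) \<le> norm (f' p) + norm (f' x - f' p)"
          using norm_triangle_ineq[of "f' p" "f' x - f' p"] by simp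
        also have "norm (f' x - f' p) \<le> B * norm (x - p)" using lip[of x p] x r by simp
        also have "\<dots> \<le> B * r"
          using x B0 by (intro mult_left_mono) (auto simp: dist_norm norm_minus_commute)
        finally show ?thesis by simp
      qed
      also have "\<dots> \<le> C" using B0 by (simp add: C_def)
      finally have "norm (f' x) \<le> C" .
      then show "norm (blinfun_apply (f' x) h) \<le> C * norm h" for h
        by (meson mult_right_mono norm_blinfun norm_ge_zero order_trans)
      fix y assume y: "y \<in> ball p r"
      have seg: "closed_segment x y \<subseteq> ball p r"
        using x y by (intro closed_segment_subset) auto
      have "norm (f y - f x - blinfun_apply (f' x) (y - x)) \<le> norm (y - x) * (B * norm (y - x))"
      proof (rule differentiable_bound_linearization[of x y "closed_segment x y" f "\<lambda>z. blinfun_apply (f' z)" x])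
        fix t :: real assume "t \<in> {0..1}"
        then show "x + t *\<^sub>R (y - x) \<in> closed_segment x y"
          by (auto simp: in_segment algebra_simps intro!: exI[of _ t])
      next
        fix z assume z: "z \<in> closed_segment x y"
        then show "(f has_derivative blinfun_apply (f' z)) (at z within closed_segment x y)"
          using f' r(2) seg has_derivative_at_withinI by blast
        have "onorm (\<lambda>h. blinfun_apply (f' z) h - blinfun_apply (f' x) h) = norm (f' z - f' x)"
          by (simp add: norm_blinfun.rep_eq minus_blinfun.rep_eq)
        also have "\<dots> \<le> B * norm (z - x)" using lip z seg x by blast
        also have "\<dots> \<le> B * norm (y - x)"
          using segment_bound1[OF z] B0 by (intro mult_left_mono) auto
        finally show "onorm (blinfun_apply (f' z) - blinfun_apply (f' x)) \<le> B * norm (y - x)" 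
          by (simp add: fun_diff_def)
      qed auto
      also have "\<dots> = B * (norm (y - x))\<^sup>2" by (simp add: power2_eq_square)
      also have "\<dots> \<le> C * (norm (y - x))\<^sup>2" using CB by (simp add: mult_right_mono)
      finally show "norm (f y - f x - blinfun_apply (f' x) (y - x)) \<le> C * (norm (y - x))\<^sup>2" .
    qed
  qed
  with r show ?thesis using that by blast
qed

text \<open>Lebesgue number argument: \<open>K\<close> is covered by finitely many balls of half the
  local radius, and a ball of the smallest half radius around any \<open>p\<close> in
  \<open>K\<close> stays inside one of the full balls.\<close>

lemma taylor_on_uniform:
  fixes K :: "'a::real_normed_vector set"
  assumes "compact K" and loc: "\<And>p. p \<in> K \<Longrightarrow> \<exists>r>0. \<exists>C. taylor_on C (ball p r \<inter> X) f"
  obtains r C where "r > 0" "0 \<le> C" "\<And>p. p \<in> K \<Longrightarrow> taylor_on C (ball p r \<inter> X) f"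
proof -
  obtain r C where rC: "\<And>p. p \<in> K \<Longrightarrow> r p > 0 \<and> taylor_on (C p) (ball p (r p) \<inter> X) f"
    using loc by metis
  obtain F where F: "F \<subseteq> K" "finite F" "K \<subseteq> (\<Union>p\<in>F. ball p (r p / 2))"
  proof (rule compactE_image[OF assms(1), of K "\<lambda>p. ball p (r p / 2)"])
    show "K \<subseteq> (\<Union>p\<in>K. ball p (r p / 2))"
    proof
      fix p assume "p \<in> K"
      then show "p \<in> (\<Union>p\<in>K. ball p (r p / 2))" using rC[of p] by (intro UN_I[of p]) auto
    qed
  qed auto
  \<comment> \<open>The inserted elements \<open>1\<close> and \<open>0\<close> keep
    \<open>Min\<close> and \<open>Max\<close> meaningful for empty \<open>K\<close>; the
    \<open>0\<close> also makes \<open>C'\<close> nonnegative.\<close>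
  define r' where "r' = Min (insert 1 ((\<lambda>p. r p / 2) ` F))"
  define C' where "C' = Max (insert 0 (C ` F))"
  have "r' > 0" unfolding r'_def using F rC by (subst Min_gr_iff) auto
  moreover have "0 \<le> C'" unfolding C'_def using F by simp
  moreover have "taylor_on C' (ball p r' \<inter> X) f" if "p \<in> K" for p
  proof -
    obtain q where q: "q \<in> F" "p \<in> ball q (r q / 2)" 
      using subsetD[OF F(3) \<open>p \<in> K\<close>] by (rule UN_E)
    have "r' \<le> r q / 2" unfolding r'_def using q F by (intro Min_le) auto
    have "ball p r' \<subseteq> ball q (r q)"
    proof
      fix x assume "x \<in> ball p r'"
      then have "dist p x < r'" by simp
      moreover have "dist q p < r q / 2" using q by simp
      ultimately have "dist q x < r q"
        using \<open>r' \<le> r q / 2\<close> dist_triangle[of q x p] by linarith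
      then show "x \<in> ball q (r q)" by simp
    qed
    moreover have "C q \<le> C'" unfolding C'_def using q F by (intro Max_ge) auto
    ultimately show ?thesis
      using rC[OF subsetD[OF F(1) q(1)]]
      by (intro taylor_on_mono[of "C q" "ball q (r q) \<inter> X" f "ball p r' \<inter> X"]) auto
  qed
  ultimately show ?thesis by (rule that)
qed

section \<open>Discrete multi-marginal duality\<close>

text \<open>Coercivity of the smoothed dual functional, one configuration at a time: for large
  \<open>T\<close> the exponential beats linear growth, for negative \<open>T\<close> the linear
  term alone decreases. The error term \<open>2 * \<bar>e\<bar>\<close> does not involve
  \<open>T\<close>.\<close>

lemma entropic_term_bound:
  fixes T \<tau> p e :: real
  assumes "\<tau> > 0" "0 \<le> p" "p \<le> 1"
  shows "p * T - \<tau> * exp ((T - e) / \<tau>) \<le> 2 * \<bar>e\<bar> - p * \<bar>T\<bar>"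
proof (cases "T \<ge> 0")
  case True
  \<comment> \<open>The tangent inequality for \<open>exp\<close> after a shift by
    \<open>ln 2\<close>: the exponential term then grows at least with slope 2 in \<open>T\<close>,
    one unit more than \<open>p * T\<close> can consume.\<close>
  have "2 * (1 + ((T - e) / \<tau> - ln 2)) \<le> 2 * exp ((T - e) / \<tau> - ln 2)"
    by (intro mult_left_mono exp_ge_add_one_self) auto
  also have "\<dots> = exp ((T - e) / \<tau>)" by (simp add: exp_diff)
  finally have "\<tau> * (2 * (1 + ((T - e) / \<tau> - ln 2))) \<le> \<tau> * exp ((T - e) / \<tau>)"
    using assms by (intro mult_left_mono) auto
  moreover have "\<tau> * (2 * (1 + ((T - e) / \<tau> - ln 2))) = 2 * (T - e) + 2 * \<tau> * (1 - ln 2)"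
    using assms(1) by (simp add: field_simps)
  moreover have "0 \<le> 2 * \<tau> * (1 - ln 2)" using assms(1) ln_2_less_1 by simp
  ultimately have "2 * (T - e) \<le> \<tau> * exp ((T - e) / \<tau>)" by linarith
  moreover have "p * T \<le> 1 * T" using True assms by (intro mult_right_mono) auto
  ultimately have "p * T - \<tau> * exp ((T - e) / \<tau>) \<le> 2 * \<bar>e\<bar> - p * T"
    using abs_ge_self[of e] by (simp add: algebra_simps)
  then show ?thesis using True by simp
next
  case False
  have "0 \<le> \<tau> * exp ((T - e) / \<tau>)" using assms by simp
  then show ?thesis using False by (simp add: abs_if)
qed

lemma compact_function_box:
  fixes S :: "'a \<Rightarrow> real set"
  assumes "\<And>i. compact (S i)"
  shows "compact {f. \<forall>i. f i \<in> S i}"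
proof -
  have "compactin (product_topology (\<lambda>_. euclidean) UNIV) (PiE UNIV S)"
    using assms by (subst compactin_PiE) (simp add: compactin_euclidean_iff)
  then show ?thesis
    by (simp add: euclidean_product_topology compactin_euclidean_iff PiE_UNIV_domain Pi_def)
qed

lemma sum_prod_fun_UNIV:
  fixes f :: "'m::finite \<Rightarrow> 'b \<Rightarrow> 'c::comm_semiring_1"
  assumes "\<And>i. finite (G i)"
  shows "(\<Sum>x\<in>PiE UNIV G. \<Prod>i\<in>UNIV. f i (x i)) = (\<Prod>i\<in>UNIV. \<Sum>g\<in>G i. f i g)"
  using assms by (subst prod_sum_PiE) auto

lemma sum_product_marginal:
  fixes a :: "'m::finite \<Rightarrow> 'b \<Rightarrow> real"
  assumes "\<And>i. finite (G i)" "\<And>i. (\<Sum>g\<in>G i. a i g) = 1"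
  shows "(\<Sum>x\<in>PiE UNIV G. (\<Prod>j\<in>UNIV. a j (x j)) * u (x i)) = (\<Sum>g\<in>G i. a i g * u g)"
proof -
  have "(\<Prod>j\<in>UNIV. a j (x j)) * u (x i) = (\<Prod>j\<in>UNIV. a j (x j) * (if j = i then u (x j) else 1))" for x
    by (simp add: prod.distrib)
  then have "(\<Sum>x\<in>PiE UNIV G. (\<Prod>j\<in>UNIV. a j (x j)) * u (x i)) =
     (\<Prod>j\<in>UNIV. \<Sum>g\<in>G j. a j g * (if j = i then u g else 1))"
    by (simp add: sum_prod_fun_UNIV[OF assms(1), of "\<lambda>j g. a j g * (if j = i then u g else 1)"])
  also have "\<dots> = (\<Prod>j\<in>UNIV. if j = i then \<Sum>g\<in>G i. a i g * u g else 1)"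
    by (intro prod.cong) (auto simp: assms)
  finally show ?thesis by simp
qed

lemma sum_marginal:
  fixes P :: "('m \<Rightarrow> 'b) \<Rightarrow> real"
  assumes "finite \<Omega>" "finite A" "\<And>x. x \<in> \<Omega> \<Longrightarrow> x i \<in> A"
    and "\<And>g. g \<in> A \<Longrightarrow> (\<Sum>x\<in>{x\<in>\<Omega>. x i = g}. P x) = a g"
  shows "(\<Sum>x\<in>\<Omega>. P x * u (x i)) = (\<Sum>g\<in>A. a g * u g)"
proof -
  have "(\<Sum>x\<in>\<Omega>. P x * u (x i)) = (\<Sum>g\<in>A. \<Sum>x\<in>{x\<in>\<Omega>. x i = g}. P x * u (x i))"
    using assms(1-3) by (intro sum.group[symmetric]) auto
  also have "\<dots> = (\<Sum>g\<in>A. (\<Sum>x\<in>{x\<in>\<Omega>. x i = g}. P x) * u g)"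
    by (intro sum.cong refl) (simp add: sum_distrib_right)
  finally show ?thesis using assms(4) by simp
qed

text \<open>\<open>D\<close> depends on \<open>f\<close> only through the sums \<open>T f\<close>,
  so constants can be moved between the potentials and superlevel sets need not be bounded. The
  normalisation \<open>N\<close> fixes these constants without changing \<open>D\<close>; the
  coercive bound then confines the candidates to a compact box.\<close>

lemma discrete_duality_max:
  fixes G :: "'m::finite \<Rightarrow> 'b set" and a :: "'m \<Rightarrow> 'b \<Rightarrow> real" and c :: "('m \<Rightarrow> 'b) \<Rightarrow> real"
  assumes fin: "\<And>i. finite (G i)" and pos: "\<And>i g. g \<in> G i \<Longrightarrow> 0 < a i g"
    and one: "\<And>i. (\<Sum>g\<in>G i. a i g) = 1" and \<tau>: "\<tau> > 0"
  defines "D \<equiv> \<lambda>f :: 'm \<times> 'b \<Rightarrow> real. (\<Sum>i\<in>UNIV. \<Sum>g\<in>G i. a i g * f (i, g)) -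
      \<tau> * (\<Sum>x\<in>PiE UNIV G. exp (((\<Sum>i\<in>UNIV. f (i, x i)) - c x) / \<tau>))"
  shows "\<exists>f. \<forall>h. D h \<le> D f"
proof -
  define \<Omega> where "\<Omega> = PiE UNIV G"
  define \<pi> where "\<pi> x = (\<Prod>j\<in>UNIV. a j (x j))" for x
  define T where "T f x = (\<Sum>i\<in>UNIV. f (i, x i))" for f :: "'m \<times> 'b \<Rightarrow> real" and x
  have fin\<Omega>: "finite \<Omega>" unfolding \<Omega>_def using fin by (intro finite_PiE) auto
  have ne: "G i \<noteq> {}" for i using one[of i] by auto
  then obtain x0 where x0: "\<And>i. x0 i \<in> G i" unfolding ex_in_conv[symmetric] by metis
  have x0\<Omega>: "x0 \<in> \<Omega>" using x0 by (auto simp: \<Omega>_def)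
  have \<pi>pos: "0 < \<pi> x" if "x \<in> \<Omega>" for x
    using that pos unfolding \<pi>_def \<Omega>_def by (intro prod_pos) auto
  have \<pi>1: "\<pi> x \<le> 1" if "x \<in> \<Omega>" for x
  proof -
    have "\<pi> x \<le> (\<Sum>x\<in>\<Omega>. \<pi> x)" using that fin\<Omega> \<pi>pos by (intro member_le_sum) (auto intro: less_imp_le)
    also have "\<dots> = 1" unfolding \<Omega>_def \<pi>_def using sum_prod_fun_UNIV[OF fin, of a] one by simp
    finally show ?thesis .
  qed
  \<comment> \<open>Averages under the single \<open>a i\<close> are averages under the product
    weight \<open>\<pi>\<close>, which turns \<open>D\<close> into a sum of terms to which
    \<open>entropic_term_bound\<close> applies.\<close>
  have D: "D f = (\<Sum>x\<in>\<Omega>. \<pi> x * T f x - \<tau> * exp ((T f x - c x) / \<tau>))" for f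
  proof -
    have "(\<Sum>x\<in>\<Omega>. \<pi> x * T f x) = (\<Sum>i\<in>UNIV. \<Sum>x\<in>\<Omega>. \<pi> x * f (i, x i))"
      unfolding T_def sum_distrib_left by (rule sum.swap)
    also have "\<dots> = (\<Sum>i\<in>UNIV. \<Sum>g\<in>G i. a i g * f (i, g))"
      unfolding \<pi>_def \<Omega>_def using sum_product_marginal[OF fin one] by (intro sum.cong) auto
    finally show ?thesis unfolding D_def \<Omega>_def[symmetric] T_def[symmetric]
      by (simp add: sum_subtractf sum_distrib_left)
  qed
  have Dbound: "(\<Sum>x\<in>\<Omega>. \<pi> x * \<bar>T f x\<bar>) \<le> 2 * (\<Sum>x\<in>\<Omega>. \<bar>c x\<bar>) - D f" for f
  proof -
    have "D f \<le> (\<Sum>x\<in>\<Omega>. 2 * \<bar>c x\<bar> - \<pi> x * \<bar>T f x\<bar>)"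
      unfolding D using \<pi>pos \<pi>1
      by (intro sum_mono entropic_term_bound[OF \<tau>]) (auto intro: less_imp_le)
    then show ?thesis by (simp add: sum_subtractf sum_distrib_left)
  qed
  define W where "W = 2 * (\<Sum>x\<in>\<Omega>. \<bar>c x\<bar>) - D (\<lambda>_. 0)"
  have W0: "0 \<le> W"
  proof -
    have "0 \<le> (\<Sum>x\<in>\<Omega>. \<pi> x * \<bar>T (\<lambda>_. 0) x\<bar>)" using \<pi>pos
      by (intro sum_nonneg mult_nonneg_nonneg) (auto intro: less_imp_le)
    with Dbound[of "\<lambda>_. 0"] show ?thesis by (simp add: W_def)
  qed
  define R0 where "R0 = (\<Sum>x\<in>\<Omega>. W / \<pi> x)"
  have TR: "\<bar>T f x\<bar> \<le> R0" if "D (\<lambda>_. 0) \<le> D f" "x \<in> \<Omega>" for f x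
  proof -
    have "\<pi> x * \<bar>T f x\<bar> \<le> (\<Sum>x\<in>\<Omega>. \<pi> x * \<bar>T f x\<bar>)"
      using that fin\<Omega> \<pi>pos
      by (intro member_le_sum mult_nonneg_nonneg) (auto intro: less_imp_le)
    also have "\<dots> \<le> W" using Dbound[of f] that by (simp add: W_def)
    finally have "\<bar>T f x\<bar> \<le> W / \<pi> x" using \<pi>pos[OF that(2)] by (simp add: field_simps)
    also have "\<dots> \<le> R0" unfolding R0_def
      using that fin\<Omega> \<pi>pos W0 by (intro member_le_sum[of x]) (auto intro: divide_nonneg_pos)
    finally show ?thesis .
  qed
  define i0 :: 'm where "i0 = undefined"
  \<comment> \<open>All constants are moved to the factor \<open>i0\<close>: the other potentials
    vanish at the base point \<open>x0\<close>, and the one at \<open>i0\<close> becomes a value of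
    \<open>T f\<close>. Bounds on \<open>T f\<close> thus bound every single coordinate.\<close>
  define N where "N f = (\<lambda>p. if snd p \<in> G (fst p) then
      (if fst p = i0 then T f (x0(i0 := snd p)) else f p - f (fst p, x0 (fst p))) else 0)"
    for f :: "'m \<times> 'b \<Rightarrow> real"
  have TN: "T (N f) x = T f x" if "x \<in> \<Omega>" for f x
  proof -
    have xG: "x i \<in> G i" for i using that by (auto simp: \<Omega>_def)
    have "T (N f) x = T f (x0(i0 := x i0)) + (\<Sum>i\<in>UNIV-{i0}. f (i, x i) - f (i, x0 i))"
      unfolding T_def[of "N f"] by (subst sum.remove[of _ i0]) (auto simp: N_def xG)
    also have "T f (x0(i0 := x i0)) = f (i0, x i0) + (\<Sum>i\<in>UNIV-{i0}. f (i, x0 i))"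
      unfolding T_def by (subst sum.remove[of _ i0]) auto
    also have "\<dots> + (\<Sum>i\<in>UNIV-{i0}. f (i, x i) - f (i, x0 i)) = T f x"
      unfolding T_def by (subst (2) sum.remove[of _ i0]) (auto simp: sum_subtractf)
    finally show ?thesis .
  qed
  have DN: "D (N f) = D f" for f unfolding D by (simp add: TN)
  \<comment> \<open>Values at labels outside \<open>G\<close> are pinned to 0, so that the box is
    compact in the product topology on all functions.\<close>
  define S where "S p = (if snd p \<in> G (fst p) then {-2 * R0..2 * R0} else {0})" for p
  define K where "K = {f. \<forall>p. f p \<in> S p}"
  have compK: "compact K" unfolding K_def by (rule compact_function_box) (auto simp: S_def)
  have R00: "0 \<le> R0" unfolding R0_def using W0 \<pi>pos by (intro sum_nonneg divide_nonneg_pos) auto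
  have NK: "N f \<in> K" if "D (\<lambda>_. 0) \<le> D f" for f
  proof -
    have "N f (i, g) \<in> S (i, g)" for i g
    proof (cases "g \<in> G i")
      case g: True
      have m: "x0(j := g') \<in> \<Omega>" if "g' \<in> G j" for j g' using x0 that by (auto simp: \<Omega>_def)
      show ?thesis
      proof (cases "i = i0")
        case True
        then show ?thesis using TR[OF that m[OF g]] R00 g by (auto simp: N_def S_def abs_le_iff)
      next
        case False
        have "T f (x0(i := g)) - T f x0 = f (i, g) - f (i, x0 i)"
          unfolding T_def by (subst (1 2) sum.remove[of _ i]) auto
        then have "\<bar>f (i, g) - f (i, x0 i)\<bar> \<le> 2 * R0"
          using TR[OF that m[OF g]] TR[OF that x0\<Omega>] by linarith
        then show ?thesis using g False by (auto simp: N_def S_def abs_le_iff)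
      qed
    qed (simp add: N_def S_def)
    then show ?thesis by (auto simp: K_def)
  qed
  have cont: "continuous_on K D"
    unfolding D_def using \<tau>
    by (intro continuous_intros continuous_on_subset[OF continuous_on_product_coordinates]) auto
  have "K \<noteq> {}" using NK[of "\<lambda>_. 0"] by auto
  then obtain f where f: "f \<in> K" "\<And>h. h \<in> K \<Longrightarrow> D h \<le> D f"
    using continuous_attains_sup[OF compK _ cont] by blast
  have "D h \<le> D f" for h
  proof (cases "D (\<lambda>_. 0) \<le> D h")
    case True then show ?thesis using f(2)[OF NK] DN by metis
  next
    case False
    have "D (\<lambda>_. 0) \<le> D f" using f(2)[OF NK[of "\<lambda>_. 0"]] DN[of "\<lambda>_. 0"] by simp
    then show ?thesis using False by simp
  qed
  then show ?thesis by blast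
qed

text \<open>At a maximiser \<open>f\<close> of the entropically smoothed dual functional, the vanishing gradient says
  that the Gibbs weights \<open>P x = exp ((\<Sum>i. f i (x i) - c x) / \<tau>)\<close> form a plan with marginals \<open>a i\<close>. As
  they are at most \<open>1\<close>, the potentials are feasible, and \<open>- p ln p \<le> 1\<close> bounds the duality gap.\<close>

lemma discrete_duality:
  fixes G :: "'m::finite \<Rightarrow> 'b set" and a :: "'m \<Rightarrow> 'b \<Rightarrow> real" and c :: "('m \<Rightarrow> 'b) \<Rightarrow> real"
  assumes fin: "\<And>i. finite (G i)" and pos: "\<And>i g. g \<in> G i \<Longrightarrow> 0 < a i g"
    and one: "\<And>i. (\<Sum>g\<in>G i. a i g) = 1" and \<kappa>: "\<kappa> > 0"
  obtains P f where "\<And>x. x \<in> PiE UNIV G \<Longrightarrow> 0 \<le> P x"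
    "\<And>i g. g \<in> G i \<Longrightarrow> (\<Sum>x\<in>{x\<in>PiE UNIV G. x i = g}. P x) = a i g"
    "\<And>x. x \<in> PiE UNIV G \<Longrightarrow> (\<Sum>i\<in>UNIV. f i (x i)) \<le> c x"
    "(\<Sum>x\<in>PiE UNIV G. P x * (c x - (\<Sum>i\<in>UNIV. f i (x i)))) \<le> \<kappa>"
proof -
  define \<Omega> where "\<Omega> = PiE UNIV G"
  have fin\<Omega>: "finite \<Omega>" unfolding \<Omega>_def using fin by (intro finite_PiE) auto
  \<comment> \<open>Each configuration will contribute at most \<open>\<tau>\<close> to the duality
    gap, so the gap is at most \<open>card \<Omega> * \<tau>\<close>; the added 1 makes the
    denominator visibly positive.\<close>
  define \<tau> where "\<tau> = \<kappa> / (card \<Omega> + 1)"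
  have \<tau>: "\<tau> > 0" using \<kappa> by (simp add: \<tau>_def add_nonneg_pos)
  define D where "D f = (\<Sum>i\<in>UNIV. \<Sum>g\<in>G i. a i g * f (i, g)) -
      \<tau> * (\<Sum>x\<in>\<Omega>. exp (((\<Sum>i\<in>UNIV. f (i, x i)) - c x) / \<tau>))" for f :: "'m \<times> 'b \<Rightarrow> real"
  obtain f where f: "\<And>h. D h \<le> D f"
    using discrete_duality_max[where G = G and a = a and c = c, OF fin pos one \<tau>]
    unfolding D_def \<Omega>_def by auto
  define E where "E x = c x - (\<Sum>i\<in>UNIV. f (i, x i))" for x
  define P where "P x = exp (- E x / \<tau>)" for x
  have marg: "(\<Sum>x\<in>{x\<in>\<Omega>. x i = g}. P x) = a i g" if g: "g \<in> G i" for i g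
  proof -
    define \<Omega>1 where "\<Omega>1 = {x\<in>\<Omega>. x i = g}"
    define \<Omega>2 where "\<Omega>2 = {x\<in>\<Omega>. x i \<noteq> g}"
    define h where "h t = f((i, g) := f (i, g) + t)" for t :: real
    define A where "A = (\<Sum>j\<in>UNIV. \<Sum>g\<in>G j. a j g * f (j, g))"
    define B where "B = (\<Sum>x\<in>\<Omega>2. P x)"
    define S where "S = (\<Sum>x\<in>\<Omega>1. P x)"
    have split: "\<Omega> = \<Omega>1 \<union> \<Omega>2" "\<Omega>1 \<inter> \<Omega>2 = {}" "finite \<Omega>1" "finite \<Omega>2"
      using fin\<Omega> by (auto simp: \<Omega>1_def \<Omega>2_def)
    have D: "D (h t) = A + a i g * t - \<tau> * (exp (t / \<tau>) * S + B)" for t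
    proof -
      have "(\<Sum>j\<in>UNIV. \<Sum>g'\<in>G j. a j g' * h t (j, g')) =
          (\<Sum>j\<in>UNIV. \<Sum>g'\<in>G j. a j g' * f (j, g') + (if j = i then (if g' = g then a i g * t else 0) else 0))"
        by (intro sum.cong refl) (auto simp: h_def algebra_simps)
      also have "\<dots> = A + (\<Sum>j\<in>UNIV. \<Sum>g'\<in>G j. (if j = i then (if g' = g then a i g * t else 0) else 0))"
        by (simp add: sum.distrib A_def)
      also have "(\<Sum>j\<in>UNIV. \<Sum>g'\<in>G j. (if j = i then (if g' = g then a i g * t else 0) else 0)) =
          (\<Sum>j\<in>UNIV. if j = i then \<Sum>g'\<in>G i. (if g' = g then a i g * t else 0) else 0)"
        by (intro sum.cong) auto
      also have "\<dots> = a i g * t" using g fin by (simp add: sum.delta)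
      finally have 1: "(\<Sum>j\<in>UNIV. \<Sum>g'\<in>G j. a j g' * h t (j, g')) = A + a i g * t" .
      have T: "(\<Sum>j\<in>UNIV. h t (j, x j)) = (\<Sum>j\<in>UNIV. f (j, x j)) + (if x i = g then t else 0)" for x
      proof -
        have "(\<Sum>j\<in>UNIV. h t (j, x j)) = (\<Sum>j\<in>UNIV. f (j, x j) + (if j = i then (if x i = g then t else 0) else 0))"
          by (intro sum.cong refl) (auto simp: h_def)
        then show ?thesis by (simp add: sum.distrib)
      qed
      have "(\<Sum>x\<in>\<Omega>. exp (((\<Sum>j\<in>UNIV. h t (j, x j)) - c x) / \<tau>)) =
          (\<Sum>x\<in>\<Omega>1. exp (((\<Sum>j\<in>UNIV. h t (j, x j)) - c x) / \<tau>)) +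
          (\<Sum>x\<in>\<Omega>2. exp (((\<Sum>j\<in>UNIV. h t (j, x j)) - c x) / \<tau>))"
        unfolding split(1) using split by (intro sum.union_disjoint) auto
      also have "(\<Sum>x\<in>\<Omega>1. exp (((\<Sum>j\<in>UNIV. h t (j, x j)) - c x) / \<tau>)) = exp (t / \<tau>) * S"
        unfolding S_def sum_distrib_left
        by (intro sum.cong refl)
          (auto simp: T \<Omega>1_def P_def E_def exp_add[symmetric] add_divide_distrib diff_divide_distrib)
      also have "(\<Sum>x\<in>\<Omega>2. exp (((\<Sum>j\<in>UNIV. h t (j, x j)) - c x) / \<tau>)) = B"
        unfolding B_def by (intro sum.cong refl) (auto simp: T \<Omega>2_def P_def E_def)
      finally show ?thesis unfolding D_def 1 by simp
    qed
    have "h 0 = f" by (simp add: h_def)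
    \<comment> \<open>Only configurations through \<open>g\<close> feel the perturbation of
      \<open>f (i, g)\<close>, and on them the Gibbs weight is multiplied by
      \<open>exp (t / \<tau>)\<close>. Hence the derivative at 0 is the marginal defect
      \<open>a i g - S\<close>.\<close>
    have "((\<lambda>t. D (h t)) has_real_derivative (a i g - S)) (at 0)"
      unfolding D using \<tau> by (auto intro!: derivative_eq_intros)
    then have "a i g - S = 0"
      by (rule DERIV_local_max[where d=1]) (use f \<open>h 0 = f\<close> in auto)
    then show ?thesis by (simp add: S_def \<Omega>1_def)
  qed
  have Psum: "(\<Sum>x\<in>\<Omega>. P x) = 1"
  proof -
    have "(\<Sum>x\<in>\<Omega>. P x * 1) = (\<Sum>g\<in>G undefined. a undefined g * 1)"
      by (rule sum_marginal[OF fin\<Omega> fin _ marg]) (auto simp: \<Omega>_def)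
    then show ?thesis using one by simp
  qed
  have P0: "0 < P x" for x by (simp add: P_def)
  have P1: "P x \<le> 1" if "x \<in> \<Omega>" for x
    using member_le_sum[of x \<Omega> P] that fin\<Omega> P0 Psum by (simp add: less_imp_le)
  have E: "E x = - \<tau> * ln (P x)" for x using \<tau> by (simp add: P_def)
  show ?thesis
  proof (rule that[of P "\<lambda>i g. f (i, g)"])
    show "(\<Sum>i\<in>UNIV. f (i, x i)) \<le> c x" if "x \<in> PiE UNIV G" for x
    proof -
      have "ln (P x) \<le> 0" using P1[of x] P0[of x] that by (simp add: \<Omega>_def)
      then have "0 \<le> E x" using \<tau> by (simp add: E mult_nonneg_nonpos)
      then show ?thesis by (simp add: E_def)
    qed
    have "P x * E x \<le> \<tau>" if "x \<in> \<Omega>" for x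
    proof -
      have "- ln (P x) \<le> inverse (P x) - 1"
        using ln_le_minus_one[of "inverse (P x)"] P0[of x] by (simp add: ln_inverse)
      then have "P x * (- ln (P x)) \<le> P x * (inverse (P x) - 1)"
        using P0[of x] by (intro mult_left_mono) auto
      also have "\<dots> \<le> 1" using P0[of x] by (simp add: right_diff_distrib)
      finally have "\<tau> * (P x * (- ln (P x))) \<le> \<tau> * 1" using \<tau> by (intro mult_left_mono) auto
      then show ?thesis by (simp add: E algebra_simps)
    qed
    then have "(\<Sum>x\<in>\<Omega>. P x * E x) \<le> card \<Omega> * \<tau>" using sum_bounded_above[of \<Omega> "\<lambda>x. P x * E x"] by simp
    also have "\<dots> \<le> \<kappa>" using \<kappa> by (simp add: \<tau>_def divide_le_eq)
    finally show "(\<Sum>x\<in>PiE UNIV G. P x * (c x - (\<Sum>i\<in>UNIV. f (i, x i)))) \<le> \<kappa>"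
      by (simp add: E_def \<Omega>_def)
  qed (use P0 marg in \<open>auto simp: less_imp_le \<Omega>_def\<close>)
qed

section \<open>Semiconcave functions on a lattice\<close>

text \<open>At every point a paraboloid touches \<open>f\<close> from above. Its slope is bounded as
  well, because this makes \<open>f\<close> Lipschitz, which is needed for the boundary terms of the
  telescoping sums.\<close>

definition semiconcave_on :: "real \<Rightarrow> 'a::euclidean_space set \<Rightarrow> ('a \<Rightarrow> real) \<Rightarrow> bool" where
  "semiconcave_on C S f \<longleftrightarrow> 0 \<le> C \<and>
    (\<forall>x\<in>S. \<exists>A. linear A \<and> (\<forall>h. \<bar>A h\<bar> \<le> C * norm h) \<and>
      (\<forall>y\<in>S. f y \<le> f x + A (y - x) + C * (norm (y - x))\<^sup>2))"

lemma semiconcave_onE: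
  assumes "semiconcave_on C S f" "x \<in> S"
  obtains A where "linear A" "\<And>h. \<bar>A h\<bar> \<le> C * norm h"
    "\<And>y. y \<in> S \<Longrightarrow> f y \<le> f x + A (y - x) + C * (norm (y - x))\<^sup>2"
  using assms unfolding semiconcave_on_def by blast

definition orthonormal :: "'a::euclidean_space set \<Rightarrow> bool" where
  "orthonormal B \<longleftrightarrow> finite B \<and> (\<forall>b\<in>B. \<forall>b'\<in>B. b \<bullet> b' = (if b = b' then 1 else 0))"

lemma orthonormal_coordinate:
  assumes "orthonormal B" "b \<in> B"
  shows "(\<Sum>b'\<in>B. u b' *\<^sub>R b') \<bullet> b = u b"
proof -
  have "(\<Sum>b'\<in>B. u b' *\<^sub>R b') \<bullet> b = (\<Sum>b'\<in>B. if b' = b then u b' else 0)"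
    unfolding inner_sum_left using assms by (intro sum.cong) (auto simp: orthonormal_def)
  also have "\<dots> = u b" using assms by (simp add: orthonormal_def)
  finally show ?thesis .
qed

lemma orthonormal_expansion:
  assumes "orthonormal B" "w \<in> span B"
  shows "(\<Sum>b\<in>B. (w \<bullet> b) *\<^sub>R b) = w"
proof -
  obtain u where u: "w = (\<Sum>b\<in>B. u b *\<^sub>R b)"
    using assms span_finite[of B] by (auto simp: orthonormal_def)
  then show ?thesis using orthonormal_coordinate[OF assms(1), of _ u]
    by (auto intro!: sum.cong)
qed

lemma orthonormal_norm_le:
  assumes "orthonormal B" "w \<in> span B"
  shows "norm w \<le> (\<Sum>b\<in>B. \<bar>w \<bullet> b\<bar>)"
proof -
  have "norm w = norm (\<Sum>b\<in>B. (w \<bullet> b) *\<^sub>R b)" using orthonormal_expansion[OF assms] by simp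
  also have "\<dots> \<le> (\<Sum>b\<in>B. norm ((w \<bullet> b) *\<^sub>R b))" by (rule norm_sum)
  also have "\<dots> = (\<Sum>b\<in>B. \<bar>w \<bullet> b\<bar>)"
    using assms(1) by (intro sum.cong) (auto simp: orthonormal_def norm_eq_sqrt_inner)
  finally show ?thesis .
qed

text \<open>A semiconcave function becomes concave after subtracting a paraboloid, so its defect from
  the supporting paraboloid at \<open>z\<close> is maximal at the vertices \<open>z \<plusminus> R b\<close> of a cross-polytope,
  where two opposite defects add up to a second difference.\<close>

lemma semiconcave_second_difference:
  assumes B: "orthonormal B" and f: "semiconcave_on C S f"
    and z: "z \<in> S" "\<And>b. b \<in> B \<Longrightarrow> z + R *\<^sub>R b \<in> S \<and> z - R *\<^sub>R b \<in> S" and R: "R > 0"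
  defines "\<omega> \<equiv> \<Sum>b\<in>B. 2 * f z - f (z + R *\<^sub>R b) - f (z - R *\<^sub>R b) + 2 * C * R\<^sup>2"
  shows "0 \<le> \<omega>"
    and "\<And>w v. \<lbrakk>w \<in> S; w + v \<in> S; w - v \<in> S; w - z \<in> span B; v \<in> span B;
      (\<Sum>b\<in>B. \<bar>(w + v - z) \<bullet> b\<bar>) \<le> R; (\<Sum>b\<in>B. \<bar>(w - v - z) \<bullet> b\<bar>) \<le> R\<rbrakk>
      \<Longrightarrow> 2 * f w - f (w + v) - f (w - v) \<le> 2 * \<omega>"
proof -
  have C: "0 \<le> C" using f by (simp add: semiconcave_on_def)
  have finB: "finite B" using B by (simp add: orthonormal_def)
  obtain A where A: "linear A" "\<And>y. y \<in> S \<Longrightarrow> f y \<le> f z + A (y - z) + C * (norm (y - z))\<^sup>2"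
    using semiconcave_onE[OF f z(1)] by metis
  define g where "g y = f z + A (y - z) + C * (norm (y - z))\<^sup>2 - f y" for y
  have g0: "0 \<le> g y" if "y \<in> S" for y using A(2)[OF that] by (simp add: g_def)
  have gz: "g z = 0" using linear_0[OF A(1)] by (simp add: g_def)
  have normb: "norm b = 1" if "b \<in> B" for b
    using that B by (auto simp: orthonormal_def norm_eq_sqrt_inner)
  define \<theta> where "\<theta> b = 2 * f z - f (z + R *\<^sub>R b) - f (z - R *\<^sub>R b) + 2 * C * R\<^sup>2" for b
  have \<theta>: "g (z + R *\<^sub>R b) + g (z - R *\<^sub>R b) = \<theta> b" if "b \<in> B" for b
    using R normb[OF that] linear_neg[OF A(1), of "R *\<^sub>R b"] by (simp add: g_def \<theta>_def)
  have \<theta>0: "0 \<le> \<theta> b" "g (z + R *\<^sub>R b) \<le> \<theta> b" "g (z - R *\<^sub>R b) \<le> \<theta> b" if "b \<in> B" for b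
    using g0[of "z + R *\<^sub>R b"] g0[of "z - R *\<^sub>R b"] z(2)[OF that] \<theta>[OF that] by auto
  have \<omega>: "\<omega> = (\<Sum>b\<in>B. \<theta> b)" by (simp add: \<omega>_def \<theta>_def)
  show \<omega>0: "0 \<le> \<omega>" unfolding \<omega> using \<theta>0 by (intro sum_nonneg) auto
  have sup: "g y \<le> \<omega>" if y: "y \<in> S" "y - z \<in> span B" "(\<Sum>b\<in>B. \<bar>(y - z) \<bullet> b\<bar>) \<le> R" for y
  proof -
    obtain A' where A': "linear A'"
      "\<And>x. x \<in> S \<Longrightarrow> f x \<le> f y + A' (x - y) + C * (norm (x - y))\<^sup>2"
      using semiconcave_onE[OF f y(1)] by metis
    \<comment> \<open>\<open>L\<close> is a subgradient of the convex function \<open>g\<close> at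
      \<open>y\<close>: the paraboloids of \<open>f\<close> at \<open>y\<close> and at
      \<open>z\<close> have the same opening \<open>C\<close>, so their difference is affine and
      only the cross term with \<open>y - z\<close> joins the two slopes.\<close>
    define L where "L h = A h - A' h + 2 * C * ((y - z) \<bullet> h)" for h
    have L: "linear L"
      unfolding L_def using A(1) A'(1)
      by (intro linear_compose_add linear_compose_sub linearI)
        (auto simp: algebra_simps linear_add linear_scale)
    have supp: "g y + L (x - y) \<le> g x" if "x \<in> S" for x
    proof -
      have "(norm (x - z))\<^sup>2 = (norm (x - y))\<^sup>2 + 2 * ((y - z) \<bullet> (x - y)) + (norm (y - z))\<^sup>2"
        unfolding power2_norm_eq_inner by (simp add: algebra_simps inner_commute)
      then have "C * (norm (x - z))\<^sup>2 = C * (norm (x - y))\<^sup>2 +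
          2 * C * ((y - z) \<bullet> (x - y)) + C * (norm (y - z))\<^sup>2"
        by (simp only: distrib_left mult.assoc mult.left_commute[of C 2])
      moreover have "A (x - z) = A (x - y) + A (y - z)"
        using linear_add[OF A(1), of "x - y" "y - z"] by simp
      ultimately show ?thesis
        using A'(2)[OF that] unfolding g_def L_def by linarith
    qed
    \<comment> \<open>\<open>y\<close> is a convex combination of the vertices \<open>q b\<close> on
      its own side of each axis, with weights \<open>t b\<close>, and of the centre
      \<open>z\<close>, where \<open>g\<close> vanishes. A zero coordinate gives
      \<open>q b = z\<close> with weight 0.\<close>
    define s where "s b = sgn ((y - z) \<bullet> b)" for b
    define t where "t b = \<bar>(y - z) \<bullet> b\<bar> / R" for b
    define q where "q b = z + (s b * R) *\<^sub>R b" for b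
    have q: "q b \<in> S \<and> g (q b) \<le> \<theta> b" if "b \<in> B" for b
    proof -
      have "s b = 1 \<or> s b = -1 \<or> s b = 0" by (simp add: s_def sgn_if)
      then show ?thesis using z(1) z(2)[OF that] \<theta>0[OF that] gz by (auto simp: q_def)
    qed
    have t: "0 \<le> t b" for b using R by (simp add: t_def)
    have t1: "(\<Sum>b\<in>B. t b) \<le> 1" unfolding t_def sum_divide_distrib[symmetric] using y(3) R by simp
    have bary: "(\<Sum>b\<in>B. t b *\<^sub>R (q b - z)) = y - z"
    proof -
      have "t b * (s b * R) = (y - z) \<bullet> b" for b
        using R sgn_mult_abs[of "(y - z) \<bullet> b"] by (simp add: t_def s_def mult.commute)
      then show ?thesis using orthonormal_expansion[OF B y(2)] by (simp add: q_def)
    qed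
    have "(\<Sum>b\<in>B. t b * (g y + L (q b - y))) + (1 - (\<Sum>b\<in>B. t b)) * (g y + L (z - y)) \<le>
        (\<Sum>b\<in>B. t b * g (q b)) + (1 - (\<Sum>b\<in>B. t b)) * g z"
      using t t1 supp q z(1) by (intro add_mono sum_mono mult_left_mono) auto
    moreover have "(\<Sum>b\<in>B. t b * (g y + L (q b - y))) + (1 - (\<Sum>b\<in>B. t b)) * (g y + L (z - y)) = g y"
    proof -
      have "(\<Sum>b\<in>B. t b * (g y + L (q b - y))) =
          (\<Sum>b\<in>B. t b * (g y + L (z - y)) + t b * L (q b - z))"
        unfolding linear_diff[OF L] by (intro sum.cong refl) (simp add: algebra_simps)
      also have "\<dots> = (\<Sum>b\<in>B. t b) * (g y + L (z - y)) + (\<Sum>b\<in>B. t b * L (q b - z))"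
        by (simp add: sum.distrib sum_distrib_right)
      also have "(\<Sum>b\<in>B. t b * L (q b - z)) = L (y - z)"
        unfolding bary[symmetric] linear_sum[OF L] using linear_scale[OF L] by simp
      finally show ?thesis unfolding linear_diff[OF L] by (simp add: algebra_simps)
    qed
    ultimately have "g y \<le> (\<Sum>b\<in>B. t b * g (q b))" using gz by simp
    also have "\<dots> \<le> (\<Sum>b\<in>B. 1 * \<theta> b)"
    proof (intro sum_mono mult_mono)
      fix b assume b: "b \<in> B"
      have "t b \<le> (\<Sum>b\<in>B. t b)" using b t finB by (intro member_le_sum) auto
      then show "t b \<le> 1" using t1 by simp
      show "0 \<le> g (q b)" using q[OF b] g0 by blast
    qed (use q in auto)
    finally show ?thesis by (simp add: \<omega>)
  qed
  fix w v
  assume wv: "w \<in> S" "w + v \<in> S" "w - v \<in> S" "w - z \<in> span B" "v \<in> span B"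
    "(\<Sum>b\<in>B. \<bar>(w + v - z) \<bullet> b\<bar>) \<le> R" "(\<Sum>b\<in>B. \<bar>(w - v - z) \<bullet> b\<bar>) \<le> R"
  have "(w + v) - z \<in> span B" "(w - v) - z \<in> span B"
    using span_add[OF wv(4,5)] span_diff[OF wv(4,5)] by (simp_all add: algebra_simps)
  then have "g (w + v) \<le> \<omega>" "g (w - v) \<le> \<omega>" using sup wv by auto
  moreover have "0 \<le> g w" using g0 wv by blast
  \<comment> \<open>The linear parts cancel and by the parallelogram law the paraboloid leaves
    exactly the term in \<open>(norm v)\<^sup>2\<close>, which has the favourable sign. Two values
    of \<open>g\<close> remain, each at most \<open>\<omega>\<close>; this is the factor 2.\<close>
  moreover have "2 * f w - f (w + v) - f (w - v) = g (w + v) + g (w - v) - 2 * g w - 2 * C * (norm v)\<^sup>2"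
  proof -
    have "(norm (w + v - z))\<^sup>2 + (norm (w - v - z))\<^sup>2 = 2 * (norm (w - z))\<^sup>2 + 2 * (norm v)\<^sup>2"
      unfolding power2_norm_eq_inner by (simp add: algebra_simps inner_commute)
    then have "C * (norm (w + v - z))\<^sup>2 + C * (norm (w - v - z))\<^sup>2 =
        2 * C * (norm (w - z))\<^sup>2 + 2 * C * (norm v)\<^sup>2"
      by (metis (no_types, opaque_lifting) distrib_left mult.assoc mult.left_commute)
    moreover have "A (w + v - z) + A (w - v - z) = 2 * A (w - z)"
      using linear_add[OF A(1)] linear_diff[OF A(1)] by simp
    ultimately show ?thesis by (simp add: g_def)
  qed
  moreover have "0 \<le> 2 * C * (norm v)\<^sup>2" using C by simp
  ultimately show "2 * f w - f (w + v) - f (w - v) \<le> 2 * \<omega>" by linarith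
qed

lemma semiconcave_on_lipschitz:
  assumes "semiconcave_on C S f" "x \<in> S" "y \<in> S" "norm (y - x) \<le> D"
  shows "\<bar>f y - f x\<bar> \<le> C * (1 + D) * norm (y - x)"
proof -
  have C: "0 \<le> C" using assms(1) by (simp add: semiconcave_on_def)
  have *: "f y - f x \<le> C * (1 + D) * norm (y - x)"
    if xy: "x \<in> S" "y \<in> S" "norm (y - x) \<le> D" for x y
  proof -
    obtain A where A: "\<And>h. \<bar>A h\<bar> \<le> C * norm h" "f y \<le> f x + A (y - x) + C * (norm (y - x))\<^sup>2"
      using semiconcave_onE[OF assms(1) xy(1)] xy(2) by metis
    have "C * (norm (y - x) * norm (y - x)) \<le> C * (D * norm (y - x))"
      using xy(3) C by (intro mult_left_mono mult_right_mono) auto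
    then show ?thesis using A(1)[of "y - x"] A(2) by (simp add: power2_eq_square algebra_simps)
  qed
  show ?thesis
    using *[OF assms(2-4)] *[OF assms(3,2)] assms(4) norm_minus_commute[of x y]
    by (simp add: abs_le_iff)
qed

text \<open>With \<open>g j = u j - u (j + M)\<close> each summand is
  \<open>g j - g (j - M)\<close>. The shifted ranges overlap except for \<open>M\<close> indices at
  either end, so only \<open>2 * M\<close> first differences survive, however large \<open>n\<close>
  is.\<close>

lemma sum_second_difference_le:
  fixes u :: "int \<Rightarrow> real"
  assumes e: "\<And>j. - n - M \<le> j \<Longrightarrow> j \<le> n \<Longrightarrow> \<bar>u j - u (j + M)\<bar> \<le> e" and "0 \<le> M" "0 \<le> n"
  shows "(\<Sum>j=-n..n. 2 * u j - u (j + M) - u (j - M)) \<le> 2 * of_int M * e"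
proof -
  define g where "g j = u j - u (j + M)" for j
  define A where "A = {-n..n}"
  define A' where "A' = {-n-M..n-M}"
  have e0: "0 \<le> e" using order_trans[OF abs_ge_zero e[of n]] assms(2,3) by simp
  have g: "\<bar>g j\<bar> \<le> e" if "j \<in> A \<union> A'" for j using e[of j] that assms by (auto simp: g_def A_def A'_def)
  have "(\<Sum>j\<in>A. 2 * u j - u (j + M) - u (j - M)) = (\<Sum>j\<in>A. g j) - (\<Sum>j\<in>A. g (j - M))"
    unfolding sum_subtractf[symmetric] by (intro sum.cong refl) (simp add: g_def)
  also have "(\<Sum>j\<in>A. g (j - M)) = (\<Sum>j\<in>A'. g j)"
    unfolding A_def A'_def
    by (rule sum.reindex_bij_witness[of _ "\<lambda>j. j + M" "\<lambda>j. j - M"]) auto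
  also have "(\<Sum>j\<in>A. g j) - (\<Sum>j\<in>A'. g j) = (\<Sum>j\<in>A - A'. g j) - (\<Sum>j\<in>A' - A. g j)"
    using sum.Int_Diff[of A g A'] sum.Int_Diff[of A' g A] by (simp add: A_def A'_def Int_commute)
  also have "\<dots> \<le> (\<Sum>j\<in>A - A'. \<bar>g j\<bar>) + (\<Sum>j\<in>A' - A. \<bar>g j\<bar>)"
    using sum_abs[of g "A - A'"] sum_abs[of g "A' - A"] by linarith
  also have "\<dots> \<le> of_nat (card (A - A')) * e + of_nat (card (A' - A)) * e"
    using g by (intro add_mono sum_bounded_above) auto
  also have "\<dots> \<le> of_int M * e + of_int M * e"
  proof -
    have "card (A - A') \<le> card {n-M+1..n}" "card (A' - A) \<le> card {-n-M..-n-1}"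
      using assms(2) by (intro card_mono; auto simp: A_def A'_def)+
    then have "real (card (A - A')) \<le> of_int M" "real (card (A' - A)) \<le> of_int M"
      using assms(2) by auto
    then show ?thesis using e0 by (intro add_mono mult_right_mono) auto
  qed
  finally show ?thesis by (simp add: A_def mult.commute mult.left_commute)
qed

lemma sum_PiE_split:
  fixes g :: "('a \<Rightarrow> 'b) \<Rightarrow> 'c::comm_monoid_add"
  assumes "b \<in> B"
  shows "(\<Sum>k\<in>PiE B (\<lambda>_. J). g k) = (\<Sum>k\<in>PiE (B - {b}) (\<lambda>_. J). \<Sum>j\<in>J. g (k(b := j)))"
proof -
  have "PiE B (\<lambda>_. J) = PiE (insert b (B - {b})) (\<lambda>_. J)" using assms by (simp add: insert_absorb)
  also have "\<dots> = (\<lambda>(j, k). k(b := j)) ` (J \<times> PiE (B - {b}) (\<lambda>_. J))"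
    by (subst PiE_insert_eq) auto
  finally have "(\<Sum>k\<in>PiE B (\<lambda>_. J). g k) = (\<Sum>p\<in>J \<times> PiE (B - {b}) (\<lambda>_. J). g ((snd p)(b := fst p)))"
    using inj_combinator[of b "B - {b}" "\<lambda>_. J"]
    by (simp add: sum.reindex split_beta' o_def)
  also have "\<dots> = (\<Sum>j\<in>J. \<Sum>k\<in>PiE (B - {b}) (\<lambda>_. J). g (k(b := j)))"
    by (simp add: sum.cartesian_product case_prod_beta)
  finally show ?thesis by (subst sum.swap)
qed

section \<open>Lattices in a cube and the total of the second differences over them\<close>

definition cube :: "'a::euclidean_space set \<Rightarrow> real \<Rightarrow> 'a set" where
  "cube B r = {w \<in> span B. \<forall>b\<in>B. \<bar>w \<bullet> b\<bar> \<le> r}"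

text \<open>The extra 1 leaves room for rounding a coordinate of modulus up to \<open>\<rho>\<close>
  to the nearest lattice point.\<close>

definition lattice_indices :: "'a set \<Rightarrow> real \<Rightarrow> real \<Rightarrow> ('a \<Rightarrow> int) set" where
  "lattice_indices B \<rho> \<delta> = PiE B (\<lambda>_. {- (\<lceil>\<rho> / \<delta>\<rceil> + 1)..\<lceil>\<rho> / \<delta>\<rceil> + 1})"

lemma lattice_extent:
  fixes \<rho> \<delta> :: real
  assumes "0 < \<delta>" "\<delta> \<le> \<rho>"
  shows "\<delta> * of_int (\<lceil>\<rho> / \<delta>\<rceil> + 1) \<le> \<rho> + 2 * \<delta>" "0 \<le> \<lceil>\<rho> / \<delta>\<rceil>"
proof -
  have "\<delta> * of_int (\<lceil>\<rho> / \<delta>\<rceil> + 1) \<le> \<delta> * (\<rho> / \<delta> + 2)"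
    using assms(1) by (intro mult_left_mono) linarith+
  then show "\<delta> * of_int (\<lceil>\<rho> / \<delta>\<rceil> + 1) \<le> \<rho> + 2 * \<delta>"
    using assms(1) by (simp add: distrib_left)
  show "0 \<le> \<lceil>\<rho> / \<delta>\<rceil>"
    using divide_pos_pos[of \<rho> \<delta>] assms by linarith
qed

text \<open>With \<open>n\<close> the extent of an axis, \<open>2 * n + 1\<close> is at most
  \<open>3 * n\<close>, and \<open>\<delta> * n\<close> is at most
  \<open>\<rho> + 2 * \<delta>\<close>, hence at most \<open>3 * \<rho>\<close>; this is the origin
  of the 9.\<close>

lemma card_lattice:
  assumes "finite B" "0 < \<delta>" "\<delta> \<le> \<rho>"
  shows "\<delta> ^ card B * card (lattice_indices B \<rho> \<delta>) \<le> (9 * \<rho>) ^ card B"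
    and "finite (lattice_indices B \<rho> \<delta>)"
proof -
  define n where "n = \<lceil>\<rho> / \<delta>\<rceil> + 1"
  have n: "\<delta> * of_int n \<le> 3 * \<rho>" "1 \<le> n"
    using lattice_extent[OF assms(2,3)] assms by (auto simp: n_def)
  have "\<delta> * (2 * of_int n + 1) \<le> \<delta> * (3 * of_int n)"
    using n assms(2) by (intro mult_left_mono) auto
  then have "\<delta> * (2 * of_int n + 1) \<le> 9 * \<rho>" using n(1) by simp
  then have "(\<delta> * (2 * of_int n + 1)) ^ card B \<le> (9 * \<rho>) ^ card B"
    using n assms by (intro power_mono) auto
  moreover have "real (card (lattice_indices B \<rho> \<delta>)) = (2 * of_int n + 1) ^ card B"
    using n assms(1) by (simp add: lattice_indices_def n_def card_PiE)
  ultimately show "\<delta> ^ card B * card (lattice_indices B \<rho> \<delta>) \<le> (9 * \<rho>) ^ card B"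
    by (simp add: power_mult_distrib)
  show "finite (lattice_indices B \<rho> \<delta>)" unfolding lattice_indices_def
    using assms by (intro finite_PiE) auto
qed

lemma orthonormal_sum_abs_le:
  fixes e :: real
  assumes "\<And>b. b \<in> B \<Longrightarrow> \<bar>w \<bullet> b\<bar> \<le> e"
  shows "(\<Sum>b\<in>B. \<bar>w \<bullet> b\<bar>) \<le> card B * e"
  using sum_bounded_above[of B "\<lambda>b. \<bar>w \<bullet> b\<bar>" e] assms by simp

text \<open>Near a lattice point the second differences of \<open>f\<close> are controlled by those
  of the axis stencil at that point. Summed along a lattice line they telescope to boundary terms of
  order \<delta>, and there are O(\<delta>^(1-d)) lines in each direction, so the total over the
  lattice is O(\<delta>^(2-d)). The constant \<open>K\<close> serves all semiconcave functions with
  the same \<open>C\<close>, since the potentials will vary with \<delta>.\<close>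

lemma lattice_second_difference:
  fixes B :: "'a::euclidean_space set" and C \<rho> :: real
  assumes B: "orthonormal B" and C: "0 \<le> C" and \<rho>: "0 < \<rho>"
  obtains K where "0 \<le> K" "\<And>(\<delta>::real) f. \<lbrakk>0 < \<delta>; \<delta> * (2 * card B + 4) \<le> \<rho>; semiconcave_on C (cube B (2 * \<rho>)) f\<rbrakk> \<Longrightarrow>
    \<exists>\<omega>. (\<forall>k\<in>lattice_indices B \<rho> \<delta>. 0 \<le> \<omega> k \<and>
        (\<forall>w\<in>span B. \<forall>v\<in>span B. (\<forall>b\<in>B. \<bar>w \<bullet> b - \<delta> * of_int (k b)\<bar> \<le> \<delta> / 2 \<and> \<bar>v \<bullet> b\<bar> \<le> \<delta>) \<longrightarrow>
          2 * f w - f (w + v) - f (w - v) \<le> \<omega> k)) \<and>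
      \<delta> ^ card B * (\<Sum>k\<in>lattice_indices B \<rho> \<delta>. \<omega> k) \<le> K * \<delta>\<^sup>2"
proof -
  define d where "d = card B"
  define M where "M = 2 * real d + 1"
  have finB: "finite B" using B by (simp add: orthonormal_def)
  \<comment> \<open>The stencil radius \<open>R = M * \<delta>\<close> spans \<open>m\<close>
    lattice steps. In each coordinate \<open>w + v\<close> and \<open>w - v\<close> stay within
    \<open>2 * \<delta>\<close> of the lattice point, so they lie in the cross-polytope of radius
    \<open>R\<close>; the extra 1 keeps \<open>R\<close> positive for \<open>d = 0\<close>.\<close>
  define m where "m = 2 * int d + 1"
  have M: "1 \<le> M" "M = of_int m" and m: "0 \<le> m" by (auto simp: M_def m_def)
  \<comment> \<open>The first summand collects the boundary terms of the lattice lines, the second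
    one the curvature term \<open>2 * C * R\<^sup>2\<close> at every lattice point. The outer 2
    comes from the bound \<open>2 * \<omega>\<close> on second differences.\<close>
  define K where "K = 2 * (d * ((9 * \<rho>) ^ (d - 1) * (2 * M\<^sup>2 * (C * (1 + \<rho>))) + (9 * \<rho>) ^ d * (2 * C * M\<^sup>2)))"
  have "0 \<le> K" unfolding K_def using C \<rho> M by simp
  moreover have "\<exists>\<omega>. (\<forall>k\<in>lattice_indices B \<rho> \<delta>. 0 \<le> \<omega> k \<and>
        (\<forall>w\<in>span B. \<forall>v\<in>span B. (\<forall>b\<in>B. \<bar>w \<bullet> b - \<delta> * of_int (k b)\<bar> \<le> \<delta> / 2 \<and> \<bar>v \<bullet> b\<bar> \<le> \<delta>) \<longrightarrow>
          2 * f w - f (w + v) - f (w - v) \<le> \<omega> k)) \<and>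
      \<delta> ^ card B * (\<Sum>k\<in>lattice_indices B \<rho> \<delta>. \<omega> k) \<le> K * \<delta>\<^sup>2"
    if \<delta>: "0 < \<delta>" "\<delta> * (2 * card B + 4) \<le> \<rho>" and f: "semiconcave_on C (cube B (2 * \<rho>)) f" for \<delta> :: real and f
  proof -
    define n where "n = \<lceil>\<rho> / \<delta>\<rceil> + 1"
    define R where "R = M * \<delta>"
    define S where "S = cube B (2 * \<rho>)"
    define Z where "Z = lattice_indices B \<rho> \<delta>"
    have Z: "Z = PiE B (\<lambda>_. {-n..n})" by (simp add: Z_def lattice_indices_def n_def)
    define z where "z k = (\<Sum>b\<in>B. (\<delta> * of_int (k b)) *\<^sub>R b)" for k :: "'a \<Rightarrow> int"
    have zb: "z k \<bullet> b = \<delta> * of_int (k b)" if "b \<in> B" for k b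
      unfolding z_def by (rule orthonormal_coordinate[OF B that])
    have zspan: "z k \<in> span B" for k
      unfolding z_def by (intro span_sum span_scale span_base)
    have "\<delta> * 3 \<le> \<delta> * (2 * card B + 4)" using \<delta>(1) by (intro mult_left_mono) auto
    then have \<delta>\<rho>: "\<delta> \<le> \<rho>" "3 * \<delta> \<le> \<rho>" using \<delta> by linarith+
    have R: "0 < R" using M \<delta> by (simp add: R_def)
    have R\<rho>: "R + 3 * \<delta> \<le> \<rho>" using \<delta> by (simp add: R_def M_def d_def algebra_simps)
    have n: "\<delta> * of_int n \<le> \<rho> + 2 * \<delta>" "1 \<le> n"
      using lattice_extent[OF \<delta>(1) \<delta>\<rho>(1)] by (auto simp: n_def)
    have bb: "b \<bullet> b' = (if b = b' then 1 else 0)" if "b \<in> B" "b' \<in> B" for b b'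
      using that B by (simp add: orthonormal_def)
    have kb: "\<bar>\<delta> * of_int (k b)\<bar> \<le> \<rho> + 2 * \<delta>" if "k \<in> Z" "b \<in> B" for k b
    proof -
      have "\<bar>k b\<bar> \<le> n" using that by (auto simp: Z PiE_def Pi_def abs_le_iff)
      then have "\<bar>of_int (k b)\<bar> \<le> real_of_int n" by linarith
      then have "\<delta> * \<bar>of_int (k b)\<bar> \<le> \<delta> * of_int n" using \<delta> by (intro mult_left_mono) auto
      then have "\<delta> * \<bar>of_int (k b)\<bar> \<le> \<rho> + 2 * \<delta>" using n(1) by linarith
      then show ?thesis using \<delta>(1) by (simp add: abs_mult)
    qed
    have zS: "z k + t *\<^sub>R b \<in> S" if "k \<in> Z" "b \<in> B" "\<bar>t\<bar> \<le> R" for k b t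
    proof -
      have "\<bar>(z k + t *\<^sub>R b) \<bullet> b'\<bar> \<le> 2 * \<rho>" if "b' \<in> B" for b'
        using kb[OF \<open>k \<in> Z\<close> that] \<open>\<bar>t\<bar> \<le> R\<close> R R\<rho> \<delta>\<rho> \<delta>
        by (simp add: inner_add_left zb[OF that] bb[OF \<open>b \<in> B\<close> that] abs_le_iff; linarith)
      then show ?thesis using zspan span_base[OF \<open>b \<in> B\<close>]
        by (simp add: S_def cube_def span_add span_scale)
    qed
    have zS0: "z k \<in> S" if "k \<in> Z" for k
      using kb[OF that] zspan R\<rho> R \<delta> by (force simp: S_def cube_def zb)
    define \<theta> where "\<theta> k b = 2 * f (z k) - f (z k + R *\<^sub>R b) - f (z k - R *\<^sub>R b)" for k b
    define \<omega> where "\<omega> k = (\<Sum>b\<in>B. \<theta> k b + 2 * C * R\<^sup>2)" for k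
    have f': "semiconcave_on C S f" using f by (simp add: S_def)
    have nbhd: "z k + R *\<^sub>R b \<in> S \<and> z k - R *\<^sub>R b \<in> S" if "k \<in> Z" "b \<in> B" for k b
      using zS[OF that, of R] zS[OF that, of "- R"] R by auto
    have \<omega>0: "0 \<le> \<omega> k" if "k \<in> Z" for k
      using semiconcave_second_difference(1)[OF B f' zS0[OF that] nbhd[OF that] R]
      by (simp add: \<omega>_def \<theta>_def)
    have \<omega>: "2 * f w - f (w + v) - f (w - v) \<le> 2 * \<omega> k"
      if k: "k \<in> Z" and w: "w \<in> span B" and v: "v \<in> span B"
        and wv: "\<forall>b\<in>B. \<bar>w \<bullet> b - \<delta> * of_int (k b)\<bar> \<le> \<delta> / 2 \<and> \<bar>v \<bullet> b\<bar> \<le> \<delta>" for k w v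
    proof -
      have in_S: "w + t *\<^sub>R v \<in> S" if "\<bar>t\<bar> \<le> 1" for t
      proof -
        have "\<bar>(w + t *\<^sub>R v) \<bullet> b\<bar> \<le> 2 * \<rho>" if b: "b \<in> B" for b
        proof -
          have "\<bar>t * (v \<bullet> b)\<bar> \<le> 1 * \<delta>"
            unfolding abs_mult using \<open>\<bar>t\<bar> \<le> 1\<close> wv b by (intro mult_mono) auto
          moreover have "\<bar>w \<bullet> b - \<delta> * of_int (k b)\<bar> \<le> \<delta> / 2" using wv b by blast
          moreover have "R \<ge> \<delta>" using M \<delta> by (simp add: R_def)
          ultimately show ?thesis
            using kb[OF k b] R\<rho> \<delta>\<rho> \<delta> unfolding inner_add_left inner_scaleR_left by linarith
        qed
        then show ?thesis using w v by (simp add: S_def cube_def span_add span_scale)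
      qed
      have small: "(\<Sum>b\<in>B. \<bar>(w + t *\<^sub>R v - z k) \<bullet> b\<bar>) \<le> R" if "\<bar>t\<bar> \<le> 1" for t
      proof -
        have "(\<Sum>b\<in>B. \<bar>(w + t *\<^sub>R v - z k) \<bullet> b\<bar>) \<le> card B * (2 * \<delta>)"
        proof (rule orthonormal_sum_abs_le)
          fix b assume b: "b \<in> B"
          have "\<bar>t * (v \<bullet> b)\<bar> \<le> 1 * \<delta>"
            unfolding abs_mult using \<open>\<bar>t\<bar> \<le> 1\<close> wv b by (intro mult_mono) auto
          moreover have "\<bar>w \<bullet> b - \<delta> * of_int (k b)\<bar> \<le> \<delta> / 2" using wv b by blast
          ultimately show "\<bar>(w + t *\<^sub>R v - z k) \<bullet> b\<bar> \<le> 2 * \<delta>"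
            using \<delta> unfolding inner_add_left inner_diff_left inner_scaleR_left zb[OF b] by linarith
        qed
        also have "\<dots> \<le> R" using \<delta> by (simp add: R_def M_def d_def algebra_simps)
        finally show ?thesis .
      qed
      show ?thesis
        using semiconcave_second_difference(2)[OF B f' zS0[OF k] nbhd[OF k] R, of w v]
          in_S[of 0] in_S[of 1] in_S[of "-1"] small[of 1] small[of "-1"] w v zspan[of k]
        by (simp add: \<omega>_def \<theta>_def span_diff)
    qed
    have line: "(\<Sum>k\<in>Z. \<theta> k b) \<le> (2 * of_int n + 1) ^ (d - 1) * (2 * M * (C * (1 + \<rho>) * R))"
      if b: "b \<in> B" for b
    proof -
      have inner: "(\<Sum>j=-n..n. \<theta> (k(b := j)) b) \<le> 2 * of_int m * (C * (1 + \<rho>) * R)"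
        if k: "k \<in> PiE (B - {b}) (\<lambda>_. {-n..n})" for k
      proof -
        define u where "u j = f (z (k(b := j)))" for j :: int
        have kj: "k(b := j) \<in> Z" if "j \<in> {-n..n}" for j
          using k b that unfolding Z by (auto simp: PiE_def Pi_def extensional_def)
        have shift: "z (k(b := j + i)) = z (k(b := j)) + (\<delta> * of_int i) *\<^sub>R b" for i j
        proof -
          have "z (k(b := j)) = (\<delta> * of_int j) *\<^sub>R b + (\<Sum>b'\<in>B - {b}. (\<delta> * of_int (k b')) *\<^sub>R b')" for j
            unfolding z_def using finB b by (subst sum.remove[of _ b]) auto
          then show ?thesis by (simp add: algebra_simps)
        qed
        have step: "\<bar>u j - u (j + i)\<bar> \<le> C * (1 + \<rho>) * R"
          if j: "j \<in> {-n..n}" and i: "i = m \<or> i = - m" for i j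
        proof -
          have iR: "\<bar>\<delta> * of_int i\<bar> = R" using i M m \<delta> by (auto simp: R_def abs_mult)
          have nb: "norm ((\<delta> * of_int i) *\<^sub>R b) = R"
            using iR bb[OF b b] by (simp add: norm_eq_sqrt_inner abs_mult)
          have "\<bar>f (z (k(b := j)) + (\<delta> * of_int i) *\<^sub>R b) - f (z (k(b := j)))\<bar> \<le>
              C * (1 + \<rho>) * norm (z (k(b := j)) + (\<delta> * of_int i) *\<^sub>R b - z (k(b := j)))"
            using nb R\<rho> \<delta> zS[OF kj[OF j] b, of "\<delta> * of_int i"] iR zS0[OF kj[OF j]]
            by (intro semiconcave_on_lipschitz[OF f']) auto
          then show ?thesis using nb by (simp add: u_def shift abs_minus_commute)
        qed
        have "\<theta> (k(b := j)) b = 2 * u j - u (j + m) - u (j - m)" for j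
          using shift[of j m] shift[of j "- m"] M(2)
          by (simp add: \<theta>_def u_def R_def mult.commute)
        then have "(\<Sum>j=-n..n. \<theta> (k(b := j)) b) =
            (\<Sum>j=-n..n. 2 * u j - u (j + m) - u (j - m))" by simp
        also have "\<dots> \<le> 2 * of_int m * (C * (1 + \<rho>) * R)"
        proof (rule sum_second_difference_le)
          fix j assume j: "- n - m \<le> j" "j \<le> n"
          show "\<bar>u j - u (j + m)\<bar> \<le> C * (1 + \<rho>) * R"
          proof (cases "- n \<le> j")
            case True then show ?thesis using step j by simp
          next
            \<comment> \<open>Here \<open>j\<close> lies to the left of the lattice, but
              \<open>j + m\<close> belongs to it since \<open>m \<le> n\<close>; the step is then
              read backwards from \<open>j + m\<close>.\<close>
            case False
            then have "j + m \<in> {-n..n} \<or> 2 * n < m" using j by auto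
            moreover have "m \<le> n"
            proof -
              have "M * \<delta> \<le> \<rho>" using R\<rho> \<delta> by (simp add: R_def)
              then have "M \<le> \<rho> / \<delta>" using \<delta> by (simp add: field_simps)
              then have "of_int m \<le> real_of_int \<lceil>\<rho> / \<delta>\<rceil>" unfolding M(2) by linarith
              then show ?thesis unfolding n_def by linarith
            qed
            ultimately have "j + m \<in> {-n..n}" using n(2) by auto
            from step[OF this, of "- m"] show ?thesis by (simp add: abs_minus_commute)
          qed
        qed (use n m in auto)
        finally show ?thesis .
      qed
      have "(\<Sum>k\<in>Z. \<theta> k b) = (\<Sum>k\<in>PiE (B - {b}) (\<lambda>_. {-n..n}). \<Sum>j=-n..n. \<theta> (k(b := j)) b)"
        unfolding Z by (rule sum_PiE_split[OF b])
      also have "\<dots> \<le> card (PiE (B - {b}) (\<lambda>_. {-n..n})) * (2 * of_int m * (C * (1 + \<rho>) * R))"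
        by (intro sum_bounded_above inner)
      also have "card (PiE (B - {b}) (\<lambda>_. {-n..n})) = nat (2 * n + 1) ^ (d - 1)"
        using finB b by (simp add: card_PiE d_def)
      finally show ?thesis using n M(2) by simp
    qed
    have "(\<Sum>k\<in>Z. \<omega> k) = (\<Sum>b\<in>B. \<Sum>k\<in>Z. \<theta> k b) + card Z * (d * (2 * C * R\<^sup>2))"
      unfolding \<omega>_def by (simp add: sum.distrib sum.swap[of _ B] d_def)
    also have "\<dots> \<le> d * ((2 * of_int n + 1) ^ (d - 1) * (2 * M * (C * (1 + \<rho>) * R))) + card Z * (d * (2 * C * R\<^sup>2))"
      using line by (intro add_mono order_refl) (simp add: d_def sum_bounded_above)
    finally have sum: "(\<Sum>k\<in>Z. \<omega> k) \<le> \<dots>" .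
    have \<delta>n: "\<delta> * (2 * of_int n + 1) \<le> 9 * \<rho>"
    proof -
      have "\<delta> * 1 \<le> \<delta> * of_int n" using n \<delta> by (intro mult_left_mono) auto
      then show ?thesis using n(1) \<delta>\<rho> by (simp add: distrib_left)
    qed
    have "\<delta> ^ d * (\<Sum>k\<in>Z. \<omega> k) \<le>
        d * ((\<delta> ^ d * (2 * of_int n + 1) ^ (d - 1) * \<delta>) * (2 * M\<^sup>2 * (C * (1 + \<rho>)))) +
        (\<delta> ^ d * card Z) * (d * (2 * C * M\<^sup>2)) * \<delta>\<^sup>2"
      using mult_left_mono[OF sum, of "\<delta> ^ d"] \<delta>
      by (simp add: R_def power2_eq_square algebra_simps)
    also have "\<dots> \<le> d * (((9 * \<rho>) ^ (d - 1) * \<delta>\<^sup>2) * (2 * M\<^sup>2 * (C * (1 + \<rho>)))) +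
        (9 * \<rho>) ^ d * (d * (2 * C * M\<^sup>2)) * \<delta>\<^sup>2"
    proof (intro add_mono)
      show "d * ((\<delta> ^ d * (2 * of_int n + 1) ^ (d - 1) * \<delta>) * (2 * M\<^sup>2 * (C * (1 + \<rho>)))) \<le>
          d * (((9 * \<rho>) ^ (d - 1) * \<delta>\<^sup>2) * (2 * M\<^sup>2 * (C * (1 + \<rho>))))"
      \<comment> \<open>For \<open>d = 0\<close> the exponent \<open>d - 1\<close> is truncated, but
        the factor \<open>d\<close> removes the term.\<close>
      proof (cases "d = 0")
        case False
        then have "\<delta> ^ d = \<delta> ^ (d - 1) * \<delta>" by (metis power_minus_mult neq0_conv)
        then have "\<delta> ^ d * (2 * of_int n + 1) ^ (d - 1) * \<delta> = (\<delta> * (2 * of_int n + 1)) ^ (d - 1) * \<delta>\<^sup>2"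
          by (simp add: power_mult_distrib power2_eq_square)
        also have "\<dots> \<le> (9 * \<rho>) ^ (d - 1) * \<delta>\<^sup>2"
          using \<delta>n \<delta> n by (intro mult_right_mono power_mono) auto
        finally show ?thesis using C \<rho> M by (intro mult_left_mono mult_right_mono) auto
      qed simp
      show "(\<delta> ^ d * card Z) * (d * (2 * C * M\<^sup>2)) * \<delta>\<^sup>2 \<le> (9 * \<rho>) ^ d * (d * (2 * C * M\<^sup>2)) * \<delta>\<^sup>2"
        using card_lattice(1)[OF finB \<delta>(1) \<delta>\<rho>(1)] C
        by (intro mult_right_mono) (auto simp: Z_def d_def)
    qed
    also have "\<dots> * 2 = K * \<delta>\<^sup>2" by (simp add: K_def algebra_simps)
    finally have "\<delta> ^ d * (\<Sum>k\<in>Z. 2 * \<omega> k) \<le> K * \<delta>\<^sup>2"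
      unfolding sum_distrib_left[symmetric] by (simp only: mult.assoc mult.commute mult.left_commute)
    then show ?thesis
      using \<omega> \<omega>0 by (intro exI[of _ "\<lambda>k. 2 * \<omega> k"]) (auto simp: Z_def d_def)
  qed
  ultimately show ?thesis by (rule that)
qed

text \<open>Subdividing the cube into \<open>n ^ d\<close> cubes of side \<open>\<delta> / n\<close>
  gives images of diameter at most \<open>L * d * \<delta> / n\<close>. The powers of
  \<open>n\<close> cancel in the sum, so the bound survives as the mesh tends to 0. The factor
  \<open>card B\<close> next to \<open>L\<close> comes from estimating the norm by the sum of the
  coordinates.\<close>

lemma hausdorff_outer_lipschitz_cube:
  fixes \<psi> :: "'a::euclidean_space \<Rightarrow> 'a"
  assumes B: "orthonormal B" and T: "T \<subseteq> span B" and L: "0 \<le> L" and \<delta>: "0 < \<delta>"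
    and lip: "\<And>x y. x \<in> T \<Longrightarrow> y \<in> T \<Longrightarrow> norm (\<psi> x - \<psi> y) \<le> L * norm (x - y)"
    and A: "A \<subseteq> \<psi> ` {w \<in> T. \<forall>b\<in>B. \<bar>w \<bullet> b - z b\<bar> \<le> \<delta> / 2}"
  shows "hausdorff_outer (card B) A \<le> ennreal (unit_ball_vol (card B) * (L * card B * \<delta> / 2) ^ card B)"
  unfolding hausdorff_outer_def
proof (rule SUP_least)
  fix \<eta> :: real assume "\<eta> \<in> {0<..}"
  then have \<eta>: "0 < \<eta>" by simp
  define d where "d = card B"
  have finB: "finite B" using B by (simp add: orthonormal_def)
  obtain n0 :: nat where n0: "L * d * \<delta> / \<eta> < n0" using reals_Archimedean2 by blast
  define n where "n = Suc n0"
  define e where "e = \<delta> / n"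
  have e: "0 < e" "n * e = \<delta>" using \<delta> by (auto simp: e_def n_def)
  have n\<eta>: "L * (d * e) \<le> \<eta>"
  proof -
    have "L * d * \<delta> / \<eta> \<le> n" using n0 by (simp add: n_def)
    then have "L * d * \<delta> \<le> n * \<eta>" using \<eta> by (simp add: field_simps)
    then show ?thesis by (simp add: e_def n_def field_simps)
  qed
  define J where "J = PiE B (\<lambda>_. {..<n})"
  have finJ: "finite J" unfolding J_def using finB by (intro finite_PiE) auto
  have cardJ: "card J = n ^ d" by (simp add: J_def card_PiE finB d_def)
  define Q where "Q j = \<psi> ` {w \<in> T. \<forall>b\<in>B. z b - \<delta> / 2 + j b * e \<le> w \<bullet> b \<and> w \<bullet> b \<le> z b - \<delta> / 2 + (j b + 1) * e}"
    for j :: "'a \<Rightarrow> nat"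
  have Qd: "norm (x - y) \<le> L * (d * e)" if xy: "x \<in> Q j" "y \<in> Q j" for x y j
  proof -
    obtain w w' where w: "x = \<psi> w" "y = \<psi> w'" "w \<in> T" "w' \<in> T"
      "\<And>b. b \<in> B \<Longrightarrow> z b - \<delta> / 2 + j b * e \<le> w \<bullet> b \<and> w \<bullet> b \<le> z b - \<delta> / 2 + (j b + 1) * e"
      "\<And>b. b \<in> B \<Longrightarrow> z b - \<delta> / 2 + j b * e \<le> w' \<bullet> b \<and> w' \<bullet> b \<le> z b - \<delta> / 2 + (j b + 1) * e"
      using xy unfolding Q_def by blast
    have "norm (w - w') \<le> (\<Sum>b\<in>B. \<bar>(w - w') \<bullet> b\<bar>)"
      using w(3,4) T by (intro orthonormal_norm_le[OF B] span_diff) auto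
    also have "\<dots> \<le> card B * e"
    proof (rule orthonormal_sum_abs_le)
      fix b assume "b \<in> B"
      then show "\<bar>(w - w') \<bullet> b\<bar> \<le> e"
        using w(5)[of b] w(6)[of b] by (simp add: inner_diff_left distrib_right abs_le_iff; linarith)
    qed
    finally have "L * norm (w - w') \<le> L * (d * e)" using L by (intro mult_left_mono) (auto simp: d_def)
    then show ?thesis using lip[OF w(3,4)] w(1,2) by simp
  qed
  obtain h where h: "bij_betw h {..<card J} J"
    using ex_bij_betw_nat_finite[OF finJ] by (auto simp: lessThan_atLeast0)
  \<comment> \<open>The content asks for a sequence of covering sets; the finite cover is padded
    with empty sets, which count 0.\<close>
  define U where "U i = (if i < card J then Q (h i) else {})" for i
  have bnd: "bounded (U i)" "diameter (U i) \<le> L * (d * e)" for i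
  proof -
    have "bounded (Q j) \<and> diameter (Q j) \<le> L * (d * e)" for j
    proof
      have nn: "0 \<le> L * (d * e)" using L e by simp
      show "bounded (Q j)"
      proof (cases "Q j = {}")
        case False
        then obtain y where "y \<in> Q j" by blast
        then show ?thesis using Qd unfolding bounded_def dist_norm by blast
      qed simp
      show "diameter (Q j) \<le> L * (d * e)" using Qd nn by (intro diameter_le) auto
    qed
    then show "bounded (U i)" "diameter (U i) \<le> L * (d * e)"
      using L e by (auto simp: U_def)
  qed
  have cover: "A \<subseteq> (\<Union>i. U i)"
  proof
    fix x assume "x \<in> A"
    then obtain w where w: "x = \<psi> w" "w \<in> T" "\<And>b. b \<in> B \<Longrightarrow> \<bar>w \<bullet> b - z b\<bar> \<le> \<delta> / 2"
      using A by blast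
    define s where "s b = (w \<bullet> b - z b + \<delta> / 2) / e" for b
    have s: "0 \<le> s b" "s b \<le> n" if "b \<in> B" for b
    proof -
      have "0 \<le> w \<bullet> b - z b + \<delta> / 2" "w \<bullet> b - z b + \<delta> / 2 \<le> n * e"
        using w(3)[OF that] e by linarith+
      then show "0 \<le> s b" "s b \<le> n" using e(1) by (simp_all add: s_def pos_divide_le_eq)
    qed
    \<comment> \<open>The minimum assigns points on the upper face, where \<open>s b = n\<close>, to
      the last closed subcube.\<close>
    define j where "j = restrict (\<lambda>b. min (n - 1) (nat \<lfloor>s b\<rfloor>)) B"
    have jJ: "j \<in> J" by (auto simp: J_def j_def n_def)
    have js: "j b \<le> s b \<and> s b \<le> j b + 1" if "b \<in> B" for b
    proof (cases "nat \<lfloor>s b\<rfloor> \<le> n - 1")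
      case True
      then show ?thesis using s[OF that] that by (simp add: j_def; linarith)
    next
      case False
      then have "j b = n - 1" using that by (simp add: j_def)
      moreover have "real (n - 1) \<le> s b" using False s[OF that] by (simp add: n_def; linarith)
      ultimately show ?thesis using s[OF that] by (simp add: n_def)
    qed
    have "x \<in> Q j"
    proof -
      have "z b - \<delta> / 2 + j b * e \<le> w \<bullet> b \<and> w \<bullet> b \<le> z b - \<delta> / 2 + (j b + 1) * e" if "b \<in> B" for b
      proof -
        have "s b * e = w \<bullet> b - z b + \<delta> / 2" using e by (simp add: s_def)
        moreover have "j b * e \<le> s b * e" "s b * e \<le> (j b + 1) * e"
          using js[OF that] e by (auto intro!: mult_right_mono)
        ultimately show ?thesis by linarith
      qed
      then show ?thesis using w by (auto simp: Q_def)
    qed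
    moreover obtain i where "i < card J" "h i = j"
      using bij_betw_imp_surj_on[OF h] jJ by (metis imageE lessThan_iff)
    ultimately show "x \<in> (\<Union>i. U i)" by (intro UN_I[of i]) (auto simp: U_def)
  qed
  let ?v = "unit_ball_vol (real d)"
  have "hausdorff_content d \<eta> A \<le>
      (\<Sum>i. if U i = {} then 0 else ennreal (?v * (diameter (U i) / 2) ^ d))"
    unfolding hausdorff_content_def
    using cover bnd n\<eta> by (intro INF_lower) (auto intro: order_trans)
  also have "\<dots> = (\<Sum>i<card J. if U i = {} then 0 else ennreal (?v * (diameter (U i) / 2) ^ d))"
    by (intro suminf_finite) (auto simp: U_def)
  also have "\<dots> \<le> (\<Sum>i<card J. ennreal (?v * (L * (d * e) / 2) ^ d))"
  proof (intro sum_mono)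
    fix i
    have "?v * (diameter (U i) / 2) ^ d \<le> ?v * (L * (d * e) / 2) ^ d"
      using bnd[of i] diameter_ge_0[OF bnd(1)[of i]]
      by (intro mult_left_mono power_mono divide_right_mono) auto
    then show "(if U i = {} then 0 else ennreal (?v * (diameter (U i) / 2) ^ d)) \<le> ennreal (?v * (L * (d * e) / 2) ^ d)"
      by (auto intro: ennreal_leI)
  qed
  also have "\<dots> = ennreal (n ^ d * (?v * (L * (d * e) / 2) ^ d))"
    using cardJ by (simp add: ennreal_mult' ennreal_of_nat_eq_real_of_nat)
  also have "n ^ d * (?v * (L * (d * e) / 2) ^ d) = ?v * (n * (L * (d * e) / 2)) ^ d"
    unfolding power_mult_distrib[of "real n"] by simp
  also have "n * (L * (d * e) / 2) = L * d * (n * e) / 2" by simp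
  also have "n * e = \<delta>" by (rule e(2))
  finally show "hausdorff_content (card B) \<eta> A \<le> ennreal (unit_ball_vol (card B) * (L * card B * \<delta> / 2) ^ card B)"
    by (simp add: d_def)
qed

section \<open>Cells on a submanifold\<close>

lemma taylor_on_translate:
  assumes "taylor_on C S f" "\<And>w. w \<in> T \<Longrightarrow> q + w \<in> S"
  shows "taylor_on C T (\<lambda>w. f (q + w))"
  unfolding taylor_on_def
proof (intro conjI ballI)
  show "0 \<le> C" by (rule taylor_on_nonneg[OF assms(1)])
  fix x assume x: "x \<in> T"
  obtain A where "linear A" "\<And>h. norm (A h) \<le> C * norm h"
    "\<And>y. y \<in> S \<Longrightarrow> norm (f y - f (q + x) - A (y - (q + x))) \<le> C * (norm (y - (q + x)))\<^sup>2"
    using taylor_onE[OF assms(1) assms(2)[OF x]] by metis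
  from this(1,2) this(3)[OF assms(2)]
  show "\<exists>A. linear A \<and> (\<forall>h. norm (A h) \<le> C * norm h) \<and>
      (\<forall>y\<in>T. norm (f (q + y) - f (q + x) - A (y - x)) \<le> C * (norm (y - x))\<^sup>2)"
    by (intro exI[of _ A]) simp
qed

lemma subset_cube_norm:
  fixes r :: real
  assumes "orthonormal B" "w \<in> cube B r"
  shows "norm w \<le> card B * r"
  using orthonormal_norm_le[of B w] orthonormal_sum_abs_le[of B w r] assms
  by (auto simp: cube_def)

text \<open>The flattening chart is centred at the image of \<open>p\<close> and read in orthonormal
  coordinates of the flat subspace. Points of \<open>X\<close> near \<open>p\<close> land in the
  cube of radius \<open>\<rho>\<close>, while the parametrisation is controlled on the doubled cube:
  the margin is used by reflected points and by the stencils at boundary lattice points. One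
  constant serves the whole family \<open>\<F>\<close>.\<close>

lemma submanifold_chart:
  fixes X :: "'a::euclidean_space set"
  assumes "C2_submanifold d X" and p: "p \<in> X" and "0 < r0"
    and F: "\<And>h. h \<in> \<F> \<Longrightarrow> taylor_on C0 (ball p r0 \<inter> X) h"
  obtains U B \<phi> \<psi> \<rho> C where "open U" "p \<in> U" "orthonormal (B :: 'a set)" "card B = d"
    "continuous_on U \<phi>" "0 < (\<rho>::real)" "0 \<le> C"
    "\<And>x. x \<in> U \<Longrightarrow> x \<in> X \<Longrightarrow> \<phi> x \<in> cube B \<rho> \<and> \<psi> (\<phi> x) = x"
    "\<And>w. w \<in> cube B (2 * \<rho>) \<Longrightarrow> \<psi> w \<in> X"
    "\<And>w w'. w \<in> cube B (2 * \<rho>) \<Longrightarrow> w' \<in> cube B (2 * \<rho>) \<Longrightarrow> norm (\<psi> w - \<psi> w') \<le> C * norm (w - w')"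
    "\<And>h. h \<in> \<F> \<Longrightarrow> taylor_on C (cube B (2 * \<rho>)) (\<lambda>w. h (\<psi> w))"
proof -
  from assms(1) p obtain U0 V \<phi>0 and \<psi>0 :: "'a \<Rightarrow> 'a" and S where chart: "p \<in> U0"
    "homeomorphism U0 V \<phi>0 \<psi>0" "C2_on U0 \<phi>0" "C2_on V \<psi>0" "subspace S" "dim S = d"
    "\<phi>0 ` (U0 \<inter> X) = V \<inter> S"
    unfolding C2_submanifold_def by meson
  have hom: "\<And>x. x \<in> U0 \<Longrightarrow> \<psi>0 (\<phi>0 x) = x" "\<phi>0 ` U0 = V" "continuous_on U0 \<phi>0"
    using chart(2) by (auto simp: homeomorphism_def)
  define q where "q = \<phi>0 p"
  have q: "q \<in> V" "q \<in> S" "\<psi>0 q = p" using hom chart p by (auto simp: q_def)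
  obtain r1 C1 where r1: "r1 > 0" "ball q r1 \<subseteq> V" "taylor_on C1 (ball q r1) \<psi>0"
    using C2_on_imp_taylor_on[OF chart(4) q(1)] by metis
  have C1: "0 \<le> C1" using taylor_on_nonneg[OF r1(3)] .
  define D where "D = C1 * (1 + 2 * r1)"
  have D: "0 \<le> D" using C1 r1 by (simp add: D_def)
  have lip: "norm (\<psi>0 y - \<psi>0 x) \<le> D * norm (y - x)" if "x \<in> ball q r1" "y \<in> ball q r1" for x y
    unfolding D_def
  proof (rule taylor_on_lipschitz[OF r1(3) that])
    show "norm (y - x) \<le> 2 * r1"
      using that norm_triangle_ineq4[of "q - x" "q - y"] by (simp add: dist_norm)
  qed
  define r2 where "r2 = min r1 (r0 / (D + 1))"
  have r2: "0 < r2" "r2 \<le> r1" using r1 assms(3) D by (auto simp: r2_def)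
  have near: "\<psi>0 y \<in> ball p r0" if "y \<in> ball q r2" for y
  proof -
    have "norm (\<psi>0 y - p) \<le> D * norm (y - q)"
      using lip[of q y] that r2 r1 q(3) by auto
    also have "\<dots> \<le> (D + 1) * norm (y - q)" by (simp add: mult_right_mono)
    also have "\<dots> < (D + 1) * r2"
      using that D by (intro mult_strict_left_mono) (auto simp: dist_norm norm_minus_commute)
    also have "\<dots> \<le> (D + 1) * (r0 / (D + 1))" using D by (intro mult_left_mono) (auto simp: r2_def)
    also have "\<dots> = r0" using D by simp
    finally show ?thesis by (simp add: dist_norm norm_minus_commute)
  qed
  obtain B where B: "B \<subseteq> S" "pairwise orthogonal B" "\<And>x. x \<in> B \<Longrightarrow> norm x = 1"
    "independent B" "card B = dim S" "span B = S"
    using orthonormal_basis_subspace[OF chart(5)] by metis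
  have onB: "orthonormal B"
    using B(2,3) independent_imp_finite[OF B(4)]
    by (auto simp: orthonormal_def pairwise_def orthogonal_def dot_square_norm)
  \<comment> \<open>Vectors of the doubled cube have norm at most \<open>d * (2 * \<rho>)\<close>,
    which has to stay below \<open>r2\<close>; \<open>d + 1\<close> instead of \<open>d\<close>
    covers dimension 0.\<close>
  define \<rho> where "\<rho> = r2 / (2 * (d + 1))"
  have \<rho>: "0 < \<rho>" "d * (2 * \<rho>) < r2" using r2 by (auto simp: \<rho>_def field_simps)
  have cubeS: "q + w \<in> S" "q + w \<in> ball q r2" if "w \<in> cube B (2 * \<rho>)" for w
  proof -
    show "q + w \<in> S" using that B(6) q chart(5) by (simp add: cube_def subspace_add)
    have "norm w \<le> d * (2 * \<rho>)" using subset_cube_norm[OF onB that] B(5) chart(6) by simp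
    then show "q + w \<in> ball q r2" using \<rho> by (simp add: dist_norm)
  qed
  have inX: "\<psi>0 (q + w) \<in> X" if w: "w \<in> cube B (2 * \<rho>)" for w
  proof -
    have "q + w \<in> V \<inter> S" using cubeS[OF w] r1 r2 by auto
    then obtain x where "x \<in> U0 \<inter> X" "q + w = \<phi>0 x" unfolding chart(7)[symmetric] by blast
    then show ?thesis using hom(1) by auto
  qed
  \<comment> \<open>\<open>C0\<close> is known to be nonnegative only when the family has a member,
    hence the maximum with 0.\<close>
  define C where "C = max D (C1 * max C0 0 + max C0 0 * (C1 * (1 + \<bar>2 * r2\<bar>))\<^sup>2)"
  have chart_T: "taylor_on C1 (cube B (2 * \<rho>)) (\<lambda>w. \<psi>0 (q + w))"
    using cubeS(2) subset_ball[OF r2(2), of q] by (intro taylor_on_translate[OF r1(3)]) blast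
  show ?thesis
  proof (rule that[of "U0 \<inter> \<phi>0 -` ball q \<rho>" B "\<lambda>x. \<phi>0 x - q" \<rho> C "\<lambda>w. \<psi>0 (q + w)"])
    have "open U0" using chart(3) by (simp add: C2_on_def)
    then show "open (U0 \<inter> \<phi>0 -` ball q \<rho>)" using hom(3) by (intro continuous_open_preimage) auto
    show "p \<in> U0 \<inter> \<phi>0 -` ball q \<rho>" using chart(1) \<rho> by (simp add: q_def)
    show "orthonormal B" "card B = d" "0 < \<rho>" "0 \<le> C" using onB B(5) chart(6) \<rho> D by (auto simp: C_def)
    show "continuous_on (U0 \<inter> \<phi>0 -` ball q \<rho>) (\<lambda>x. \<phi>0 x - q)"
      using hom(3) by (intro continuous_intros) (auto elim: continuous_on_subset)
    fix x assume x: "x \<in> U0 \<inter> \<phi>0 -` ball q \<rho>" "x \<in> X"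
    then have "\<phi>0 x \<in> S" using chart(7) by auto
    then have 1: "\<phi>0 x - q \<in> span B" using q chart(5) B(6) by (simp add: subspace_diff)
    have "\<bar>(\<phi>0 x - q) \<bullet> b\<bar> \<le> \<rho>" if "b \<in> B" for b
    proof -
      have "\<bar>(\<phi>0 x - q) \<bullet> b\<bar> \<le> norm (\<phi>0 x - q)"
        using Cauchy_Schwarz_ineq2[of "\<phi>0 x - q" b] B(3)[OF that] by simp
      then show ?thesis using x by (simp add: dist_norm norm_minus_commute)
    qed
    with 1 x hom(1) show "\<phi>0 x - q \<in> cube B \<rho> \<and> \<psi>0 (q + (\<phi>0 x - q)) = x" by (simp add: cube_def)
  next
    fix w assume "w \<in> cube B (2 * \<rho>)" then show "\<psi>0 (q + w) \<in> X" by (rule inX)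
  next
    fix w w' assume w: "w \<in> cube B (2 * \<rho>)" "w' \<in> cube B (2 * \<rho>)"
    have "norm (\<psi>0 (q + w) - \<psi>0 (q + w')) \<le> D * norm (w - w')"
      using lip[of "q + w'" "q + w"] cubeS(2)[OF w(1)] cubeS(2)[OF w(2)] r2 by auto
    also have "\<dots> \<le> C * norm (w - w')" by (intro mult_right_mono) (auto simp: C_def)
    finally show "norm (\<psi>0 (q + w) - \<psi>0 (q + w')) \<le> C * norm (w - w')" .
  next
    fix h assume h: "h \<in> \<F>"
    have "taylor_on (C1 * C0 + C0 * (C1 * (1 + \<bar>2 * r2\<bar>))\<^sup>2) (cube B (2 * \<rho>)) (\<lambda>w. h (\<psi>0 (q + w)))"
    proof (rule taylor_on_compose[OF chart_T F[OF h]])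
      show "(\<lambda>w. \<psi>0 (q + w)) ` cube B (2 * \<rho>) \<subseteq> ball p r0 \<inter> X"
        using near inX cubeS(2) by blast
      fix x y assume "x \<in> cube B (2 * \<rho>)" "y \<in> cube B (2 * \<rho>)"
      then show "norm (y - x) \<le> 2 * r2"
        using cubeS(2)[of x] cubeS(2)[of y] norm_triangle_ineq4[of y x] by (simp add: dist_norm)
    qed
    moreover have "max C0 0 = C0" using taylor_on_nonneg[OF F[OF h]] by simp
    ultimately show "taylor_on C (cube B (2 * \<rho>)) (\<lambda>w. h (\<psi>0 (q + w)))"
      by (elim taylor_on_mono) (auto simp: C_def)
  qed
qed

text \<open>Abstract c-concavity: at every point of \<open>X\<close> some member of the family,
  shifted by a constant, touches \<open>f\<close> from above. A c-transform has this property with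
  the slice of the cost at a minimiser, and the regularity of the family reaches \<open>f\<close> as
  semiconcavity.\<close>

definition concave_wrt :: "('a \<Rightarrow> real) set \<Rightarrow> 'a set \<Rightarrow> ('a \<Rightarrow> real) \<Rightarrow> bool" where
  "concave_wrt \<F> X f \<longleftrightarrow> (\<forall>x\<in>X. \<exists>h\<in>\<F>. \<forall>y\<in>X. f y - f x \<le> h y - h x)"

text \<open>The last clause bounds the increment of \<open>h - f\<close>
  over a cell without differentiating \<open>f\<close>: the lower bound \<open>- s\<close> at the point \<open>y\<close> obtained by
  reflecting \<open>x'\<close> at \<open>x\<close> turns it into a second difference of \<open>f\<close>.\<close>

lemma chart_cells:
  fixes X :: "'a::euclidean_space set"
  assumes X: "C2_submanifold d X" and p: "p \<in> X" and r0: "0 < r0"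
    and F: "\<And>h. h \<in> \<F> \<Longrightarrow> taylor_on C0 (ball p r0 \<inter> X) h"
  obtains U and C \<delta>0 :: real where "open U" "p \<in> U" "0 \<le> C" "0 < \<delta>0"
    "\<And>\<delta>::real. \<lbrakk>0 < \<delta>; \<delta> \<le> \<delta>0\<rbrakk> \<Longrightarrow> \<exists>(q :: 'a \<Rightarrow> 'a \<Rightarrow> int) \<Lambda>. finite \<Lambda> \<and> card \<Lambda> * \<delta> ^ d \<le> C \<and>
      (\<forall>x\<in>U \<inter> X. q x \<in> \<Lambda>) \<and> (\<forall>l\<in>\<Lambda>. {x \<in> U. q x = l} \<in> sets borel) \<and>
      (\<forall>x\<in>U \<inter> X. \<forall>x'\<in>U \<inter> X. q x = q x' \<longrightarrow> norm (x' - x) \<le> C * \<delta>) \<and>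
      (\<forall>l\<in>\<Lambda>. hausdorff_outer d {x \<in> U \<inter> X. q x = l} \<le> ennreal (C * \<delta> ^ d)) \<and>
      (\<forall>f. concave_wrt \<F> X f \<longrightarrow> (\<exists>\<omega>. (\<forall>l\<in>\<Lambda>. 0 \<le> \<omega> l) \<and> \<delta> ^ d * (\<Sum>l\<in>\<Lambda>. \<omega> l) \<le> C * \<delta>\<^sup>2 \<and>
        (\<forall>x\<in>U \<inter> X. \<forall>x'\<in>U \<inter> X. q x = q x' \<longrightarrow> (\<forall>h\<in>\<F>. \<forall>s.
          (\<forall>y\<in>X. f y - f x \<le> h y - h x + s) \<longrightarrow> h x' - h x - (f x' - f x) \<le> \<omega> (q x) + s))))"
proof -
  show ?thesis
  proof (rule submanifold_chart[OF X p r0 F])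
    fix U and B :: "'a set" and \<phi> \<psi> and \<rho> C1 :: real
    assume U: "open U" "p \<in> U" and B: "orthonormal B" "card B = d"
      and \<phi>: "continuous_on U \<phi>" and \<rho>: "0 < \<rho>" and C1: "0 \<le> C1"
      and \<phi>\<psi>: "\<And>x. x \<in> U \<Longrightarrow> x \<in> X \<Longrightarrow> \<phi> x \<in> cube B \<rho> \<and> \<psi> (\<phi> x) = x"
      and \<psi>X: "\<And>w. w \<in> cube B (2 * \<rho>) \<Longrightarrow> \<psi> w \<in> X"
      and lip: "\<And>w w'. w \<in> cube B (2 * \<rho>) \<Longrightarrow> w' \<in> cube B (2 * \<rho>) \<Longrightarrow> norm (\<psi> w - \<psi> w') \<le> C1 * norm (w - w')"
      and Tay: "\<And>h. h \<in> \<F> \<Longrightarrow> taylor_on C1 (cube B (2 * \<rho>)) (\<lambda>w. h (\<psi> w))"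
    have finB: "finite B" using B by (simp add: orthonormal_def)
    have cubes: "cube B \<rho> \<subseteq> cube B (2 * \<rho>)" using \<rho> by (force simp: cube_def)
    show ?thesis
    proof (rule lattice_second_difference[OF B(1) C1 \<rho>])
      fix K assume K: "0 \<le> K" and lattice: "\<And>(\<delta>::real) f. \<lbrakk>0 < \<delta>; \<delta> * (2 * card B + 4) \<le> \<rho>; semiconcave_on C1 (cube B (2 * \<rho>)) f\<rbrakk> \<Longrightarrow>
        \<exists>\<omega>. (\<forall>k\<in>lattice_indices B \<rho> \<delta>. 0 \<le> \<omega> k \<and>
            (\<forall>w\<in>span B. \<forall>v\<in>span B. (\<forall>b\<in>B. \<bar>w \<bullet> b - \<delta> * of_int (k b)\<bar> \<le> \<delta> / 2 \<and> \<bar>v \<bullet> b\<bar> \<le> \<delta>) \<longrightarrow>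
              2 * f w - f (w + v) - f (w - v) \<le> \<omega> k)) \<and>
          \<delta> ^ card B * (\<Sum>k\<in>lattice_indices B \<rho> \<delta>. \<omega> k) \<le> K * \<delta>\<^sup>2"
      define V where "V = unit_ball_vol (real d) * (C1 * d / 2) ^ d"
      define C2 where "C2 = 2 * C1 * (real d)\<^sup>2"
      \<comment> \<open>One constant for four bounds: the number of cells, their diameter, their
        Hausdorff measure and the total defect.\<close>
      define C where "C = (9 * \<rho>) ^ d + C1 * d + V + (K + (9 * \<rho>) ^ d * C2)"
      have parts: "0 \<le> (9 * \<rho>) ^ d" "0 \<le> C1 * d" "0 \<le> V" "0 \<le> C2" using \<rho> C1 by (auto simp: V_def C2_def)
      have C: "0 \<le> C" "(9 * \<rho>) ^ d \<le> C" "C1 * d \<le> C" "V \<le> C" "K + (9 * \<rho>) ^ d * C2 \<le> C"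
        using parts K mult_nonneg_nonneg[OF parts(1,4)] by (auto simp: C_def)
      define \<delta>0 where "\<delta>0 = \<rho> / (2 * d + 4)"
      have \<delta>0: "0 < \<delta>0" using \<rho> by (simp add: \<delta>0_def)
      show ?thesis
      proof (rule that[OF U C(1) \<delta>0])
        fix \<delta> :: real assume \<delta>: "0 < \<delta>" "\<delta> \<le> \<delta>0"
        have \<delta>d: "\<delta> * (2 * card B + 4) \<le> \<rho>" using \<delta> by (simp add: \<delta>0_def B(2) field_simps)
        have "\<delta> * 4 \<le> \<delta> * (2 * card B + 4)" using \<delta>(1) by (intro mult_left_mono) auto
        then have \<delta>\<rho>: "\<delta> \<le> \<rho>" using \<delta>d \<delta>(1) by linarith
        define q where "q x = restrict (\<lambda>b. round ((\<phi> x \<bullet> b) / \<delta>)) B" for x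
        define \<Lambda> where "\<Lambda> = lattice_indices B \<rho> \<delta>"
        have qb: "\<bar>\<phi> x \<bullet> b - \<delta> * of_int (q x b)\<bar> \<le> \<delta> / 2" if "b \<in> B" for x b
        proof -
          have "\<delta> * \<bar>of_int (round ((\<phi> x \<bullet> b) / \<delta>)) - (\<phi> x \<bullet> b) / \<delta>\<bar> \<le> \<delta> * (1 / 2)"
            using \<delta>(1) of_int_round_abs_le by (intro mult_left_mono) auto
          also have "\<delta> * \<bar>of_int (round ((\<phi> x \<bullet> b) / \<delta>)) - (\<phi> x \<bullet> b) / \<delta>\<bar> =
              \<bar>\<delta> * (of_int (round ((\<phi> x \<bullet> b) / \<delta>)) - (\<phi> x \<bullet> b) / \<delta>)\<bar>"
            using \<delta>(1) by (simp add: abs_mult)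
          also have "\<delta> * (of_int (round ((\<phi> x \<bullet> b) / \<delta>)) - (\<phi> x \<bullet> b) / \<delta>) =
              \<delta> * of_int (q x b) - \<phi> x \<bullet> b"
            using \<delta>(1) that by (simp add: q_def right_diff_distrib)
          finally show ?thesis by (simp add: abs_minus_commute)
        qed
        have q\<Lambda>: "q x \<in> \<Lambda>" if x: "x \<in> U \<inter> X" for x
        proof -
          have "round ((\<phi> x \<bullet> b) / \<delta>) \<in> {- (\<lceil>\<rho> / \<delta>\<rceil> + 1)..\<lceil>\<rho> / \<delta>\<rceil> + 1}" if "b \<in> B" for b
          proof -
            have "\<bar>\<phi> x \<bullet> b\<bar> \<le> \<rho>" using \<phi>\<psi>[of x] x that by (auto simp: cube_def)
            then have "\<bar>(\<phi> x \<bullet> b) / \<delta>\<bar> \<le> \<rho> / \<delta>" using \<delta>(1) by (simp add: divide_right_mono)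
            then have "\<bar>round ((\<phi> x \<bullet> b) / \<delta>)\<bar> \<le> \<lceil>\<rho> / \<delta>\<rceil> + 1"
              using of_int_round_abs_le[of "(\<phi> x \<bullet> b) / \<delta>"] le_of_int_ceiling[of "\<rho> / \<delta>"] by linarith
            then show ?thesis unfolding atLeastAtMost_iff by linarith
          qed
          then show ?thesis by (auto simp: q_def \<Lambda>_def lattice_indices_def)
        qed
        have diff: "\<bar>(\<phi> x' - \<phi> x) \<bullet> b\<bar> \<le> \<delta>" if "q x = q x'" "b \<in> B" for x x' b
          using qb[OF that(2), of x] qb[OF that(2), of x']
          unfolding inner_diff_left that(1) by linarith
        have ndiff: "norm (\<phi> x' - \<phi> x) \<le> d * \<delta>" if "q x = q x'" "x \<in> U \<inter> X" "x' \<in> U \<inter> X" for x x'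
        proof -
          have "\<phi> x' - \<phi> x \<in> span B" using \<phi>\<psi> that by (auto simp: cube_def intro: span_diff)
          then show ?thesis
            using subset_cube_norm[OF B(1), of "\<phi> x' - \<phi> x" \<delta>] diff[OF that(1)] B(2) by (simp add: cube_def)
        qed
        have 1: "finite \<Lambda>" "card \<Lambda> * \<delta> ^ d \<le> (9 * \<rho>) ^ d"
          using card_lattice[OF finB \<delta>(1) \<delta>\<rho>] B(2) by (auto simp: \<Lambda>_def mult.commute)
        have 2: "{x \<in> U. q x = l} \<in> sets borel" if l: "l \<in> \<Lambda>" for l
        proof -
          have Ub: "U \<in> sets borel" using U by simp
          have "l \<in> extensional B" using l by (auto simp: \<Lambda>_def lattice_indices_def PiE_def)
          then have eq: "{x \<in> U. q x = l} = {x \<in> U. \<forall>b\<in>B. round ((\<phi> x \<bullet> b) / \<delta>) = l b}"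
            by (auto simp: q_def restrict_def extensional_def fun_eq_iff)
          have m: "(\<lambda>x. \<phi> x \<bullet> b) \<in> borel_measurable (restrict_space borel U)" for b
            using \<phi> by (intro borel_measurable_continuous_on_restrict continuous_intros)
          have "{x \<in> U. round ((\<phi> x \<bullet> b) / \<delta>) = l b} \<in> sets borel" for b
          proof -
            have "{x \<in> space (restrict_space borel U). \<lfloor>(\<phi> x \<bullet> b) / \<delta> + 1 / 2\<rfloor> = l b} \<in> sets (restrict_space borel U)"
              using m[of b] by measurable
            then show ?thesis using Ub
              by (simp add: round_def space_restrict_space sets_restrict_space_iff)
          qed
          then have "(\<Inter>b\<in>B. {x \<in> U. round ((\<phi> x \<bullet> b) / \<delta>) = l b}) \<in> sets borel" if "B \<noteq> {}"
            using that finB by (intro sets.finite_INT) auto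
          \<comment> \<open>In dimension 0 there is a single label and the intersection over an
            empty index set would be the whole space instead of \<open>U\<close>.\<close>
          moreover have "{x \<in> U. q x = l} = (if B = {} then U else (\<Inter>b\<in>B. {x \<in> U. round ((\<phi> x \<bullet> b) / \<delta>) = l b}))"
            unfolding eq by auto
          ultimately show ?thesis using Ub by (cases "B = {}") (auto simp del: borel_open)
        qed
        have 3: "norm (x' - x) \<le> C1 * d * \<delta>" if "x \<in> U \<inter> X" "x' \<in> U \<inter> X" "q x = q x'" for x x'
        proof -
          have "norm (\<psi> (\<phi> x') - \<psi> (\<phi> x)) \<le> C1 * norm (\<phi> x' - \<phi> x)"
            using \<phi>\<psi> that cubes by (intro lip) blast+
          also have "\<dots> \<le> C1 * (d * \<delta>)" using ndiff[OF that(3,1,2)] C1 by (intro mult_left_mono) auto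
          finally show ?thesis using \<phi>\<psi> that by simp
        qed
        have 4: "hausdorff_outer d {x \<in> U \<inter> X. q x = l} \<le> ennreal (V * \<delta> ^ d)" for l
        proof -
          have "hausdorff_outer (card B) {x \<in> U \<inter> X. q x = l} \<le>
              ennreal (unit_ball_vol (card B) * (C1 * card B * \<delta> / 2) ^ card B)"
          proof (rule hausdorff_outer_lipschitz_cube[OF B(1) _ C1 \<delta>(1) lip])
            show "cube B (2 * \<rho>) \<subseteq> span B" by (auto simp: cube_def)
            show "{x \<in> U \<inter> X. q x = l} \<subseteq> \<psi> ` {w \<in> cube B (2 * \<rho>). \<forall>b\<in>B. \<bar>w \<bullet> b - \<delta> * of_int (l b)\<bar> \<le> \<delta> / 2}"
            proof
              fix x assume x: "x \<in> {x \<in> U \<inter> X. q x = l}"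
              then have "x = \<psi> (\<phi> x)" "\<phi> x \<in> cube B (2 * \<rho>)" using \<phi>\<psi>[of x] cubes by auto
              moreover have "\<forall>b\<in>B. \<bar>\<phi> x \<bullet> b - \<delta> * of_int (l b)\<bar> \<le> \<delta> / 2" using qb x by auto
              ultimately show "x \<in> \<psi> ` {w \<in> cube B (2 * \<rho>). \<forall>b\<in>B. \<bar>w \<bullet> b - \<delta> * of_int (l b)\<bar> \<le> \<delta> / 2}" by blast
            qed
          qed auto
          moreover have "unit_ball_vol (card B) * (C1 * card B * \<delta> / 2) ^ card B = V * \<delta> ^ d"
            by (simp add: B(2) V_def power_mult_distrib[symmetric] mult.assoc)
          ultimately show ?thesis by (simp add: B(2))
        qed
        have 5: "\<exists>\<omega>. (\<forall>l\<in>\<Lambda>. 0 \<le> \<omega> l) \<and> \<delta> ^ d * (\<Sum>l\<in>\<Lambda>. \<omega> l) \<le> (K + (9 * \<rho>) ^ d * C2) * \<delta>\<^sup>2 \<and>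
            (\<forall>x\<in>U \<inter> X. \<forall>x'\<in>U \<inter> X. q x = q x' \<longrightarrow> (\<forall>h\<in>\<F>. \<forall>s.
              (\<forall>y\<in>X. f y - f x \<le> h y - h x + s) \<longrightarrow> h x' - h x - (f x' - f x) \<le> \<omega> (q x) + s))"
          if f: "concave_wrt \<F> X f" for f
        proof -
          \<comment> \<open>The member of the family that touches \<open>f\<close> at
            \<open>\<psi> w\<close> has a Taylor expansion in the chart, and this expansion is the
            supporting paraboloid.\<close>
          have sc: "semiconcave_on C1 (cube B (2 * \<rho>)) (\<lambda>w. f (\<psi> w))"
            unfolding semiconcave_on_def
          proof (intro conjI ballI)
            fix w assume w: "w \<in> cube B (2 * \<rho>)"
            obtain h where h: "h \<in> \<F>" "\<And>y. y \<in> X \<Longrightarrow> f y - f (\<psi> w) \<le> h y - h (\<psi> w)"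
              using f \<psi>X[OF w] unfolding concave_wrt_def by metis
            obtain A where A: "linear A" "\<And>v. norm (A v) \<le> C1 * norm v"
              "\<And>y. y \<in> cube B (2 * \<rho>) \<Longrightarrow> norm (h (\<psi> y) - h (\<psi> w) - A (y - w)) \<le> C1 * (norm (y - w))\<^sup>2"
              using taylor_onE[OF Tay[OF h(1)] w] by metis
            have "f (\<psi> y) \<le> f (\<psi> w) + A (y - w) + C1 * (norm (y - w))\<^sup>2" if y: "y \<in> cube B (2 * \<rho>)" for y
              using h(2)[OF \<psi>X[OF y]] A(3)[OF y] by (simp add: abs_le_iff)
            then show "\<exists>A. linear A \<and> (\<forall>h. \<bar>A h\<bar> \<le> C1 * norm h) \<and>
                (\<forall>y\<in>cube B (2 * \<rho>). f (\<psi> y) \<le> f (\<psi> w) + A (y - w) + C1 * (norm (y - w))\<^sup>2)"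
              using A(1,2) by (intro exI[of _ A]) simp
          qed (rule C1)
          obtain \<omega> where \<omega>: "\<And>k. k \<in> \<Lambda> \<Longrightarrow> 0 \<le> \<omega> k"
            "\<And>k w v. \<lbrakk>k \<in> \<Lambda>; w \<in> span B; v \<in> span B;
              \<forall>b\<in>B. \<bar>w \<bullet> b - \<delta> * of_int (k b)\<bar> \<le> \<delta> / 2 \<and> \<bar>v \<bullet> b\<bar> \<le> \<delta>\<rbrakk> \<Longrightarrow>
              2 * f (\<psi> w) - f (\<psi> (w + v)) - f (\<psi> (w - v)) \<le> \<omega> k"
            "\<delta> ^ d * (\<Sum>k\<in>\<Lambda>. \<omega> k) \<le> K * \<delta>\<^sup>2"
            using lattice[OF \<delta>(1) \<delta>d sc] unfolding B(2) \<Lambda>_def by metis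
          have "\<delta> ^ d * (\<Sum>l\<in>\<Lambda>. \<omega> l + C2 * \<delta>\<^sup>2) = \<delta> ^ d * (\<Sum>l\<in>\<Lambda>. \<omega> l) + (card \<Lambda> * \<delta> ^ d) * (C2 * \<delta>\<^sup>2)"
            by (simp add: sum.distrib algebra_simps)
          also have "\<dots> \<le> K * \<delta>\<^sup>2 + (9 * \<rho>) ^ d * (C2 * \<delta>\<^sup>2)"
            using \<omega>(3) 1(2) parts by (intro add_mono mult_right_mono) auto
          finally have sum: "\<delta> ^ d * (\<Sum>l\<in>\<Lambda>. \<omega> l + C2 * \<delta>\<^sup>2) \<le> (K + (9 * \<rho>) ^ d * C2) * \<delta>\<^sup>2"
            by (simp add: algebra_simps)
          have "h x' - h x - (f x' - f x) \<le> \<omega> (q x) + C2 * \<delta>\<^sup>2 + s"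
            if x: "x \<in> U \<inter> X" "x' \<in> U \<inter> X" "q x = q x'" and h: "h \<in> \<F>"
              and s: "\<forall>y\<in>X. f y - f x \<le> h y - h x + s" for x x' h s
          proof -
            define w where "w = \<phi> x"
            define v where "v = \<phi> x' - \<phi> x"
            have wv: "w \<in> cube B \<rho>" "w + v \<in> cube B \<rho>" "\<psi> w = x" "\<psi> (w + v) = x'"
              using \<phi>\<psi> x by (auto simp: w_def v_def)
            have vb: "\<bar>v \<bullet> b\<bar> \<le> \<delta>" if "b \<in> B" for b using diff[OF x(3) that] by (simp add: v_def)
            have v: "v \<in> span B" using wv(1,2) span_diff[of "w + v" B w] by (simp add: cube_def)
            have "\<bar>(w - v) \<bullet> b\<bar> \<le> 2 * \<rho>" if b: "b \<in> B" for b
            proof -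
              have "\<bar>w \<bullet> b\<bar> \<le> \<rho>" using wv(1) b by (simp add: cube_def)
              then show ?thesis using vb[OF b] \<delta>\<rho> unfolding inner_diff_left by linarith
            qed
            then have refl: "w - v \<in> cube B (2 * \<rho>)"
              using wv(1) v by (simp add: cube_def span_diff)
            have "\<bar>h (\<psi> (w + v)) + h (\<psi> (w - v)) - 2 * h (\<psi> w)\<bar> \<le> 2 * C1 * (norm v)\<^sup>2"
              using taylor_on_second_difference[OF Tay[OF h]] wv cubes refl by blast
            also have "\<dots> \<le> 2 * C1 * (d * \<delta>)\<^sup>2"
              using ndiff[OF x(3,1,2)] C1 by (intro mult_left_mono power_mono) (auto simp: v_def)
            also have "\<dots> = C2 * \<delta>\<^sup>2" by (simp add: C2_def power_mult_distrib)
            finally have "h x' + h (\<psi> (w - v)) - 2 * h x \<le> C2 * \<delta>\<^sup>2" using wv by simp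
            moreover have "f (\<psi> (w - v)) - f x \<le> h (\<psi> (w - v)) - h x + s" using s \<psi>X[OF refl] by blast
            moreover have "2 * f (\<psi> w) - f (\<psi> (w + v)) - f (\<psi> (w - v)) \<le> \<omega> (q x)"
              using q\<Lambda>[OF x(1)] wv(1) v vb qb by (intro \<omega>(2)) (auto simp: w_def cube_def)
            \<comment> \<open>With \<open>y\<close> for the reflected point: the second difference
              of \<open>h\<close> bounds \<open>h x' - h x\<close> by \<open>h x - h y\<close> plus
              \<open>C2 * \<delta>\<^sup>2\<close>, the slack inequality bounds
              \<open>h x - h y\<close> by \<open>f x - f y + s\<close>, and
              \<open>2 * f x - f x' - f y\<close> is at most \<open>\<omega> (q x)\<close>.\<close>
            ultimately show ?thesis using wv by simp
          qed
          then show ?thesis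
            using \<omega>(1) parts sum by (intro exI[of _ "\<lambda>l. \<omega> l + C2 * \<delta>\<^sup>2"]) auto
        qed
        have le: "a * t \<le> C * t" if "a \<le> C" "0 \<le> t" for a t using that by (rule mult_right_mono)
        have "\<forall>f. concave_wrt \<F> X f \<longrightarrow> (\<exists>\<omega>. (\<forall>l\<in>\<Lambda>. 0 \<le> \<omega> l) \<and> \<delta> ^ d * (\<Sum>l\<in>\<Lambda>. \<omega> l) \<le> C * \<delta>\<^sup>2 \<and>
            (\<forall>x\<in>U \<inter> X. \<forall>x'\<in>U \<inter> X. q x = q x' \<longrightarrow> (\<forall>h\<in>\<F>. \<forall>s.
              (\<forall>y\<in>X. f y - f x \<le> h y - h x + s) \<longrightarrow> h x' - h x - (f x' - f x) \<le> \<omega> (q x) + s)))"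
          using 5 order_trans[OF _ le[OF C(5) zero_le_power2]] by metis
        moreover have "\<forall>l\<in>\<Lambda>. hausdorff_outer d {x \<in> U \<inter> X. q x = l} \<le> ennreal (C * \<delta> ^ d)"
          using 4 order_trans[OF _ ennreal_leI[OF le[OF C(4), of "\<delta> ^ d"]]] \<delta>(1) by auto
        moreover have "\<forall>x\<in>U \<inter> X. \<forall>x'\<in>U \<inter> X. q x = q x' \<longrightarrow> norm (x' - x) \<le> C * \<delta>"
          using 3 order_trans[OF _ le[OF C(3), of \<delta>]] \<delta>(1) by fastforce
        ultimately show "\<exists>(q :: 'a \<Rightarrow> 'a \<Rightarrow> int) \<Lambda>. finite \<Lambda> \<and> card \<Lambda> * \<delta> ^ d \<le> C \<and>
          (\<forall>x\<in>U \<inter> X. q x \<in> \<Lambda>) \<and> (\<forall>l\<in>\<Lambda>. {x \<in> U. q x = l} \<in> sets borel) \<and>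
          (\<forall>x\<in>U \<inter> X. \<forall>x'\<in>U \<inter> X. q x = q x' \<longrightarrow> norm (x' - x) \<le> C * \<delta>) \<and>
          (\<forall>l\<in>\<Lambda>. hausdorff_outer d {x \<in> U \<inter> X. q x = l} \<le> ennreal (C * \<delta> ^ d)) \<and>
          (\<forall>f. concave_wrt \<F> X f \<longrightarrow> (\<exists>\<omega>. (\<forall>l\<in>\<Lambda>. 0 \<le> \<omega> l) \<and> \<delta> ^ d * (\<Sum>l\<in>\<Lambda>. \<omega> l) \<le> C * \<delta>\<^sup>2 \<and>
            (\<forall>x\<in>U \<inter> X. \<forall>x'\<in>U \<inter> X. q x = q x' \<longrightarrow> (\<forall>h\<in>\<F>. \<forall>s.
              (\<forall>y\<in>X. f y - f x \<le> h y - h x + s) \<longrightarrow> h x' - h x - (f x' - f x) \<le> \<omega> (q x) + s))))"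
          using 1 2 q\<Lambda> C(2) by (intro exI[of _ q] exI[of _ \<Lambda>]) auto
      qed
    qed
  qed
qed

text \<open>Stated for the outer measure, which is monotone on all sets and has been estimated on
  the images of cubes; in this form the cells may be enlarged freely before their mass is
  bounded.\<close>

lemma bounded_density_le_hausdorff:
  fixes \<mu> :: "'a::euclidean_space measure"
  assumes "bounded_density_wrt (restrict_space (hausdorff_measure d) X) \<mu>"
  obtains D :: real where "0 \<le> D"
    "\<And>A. A \<in> sets \<mu> \<Longrightarrow> emeasure \<mu> A \<le> ennreal D * hausdorff_outer d A"
proof -
  let ?H = "restrict_space (hausdorff_measure d) X :: 'a measure"
  obtain f and K :: real where f: "f \<in> borel_measurable ?H" "AE x in ?H. f x \<le> ennreal K" "\<mu> = density ?H f"
    using assms unfolding bounded_density_wrt_def by blast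
  have "emeasure \<mu> A \<le> ennreal \<bar>K\<bar> * hausdorff_outer d A" if A: "A \<in> sets \<mu>" for A
  proof -
    have AH: "A \<in> sets ?H" using A f(3) by simp
    have "emeasure \<mu> A = (\<integral>\<^sup>+ x. f x * indicator A x \<partial>?H)"
      using emeasure_density[OF f(1) AH] f(3) by simp
    also have "\<dots> \<le> (\<integral>\<^sup>+ x. ennreal \<bar>K\<bar> * indicator A x \<partial>?H)"
      using f(2) by (intro nn_integral_mono_AE) (auto elim!: eventually_mono intro!: mult_right_mono
          order_trans[OF _ ennreal_leI[OF abs_ge_self]])
    also have "\<dots> = ennreal \<bar>K\<bar> * emeasure ?H A"
      using AH by (rule nn_integral_cmult_indicator)
    also have "\<dots> \<le> ennreal \<bar>K\<bar> * hausdorff_outer d A"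
    proof (rule mult_left_mono)
      \<comment> \<open>The restricted measure falls back to 0 where it is not a genuine
        restriction, and a set that is not Borel has measure 0; the inequality holds in either
        case.\<close>
      have "emeasure ?H A \<le> emeasure (hausdorff_measure d) A"
        unfolding restrict_space_def emeasure_measure_of_conv by simp
      also have "\<dots> \<le> hausdorff_outer d A"
      proof (cases "A \<in> sets borel")
        case True then show ?thesis by (simp add: emeasure_hausdorff_measure)
      next
        case False
        then have "A \<notin> sets (hausdorff_measure d)"
          using sets.sigma_sets_eq[of "borel :: 'a measure"] by (simp add: hausdorff_measure_def)
        then show ?thesis by (simp add: emeasure_notin_sets)
      qed
      finally show "emeasure ?H A \<le> hausdorff_outer d A" .
    qed simp
    finally show ?thesis .
  qed
  then show ?thesis using that[of "\<bar>K\<bar>"] by simp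
qed

text \<open>Compactness reduces \<open>K\<close> to finitely many charts, and a label is a chart
  index together with a lattice index. The bounded density gives each cell mass of order
  \<open>\<delta> ^ d\<close>, which converts the weight in front of the lattice sum of
  \<open>\<omega>\<close> into the measure of the cells.\<close>

lemma cells:
  fixes X :: "'a::euclidean_space set"
  assumes X: "C2_submanifold d X" and \<mu>: "borel_prob_measure_on X \<mu>"
    and dens: "bounded_density_wrt (restrict_space (hausdorff_measure d) X) \<mu>"
    and K: "compact K" "K \<subseteq> X"
    and F: "\<And>p. p \<in> K \<Longrightarrow> \<exists>r>0. \<exists>C. \<forall>h\<in>\<F>. taylor_on C (ball p r \<inter> X) h"
  obtains C \<delta>0 :: real where "0 \<le> C" "0 < \<delta>0"
    "\<And>\<delta>::real. \<lbrakk>0 < \<delta>; \<delta> \<le> \<delta>0\<rbrakk> \<Longrightarrow> \<exists>(q :: 'a \<Rightarrow> nat \<times> ('a \<Rightarrow> int)) \<Lambda>. finite \<Lambda> \<and> card \<Lambda> * \<delta> ^ d \<le> C \<and>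
      (\<forall>x\<in>K. q x \<in> \<Lambda>) \<and> (\<forall>l\<in>\<Lambda>. {x \<in> X. q x = l} \<in> sets \<mu>) \<and>
      (\<forall>x\<in>K. \<forall>x'\<in>K. q x = q x' \<longrightarrow> norm (x' - x) \<le> C * \<delta>) \<and>
      (\<forall>f. concave_wrt \<F> X f \<longrightarrow> (\<exists>\<omega>. (\<forall>l\<in>\<Lambda>. 0 \<le> \<omega> l) \<and>
        (\<Sum>l\<in>\<Lambda>. measure \<mu> {x \<in> X. q x = l} * \<omega> l) \<le> C * \<delta>\<^sup>2 \<and>
        (\<forall>x\<in>K. \<forall>x'\<in>K. q x = q x' \<longrightarrow> (\<forall>h\<in>\<F>. \<forall>s.
          (\<forall>y\<in>X. f y - f x \<le> h y - h x + s) \<longrightarrow> h x' - h x - (f x' - f x) \<le> \<omega> (q x) + s))))"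
proof -
  define good where "good U C \<delta>0 \<longleftrightarrow> open U \<and> 0 \<le> C \<and> 0 < \<delta>0 \<and>
    (\<forall>\<delta>::real. 0 < \<delta> \<longrightarrow> \<delta> \<le> \<delta>0 \<longrightarrow> (\<exists>(q :: 'a \<Rightarrow> 'a \<Rightarrow> int) \<Lambda>. finite \<Lambda> \<and> card \<Lambda> * \<delta> ^ d \<le> C \<and>
      (\<forall>x\<in>U \<inter> X. q x \<in> \<Lambda>) \<and> (\<forall>l\<in>\<Lambda>. {x \<in> U. q x = l} \<in> sets borel) \<and>
      (\<forall>x\<in>U \<inter> X. \<forall>x'\<in>U \<inter> X. q x = q x' \<longrightarrow> norm (x' - x) \<le> C * \<delta>) \<and>
      (\<forall>l\<in>\<Lambda>. hausdorff_outer d {x \<in> U \<inter> X. q x = l} \<le> ennreal (C * \<delta> ^ d)) \<and>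
      (\<forall>f. concave_wrt \<F> X f \<longrightarrow> (\<exists>\<omega>. (\<forall>l\<in>\<Lambda>. 0 \<le> \<omega> l) \<and> \<delta> ^ d * (\<Sum>l\<in>\<Lambda>. \<omega> l) \<le> C * \<delta>\<^sup>2 \<and>
        (\<forall>x\<in>U \<inter> X. \<forall>x'\<in>U \<inter> X. q x = q x' \<longrightarrow> (\<forall>h\<in>\<F>. \<forall>s.
          (\<forall>y\<in>X. f y - f x \<le> h y - h x + s) \<longrightarrow> h x' - h x - (f x' - f x) \<le> \<omega> (q x) + s))))))"
    for U and C \<delta>0 :: real
  have "\<exists>U C \<delta>0. p \<in> U \<and> good U C \<delta>0" if p: "p \<in> K" for p
  proof -
    obtain r C0 where r: "0 < r" "\<And>h. h \<in> \<F> \<Longrightarrow> taylor_on C0 (ball p r \<inter> X) h"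
      using F[OF p] by metis
    have pX: "p \<in> X" using p K by auto
    show ?thesis
      by (rule chart_cells[OF X pX r]) (unfold good_def, blast+)
  qed
  then obtain U c \<delta>1 where Uc: "\<And>p. p \<in> K \<Longrightarrow> p \<in> U p \<and> good (U p) (c p) (\<delta>1 p)" by metis
  obtain F where F: "F \<subseteq> K" "finite F" "K \<subseteq> (\<Union>p\<in>F. U p)"
  proof (rule compactE_image[OF K(1), of K U])
    show "open (U p)" if "p \<in> K" for p using Uc[OF that] by (simp add: good_def)
    show "K \<subseteq> (\<Union>p\<in>K. U p)" using Uc by blast
  qed auto
  obtain e where e: "bij_betw e {..<card F} F"
    using ex_bij_betw_nat_finite[OF F(2)] by (auto simp: lessThan_atLeast0)
  define N where "N = card F"
  have eK: "e j \<in> K" if "j < N" for j using e that F(1) by (auto simp: bij_betw_def N_def)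
  have cov: "\<exists>j<N. x \<in> U (e j)" if "x \<in> K" for x
    using subsetD[OF F(3) that] e unfolding bij_betw_def N_def by (metis UN_E imageE lessThan_iff)
  have g: "good (U (e j)) (c (e j)) (\<delta>1 (e j))" if "j < N" for j using Uc[OF eK[OF that]] by blast
  have c0: "0 \<le> c (e j)" "0 < \<delta>1 (e j)" "open (U (e j))" if "j < N" for j
    using g[OF that] by (simp_all add: good_def)
  obtain D where D: "0 \<le> D" "\<And>A. A \<in> sets \<mu> \<Longrightarrow> emeasure \<mu> A \<le> ennreal D * hausdorff_outer d A"
    using bounded_density_le_hausdorff[OF dens] by metis
  \<comment> \<open>\<open>c (e j)\<close> covers number and diameter of the cells of one chart. The
    product arises in the weighted sum, where the mass bound
    \<open>D * c (e j) * \<delta> ^ d\<close> of a cell meets the bound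
    \<open>c (e j) * \<delta>\<^sup>2\<close> for the lattice sum.\<close>
  define C where "C = (\<Sum>j<N. c (e j) + D * c (e j) * c (e j))"
  have cC: "c (e j) \<le> C" if "j < N" for j
  proof -
    have "c (e j) \<le> c (e j) + D * c (e j) * c (e j)" using D(1) c0[OF that] by simp
    also have "\<dots> \<le> C" unfolding C_def
      using that D(1) c0 by (intro member_le_sum) auto
    finally show ?thesis .
  qed
  have C0: "0 \<le> C" unfolding C_def using D(1) c0 by (intro sum_nonneg) auto
  define \<delta>0 where "\<delta>0 = Min (insert 1 ((\<lambda>j. \<delta>1 (e j)) ` {..<N}))"
  have \<delta>0: "0 < \<delta>0" unfolding \<delta>0_def using c0 by (subst Min_gr_iff) auto
  have \<delta>0_le: "\<delta>0 \<le> \<delta>1 (e j)" if "j < N" for j unfolding \<delta>0_def using that by (intro Min_le) auto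
  have sets\<mu>: "sets \<mu> = sets (restrict_space borel X)" using \<mu> by (simp add: borel_prob_measure_on_def)
  interpret prob_space \<mu> using \<mu> by (simp add: borel_prob_measure_on_def)
  show ?thesis
  proof (rule that[OF C0 \<delta>0])
    fix \<delta> :: real assume \<delta>: "0 < \<delta>" "\<delta> \<le> \<delta>0"
    define V where "V j = U (e j)" for j
    define b where "b j = c (e j)" for j
    define P where "P j q \<Lambda> \<longleftrightarrow> finite \<Lambda> \<and> card \<Lambda> * \<delta> ^ d \<le> b j \<and>
      (\<forall>x\<in>V j \<inter> X. q x \<in> \<Lambda>) \<and> (\<forall>l\<in>\<Lambda>. {x \<in> V j. q x = l} \<in> sets borel) \<and>
      (\<forall>x\<in>V j \<inter> X. \<forall>x'\<in>V j \<inter> X. q x = q x' \<longrightarrow> norm (x' - x) \<le> b j * \<delta>) \<and>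
      (\<forall>l\<in>\<Lambda>. hausdorff_outer d {x \<in> V j \<inter> X. q x = l} \<le> ennreal (b j * \<delta> ^ d)) \<and>
      (\<forall>f. concave_wrt \<F> X f \<longrightarrow> (\<exists>\<omega>. (\<forall>l\<in>\<Lambda>. 0 \<le> \<omega> l) \<and> \<delta> ^ d * (\<Sum>l\<in>\<Lambda>. \<omega> l) \<le> b j * \<delta>\<^sup>2 \<and>
        (\<forall>x\<in>V j \<inter> X. \<forall>x'\<in>V j \<inter> X. q x = q x' \<longrightarrow> (\<forall>h\<in>\<F>. \<forall>s.
          (\<forall>y\<in>X. f y - f x \<le> h y - h x + s) \<longrightarrow> h x' - h x - (f x' - f x) \<le> \<omega> (q x) + s))))"
      for j and q :: "'a \<Rightarrow> 'a \<Rightarrow> int" and \<Lambda>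
    have "\<exists>q \<Lambda>. P j q \<Lambda>" if "j < N" for j
      using g[OF that] \<delta>(1) order_trans[OF \<delta>(2) \<delta>0_le[OF that]] unfolding good_def V_def b_def P_def by blast
    then obtain Q \<Lambda> where P: "\<And>j. j < N \<Longrightarrow> P j (Q j) (\<Lambda> j)" by metis
    have Q: "\<And>j. j < N \<Longrightarrow> finite (\<Lambda> j)" "\<And>j. j < N \<Longrightarrow> card (\<Lambda> j) * \<delta> ^ d \<le> b j"
      "\<And>j. j < N \<Longrightarrow> \<forall>x\<in>V j \<inter> X. Q j x \<in> \<Lambda> j"
      "\<And>j. j < N \<Longrightarrow> \<forall>l\<in>\<Lambda> j. {x \<in> V j. Q j x = l} \<in> sets borel"
      "\<And>j. j < N \<Longrightarrow> \<forall>x\<in>V j \<inter> X. \<forall>x'\<in>V j \<inter> X. Q j x = Q j x' \<longrightarrow> norm (x' - x) \<le> b j * \<delta>"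
      "\<And>j. j < N \<Longrightarrow> \<forall>l\<in>\<Lambda> j. hausdorff_outer d {x \<in> V j \<inter> X. Q j x = l} \<le> ennreal (b j * \<delta> ^ d)"
      "\<And>j. j < N \<Longrightarrow> \<forall>f. concave_wrt \<F> X f \<longrightarrow> (\<exists>\<omega>. (\<forall>l\<in>\<Lambda> j. 0 \<le> \<omega> l) \<and> \<delta> ^ d * (\<Sum>l\<in>\<Lambda> j. \<omega> l) \<le> b j * \<delta>\<^sup>2 \<and>
        (\<forall>x\<in>V j \<inter> X. \<forall>x'\<in>V j \<inter> X. Q j x = Q j x' \<longrightarrow> (\<forall>h\<in>\<F>. \<forall>s.
          (\<forall>y\<in>X. f y - f x \<le> h y - h x + s) \<longrightarrow> h x' - h x - (f x' - f x) \<le> \<omega> (Q j x) + s)))"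
      using P unfolding P_def by blast+
    \<comment> \<open>A point belongs to the first chart domain containing it; \<open>N\<close>
      marks points outside all of them, which do not occur in \<open>K\<close>.\<close>
    define ind where "ind x = (if \<exists>j<N. x \<in> V j then LEAST j. j < N \<and> x \<in> V j else N)" for x
    have ind: "ind x = j \<longleftrightarrow> x \<in> V j \<and> (\<forall>i<j. x \<notin> V i)" if "j < N" for x j
    proof
      assume "ind x = j"
      then have ex: "\<exists>j<N. x \<in> V j" and L: "j = (LEAST j. j < N \<and> x \<in> V j)"
        using that by (auto simp: ind_def split: if_splits)
      show "x \<in> V j \<and> (\<forall>i<j. x \<notin> V i)"
        using LeastI_ex[OF ex] not_less_Least[of _ "\<lambda>j. j < N \<and> x \<in> V j"] that unfolding L[symmetric]
        by (meson less_trans)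
    next
      assume *: "x \<in> V j \<and> (\<forall>i<j. x \<notin> V i)"
      then have "(LEAST j. j < N \<and> x \<in> V j) = j"
        using that by (intro Least_equality) (auto simp: not_less[symmetric])
      then show "ind x = j" using * that by (auto simp: ind_def)
    qed
    have indK: "ind x < N \<and> x \<in> V (ind x)" if "x \<in> K" for x
    proof -
      have "\<exists>j<N. x \<in> V j" using cov[OF that] by (simp add: V_def)
      then have "ind x = (LEAST j. j < N \<and> x \<in> V j)" "\<exists>j. j < N \<and> x \<in> V j" by (auto simp: ind_def)
      then show ?thesis using LeastI_ex[of "\<lambda>j. j < N \<and> x \<in> V j"] by metis
    qed
    define q where "q x = (ind x, Q (ind x) x)" for x
    define L where "L = Sigma {..<N} \<Lambda>"
    \<comment> \<open>Removing the earlier charts makes the cells disjoint and only shrinks them, so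
      the upper bounds obtained in the chart persist.\<close>
    have cell: "{x \<in> X. q x = (j, l)} = X \<inter> ({x \<in> V j. Q j x = l} - (\<Union>i<j. V i))" if "j < N" for j l
    proof -
      have "q x = (j, l) \<longleftrightarrow> ind x = j \<and> Q j x = l" for x by (auto simp: q_def)
      then show ?thesis using ind[OF that] by auto
    qed
    have "card L * \<delta> ^ d = (\<Sum>j<N. card (\<Lambda> j) * \<delta> ^ d)"
      unfolding L_def using Q(1) by (subst card_SigmaI) (auto simp: sum_distrib_right)
    also have "\<dots> \<le> (\<Sum>j<N. b j)" using Q(2) by (intro sum_mono) auto
    also have "\<dots> \<le> C" unfolding C_def b_def using D(1) c0 by (intro sum_mono) auto
    finally have 1: "card L * \<delta> ^ d \<le> C" .
    have 2: "finite L" unfolding L_def using Q(1) by auto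
    have 3: "q x \<in> L" if "x \<in> K" for x
      using indK[OF that] Q(3) K(2) that by (auto simp: q_def L_def)
    have 4: "{x \<in> X. q x = l} \<in> sets \<mu>" if "l \<in> L" for l
    proof -
      obtain j k where l: "l = (j, k)" "j < N" "k \<in> \<Lambda> j" using \<open>l \<in> L\<close> by (auto simp: L_def)
      have "{x \<in> V j. Q j x = k} - (\<Union>i<j. V i) \<in> sets borel"
      proof (rule sets.Diff)
        show "{x \<in> V j. Q j x = k} \<in> sets borel" using Q(4)[OF l(2)] l(3) by blast
        show "(\<Union>i<j. V i) \<in> sets borel"
          using c0(3) l(2) by (intro borel_open open_UN) (auto simp: V_def)
      qed
      then show ?thesis unfolding l(1) cell[OF l(2)] sets\<mu> sets_restrict_space by blast
    qed
    have 5: "norm (x' - x) \<le> C * \<delta>" if "x \<in> K" "x' \<in> K" "q x = q x'" for x x'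
    proof -
      have "ind x = ind x'" "Q (ind x) x = Q (ind x) x'" using that(3) by (auto simp: q_def)
      then have "norm (x' - x) \<le> b (ind x) * \<delta>"
        using Q(5)[of "ind x"] indK[OF that(1)] indK[OF that(2)] that K(2) by auto
      also have "\<dots> \<le> C * \<delta>" using cC[of "ind x"] indK[OF that(1)] \<delta>(1) by (intro mult_right_mono) (auto simp: b_def)
      finally show ?thesis .
    qed
    have meas: "measure \<mu> {x \<in> X. q x = (j, l)} \<le> D * (b j * \<delta> ^ d)" if j: "j < N" "l \<in> \<Lambda> j" for j l
    proof -
      have "emeasure \<mu> {x \<in> X. q x = (j, l)} \<le> ennreal D * hausdorff_outer d {x \<in> X. q x = (j, l)}"
        using j by (intro D(2) 4) (auto simp: L_def)
      also have "\<dots> \<le> ennreal D * hausdorff_outer d {x \<in> V j \<inter> X. Q j x = l}"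
        unfolding cell[OF j(1)] by (intro mult_left_mono hausdorff_outer_mono) auto
      also have "\<dots> \<le> ennreal D * ennreal (b j * \<delta> ^ d)"
        using Q(6)[OF j(1)] j(2) by (intro mult_left_mono) auto
      also have "\<dots> = ennreal (D * (b j * \<delta> ^ d))"
        using D(1) c0[OF j(1)] \<delta>(1) by (simp add: ennreal_mult' b_def)
      finally show ?thesis
        using D(1) c0[OF j(1)] \<delta>(1) by (simp add: emeasure_eq_measure b_def)
    qed
    have 6: "\<exists>\<omega>. (\<forall>l\<in>L. 0 \<le> \<omega> l) \<and> (\<Sum>l\<in>L. measure \<mu> {x \<in> X. q x = l} * \<omega> l) \<le> C * \<delta>\<^sup>2 \<and>
        (\<forall>x\<in>K. \<forall>x'\<in>K. q x = q x' \<longrightarrow> (\<forall>h\<in>\<F>. \<forall>s.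
          (\<forall>y\<in>X. f y - f x \<le> h y - h x + s) \<longrightarrow> h x' - h x - (f x' - f x) \<le> \<omega> (q x) + s))"
      if f: "concave_wrt \<F> X f" for f
    proof -
      define W where "W j \<omega> \<longleftrightarrow> (\<forall>l\<in>\<Lambda> j. 0 \<le> \<omega> l) \<and> \<delta> ^ d * (\<Sum>l\<in>\<Lambda> j. \<omega> l) \<le> b j * \<delta>\<^sup>2 \<and>
        (\<forall>x\<in>V j \<inter> X. \<forall>x'\<in>V j \<inter> X. Q j x = Q j x' \<longrightarrow> (\<forall>h\<in>\<F>. \<forall>s.
          (\<forall>y\<in>X. f y - f x \<le> h y - h x + s) \<longrightarrow> h x' - h x - (f x' - f x) \<le> \<omega> (Q j x) + s))" for j \<omega>
      have "\<exists>\<omega>. W j \<omega>" if "j < N" for j using Q(7)[OF that] f unfolding W_def by blast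
      then obtain w where W: "\<And>j. j < N \<Longrightarrow> W j (w j)" by metis
      have w: "\<And>j. j < N \<Longrightarrow> \<forall>l\<in>\<Lambda> j. 0 \<le> w j l"
        "\<And>j. j < N \<Longrightarrow> \<delta> ^ d * (\<Sum>l\<in>\<Lambda> j. w j l) \<le> b j * \<delta>\<^sup>2"
        "\<And>j. j < N \<Longrightarrow> \<forall>x\<in>V j \<inter> X. \<forall>x'\<in>V j \<inter> X. Q j x = Q j x' \<longrightarrow> (\<forall>h\<in>\<F>. \<forall>s.
          (\<forall>y\<in>X. f y - f x \<le> h y - h x + s) \<longrightarrow> h x' - h x - (f x' - f x) \<le> w j (Q j x) + s)"
        using W unfolding W_def by blast+
      have "(\<Sum>l\<in>L. measure \<mu> {x \<in> X. q x = l} * w (fst l) (snd l)) =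
          (\<Sum>j<N. \<Sum>l\<in>\<Lambda> j. measure \<mu> {x \<in> X. q x = (j, l)} * w j l)"
        unfolding L_def using Q(1) by (subst sum.Sigma) (auto simp: case_prod_beta)
      also have "\<dots> \<le> (\<Sum>j<N. \<Sum>l\<in>\<Lambda> j. D * (b j * \<delta> ^ d) * w j l)"
        using meas w(1) by (intro sum_mono mult_right_mono) auto
      also have "\<dots> = (\<Sum>j<N. D * b j * (\<delta> ^ d * (\<Sum>l\<in>\<Lambda> j. w j l)))"
        by (simp add: sum_distrib_left mult.assoc)
      also have "\<dots> \<le> (\<Sum>j<N. D * b j * (b j * \<delta>\<^sup>2))"
        using w(2) D(1) c0 by (intro sum_mono mult_left_mono) (auto simp: b_def)
      also have "\<dots> \<le> (\<Sum>j<N. (b j + D * b j * b j) * \<delta>\<^sup>2)"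
        using c0 by (intro sum_mono) (auto simp: b_def distrib_right)
      also have "\<dots> = C * \<delta>\<^sup>2" by (simp add: C_def b_def sum_distrib_right)
      finally have sum: "(\<Sum>l\<in>L. measure \<mu> {x \<in> X. q x = l} * w (fst l) (snd l)) \<le> C * \<delta>\<^sup>2" .
      have "h x' - h x - (f x' - f x) \<le> w (fst (q x)) (snd (q x)) + s"
        if x: "x \<in> K" "x' \<in> K" "q x = q x'" and h: "h \<in> \<F>" "\<forall>y\<in>X. f y - f x \<le> h y - h x + s" for x x' h s
      proof -
        have "ind x = ind x'" "Q (ind x) x = Q (ind x) x'" using x(3) by (auto simp: q_def)
        then have "x \<in> V (ind x) \<inter> X" "x' \<in> V (ind x) \<inter> X" "ind x < N"
          using indK[OF x(1)] indK[OF x(2)] x K(2) by auto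
        with w(3)[of "ind x"] \<open>Q (ind x) x = Q (ind x) x'\<close> h show ?thesis by (simp add: q_def)
      qed
      with sum w(1) show ?thesis
        by (intro exI[of _ "\<lambda>l. w (fst l) (snd l)"]) (auto simp: L_def)
    qed
    show "\<exists>(q :: 'a \<Rightarrow> nat \<times> ('a \<Rightarrow> int)) \<Lambda>. finite \<Lambda> \<and> card \<Lambda> * \<delta> ^ d \<le> C \<and>
      (\<forall>x\<in>K. q x \<in> \<Lambda>) \<and> (\<forall>l\<in>\<Lambda>. {x \<in> X. q x = l} \<in> sets \<mu>) \<and>
      (\<forall>x\<in>K. \<forall>x'\<in>K. q x = q x' \<longrightarrow> norm (x' - x) \<le> C * \<delta>) \<and>
      (\<forall>f. concave_wrt \<F> X f \<longrightarrow> (\<exists>\<omega>. (\<forall>l\<in>\<Lambda>. 0 \<le> \<omega> l) \<and>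
        (\<Sum>l\<in>\<Lambda>. measure \<mu> {x \<in> X. q x = l} * \<omega> l) \<le> C * \<delta>\<^sup>2 \<and>
        (\<forall>x\<in>K. \<forall>x'\<in>K. q x = q x' \<longrightarrow> (\<forall>h\<in>\<F>. \<forall>s.
          (\<forall>y\<in>X. f y - f x \<le> h y - h x + s) \<longrightarrow> h x' - h x - (f x' - f x) \<le> \<omega> (q x) + s))))"
      using 1 2 3 4 5 6 by (intro exI[of _ q] exI[of _ L]) auto
  qed
qed

section \<open>Block approximation\<close>

lemma ext_integral_eq_integral:
  assumes "integrable M f"
  shows "ext_integral M f = ereal (\<integral>x. f x \<partial>M)"
proof -
  have *: "(\<integral>\<^sup>+ x. ennreal (f x) \<partial>M) < top" "(\<integral>\<^sup>+ x. ennreal (- f x) \<partial>M) < top"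
    using assms unfolding real_integrable_def by (auto simp: less_top)
  then obtain a b where "(\<integral>\<^sup>+ x. ennreal (f x) \<partial>M) = ennreal a" "0 \<le> a"
    "(\<integral>\<^sup>+ x. ennreal (- f x) \<partial>M) = ennreal b" "0 \<le> b"
    using less_top_ennreal by metis
  then show ?thesis unfolding ext_integral_def real_lebesgue_integral_def[OF assms] by simp
qed

lemma ext_integral_nonneg:
  assumes "\<And>x. x \<in> space M \<Longrightarrow> 0 \<le> f x"
  shows "ext_integral M f = enn2ereal (\<integral>\<^sup>+ x. ennreal (f x) \<partial>M)"
proof -
  have "(\<integral>\<^sup>+ x. ennreal (- f x) \<partial>M) = (\<integral>\<^sup>+ x. 0 \<partial>M)"
    using assms by (intro nn_integral_cong) (simp add: ennreal_neg)
  then show ?thesis by (simp add: ext_integral_def zero_ennreal.rep_eq)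
qed

lemma ext_integral_cong_AE:
  assumes "AE x in M. f x = g x"
  shows "ext_integral M f = ext_integral M g"
proof -
  have "(\<integral>\<^sup>+ x. ennreal (f x) \<partial>M) = (\<integral>\<^sup>+ x. ennreal (g x) \<partial>M)"
    "(\<integral>\<^sup>+ x. ennreal (- f x) \<partial>M) = (\<integral>\<^sup>+ x. ennreal (- g x) \<partial>M)"
    using assms by (auto intro!: nn_integral_cong_AE elim: eventually_mono)
  then show ?thesis by (simp add: ext_integral_def)
qed

text \<open>Gibbs' inequality against the uniform distribution: \<open>ln t \<le> t - 1\<close> at
  \<open>t = 1 / (a l * n)\<close> gives a bound for each label, and the corrections
  \<open>1 / n - a l\<close> sum to 0. For \<open>a l = 0\<close> the bound reads
  \<open>0 \<le> 1 / n\<close>.\<close>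

lemma entropy_le_ln_card:
  fixes a :: "'l \<Rightarrow> real"
  assumes "finite \<Lambda>" "\<And>l. l \<in> \<Lambda> \<Longrightarrow> 0 \<le> a l" "(\<Sum>l\<in>\<Lambda>. a l) = 1"
  shows "(\<Sum>l\<in>\<Lambda>. a l * - ln (a l)) \<le> ln (card \<Lambda>)"
proof -
  define n where "n = real (card \<Lambda>)"
  have "\<Lambda> \<noteq> {}" using assms(3) by auto
  then have n: "0 < n" using assms(1) by (simp add: n_def card_gt_0_iff)
  have "a l * - ln (a l) \<le> a l * ln n + (1 / n - a l)" if l: "l \<in> \<Lambda>" for l
  proof (cases "a l = 0")
    case False
    then have a: "0 < a l" using assms(2)[OF l] by simp
    have "ln (1 / (a l * n)) \<le> 1 / (a l * n) - 1" using a n by (intro ln_le_minus_one) simp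
    then have "a l * (- ln (a l) - ln n) \<le> a l * (1 / (a l * n) - 1)"
      using a n by (intro mult_left_mono) (simp_all add: ln_div ln_mult)
    also have "\<dots> = 1 / n - a l" using a n by (simp add: field_simps)
    finally show ?thesis by (simp add: algebra_simps)
  qed (use n in simp)
  then have "(\<Sum>l\<in>\<Lambda>. a l * - ln (a l)) \<le> (\<Sum>l\<in>\<Lambda>. a l * ln n + (1 / n - a l))"
    by (rule sum_mono)
  also have "\<dots> = ln n"
    using n assms(3) by (simp add: sum.distrib sum_subtractf sum_distrib_right[symmetric] n_def)
  finally show ?thesis by (simp add: n_def)
qed

text \<open>Inside a block the new measure is proportional to the product measure, so given the
  label in factor \<open>i\<close> the coordinate is distributed as \<open>\<mu> i\<close>
  conditioned on its cell. Since \<open>P\<close> gives the labels the masses of the cells, mixing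
  these conditional laws restores \<open>\<mu> i\<close> exactly.\<close>

lemma block_density:
  fixes \<mu> :: "'m::finite \<Rightarrow> 'a measure" and q :: "'m \<Rightarrow> 'a \<Rightarrow> 'l" and P :: "('m \<Rightarrow> 'l) \<Rightarrow> real"
  assumes prob: "\<And>i. prob_space (\<mu> i)" and fin: "\<And>i. finite (\<Lambda> i)"
    and meas: "\<And>i l. l \<in> \<Lambda> i \<Longrightarrow> {x \<in> space (\<mu> i). q i x = l} \<in> sets (\<mu> i)"
    and ae: "\<And>i. AE x in \<mu> i. q i x \<in> \<Lambda> i"
    and P0: "\<And>Q. Q \<in> PiE UNIV \<Lambda> \<Longrightarrow> 0 \<le> P Q"
    and marg: "\<And>i l. l \<in> \<Lambda> i \<Longrightarrow> (\<Sum>Q\<in>{Q \<in> PiE UNIV \<Lambda>. Q i = l}. P Q) = measure (\<mu> i) {x \<in> space (\<mu> i). q i x = l}"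
  defines "a \<equiv> \<lambda>i l. measure (\<mu> i) {x \<in> space (\<mu> i). q i x = l}"
    and "block \<equiv> \<lambda>Q. {\<omega> \<in> space (PiM UNIV \<mu>). \<forall>i. q i (\<omega> i) = Q i}"
  defines "\<rho> \<equiv> \<lambda>\<omega>. \<Sum>Q\<in>PiE UNIV \<Lambda>. P Q / (\<Prod>i\<in>UNIV. a i (Q i)) * indicator (block Q) \<omega>"
  defines "N \<equiv> density (PiM UNIV \<mu>) (\<lambda>\<omega>. ennreal (\<rho> \<omega>))"
  shows "\<And>Q. Q \<in> PiE UNIV \<Lambda> \<Longrightarrow> block Q \<in> sets (PiM UNIV \<mu>)"
    and "\<And>Q. Q \<in> PiE UNIV \<Lambda> \<Longrightarrow> measure (PiM UNIV \<mu>) (block Q) = (\<Prod>i\<in>UNIV. a i (Q i))"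
    and "\<rho> \<in> borel_measurable (PiM UNIV \<mu>)"
    and "\<And>Q. Q \<in> PiE UNIV \<Lambda> \<Longrightarrow> emeasure N (block Q) = ennreal (P Q)"
    and "\<And>i A. A \<in> sets (\<mu> i) \<Longrightarrow> emeasure N {\<omega> \<in> space (PiM UNIV \<mu>). \<omega> i \<in> A} = emeasure (\<mu> i) A"
proof -
  interpret product_prob_space \<mu> UNIV
    by (intro product_prob_space.intro product_sigma_finite.intro product_prob_space_axioms.intro prob)
       (use prob prob_space_imp_sigma_finite in blast)
  interpret finite_product_prob_space \<mu> UNIV by unfold_locales simp
  define \<Omega> where "\<Omega> = PiE UNIV \<Lambda>"
  define C where "C i l = {x \<in> space (\<mu> i). q i x = l}" for i l
  have finC: "finite \<Omega>" unfolding \<Omega>_def using fin by (intro finite_PiE) auto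
  have CM: "C i (Q i) \<in> sets (\<mu> i)" if "Q \<in> \<Omega>" for Q i
    using meas[of "Q i" i] that by (auto simp: C_def \<Omega>_def)
  have block: "block Q = PiE UNIV (\<lambda>i. C i (Q i))" for Q
    by (auto simp: block_def C_def space_PiM PiE_def Pi_def)
  show blockM: "block Q \<in> sets (PiM UNIV \<mu>)" if "Q \<in> PiE UNIV \<Lambda>" for Q
    unfolding block using CM that by (intro sets_PiM_I_finite) (auto simp: \<Omega>_def)
  have box: "measure (PiM UNIV \<mu>) (PiE UNIV A) = (\<Prod>i\<in>UNIV. measure (\<mu> i) (A i))"
    if "\<And>i. A i \<in> sets (\<mu> i)" for A
    using measure_times[of A] that by (simp add: M.emeasure_eq_measure emeasure_eq_measure prod_ennreal prod_nonneg)
  show mblock: "measure (PiM UNIV \<mu>) (block Q) = (\<Prod>i\<in>UNIV. a i (Q i))" if "Q \<in> PiE UNIV \<Lambda>" for Q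
    unfolding block using box[of "\<lambda>i. C i (Q i)"] CM[of Q] that by (simp add: \<Omega>_def a_def C_def)
  show \<rho>M: "\<rho> \<in> borel_measurable (PiM UNIV \<mu>)"
    unfolding \<rho>_def using blockM by (intro borel_measurable_sum borel_measurable_times borel_measurable_indicator) auto
  define c where "c Q = P Q / (\<Prod>i\<in>UNIV. a i (Q i))" for Q
  have a0: "0 \<le> a i l" for i l by (simp add: a_def)
  have c0: "0 \<le> c Q" if "Q \<in> \<Omega>" for Q
    using P0 that a0 unfolding c_def \<Omega>_def by (intro divide_nonneg_nonneg prod_nonneg) auto
  \<comment> \<open>Domination by the marginals: a block over a null cell carries no mass, so the
    value 0 of a division by 0 in \<open>c\<close> is the right one.\<close>
  have P_le: "P Q \<le> a i (Q i)" if "Q \<in> \<Omega>" for Q i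
  proof -
    have "P Q \<le> (\<Sum>R\<in>{R \<in> \<Omega>. R i = Q i}. P R)"
      using that finC P0 by (intro member_le_sum) (auto simp: \<Omega>_def)
    also have "\<dots> = a i (Q i)" unfolding a_def \<Omega>_def using that by (intro marg) (auto simp: \<Omega>_def)
    finally show ?thesis .
  qed
  have P_c: "c Q * (\<Prod>i\<in>UNIV. a i (Q i)) = P Q" if "Q \<in> \<Omega>" for Q
  proof (cases "(\<Prod>i\<in>UNIV. a i (Q i)) = 0")
    case True
    then obtain i where "a i (Q i) = 0" by auto
    then have "P Q = 0" using P_le[OF that, of i] P0[of Q] that by (simp add: \<Omega>_def)
    then show ?thesis by (simp add: c_def)
  qed (simp add: c_def)
  have N: "emeasure N B = (\<Sum>Q\<in>\<Omega>. ennreal (c Q * measure (PiM UNIV \<mu>) (block Q \<inter> B)))"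
    if B: "B \<in> sets (PiM UNIV \<mu>)" for B
  proof -
    have "emeasure N B = (\<integral>\<^sup>+ \<omega>. ennreal (\<rho> \<omega>) * indicator B \<omega> \<partial>PiM UNIV \<mu>)"
      unfolding N_def using \<rho>M B by (subst emeasure_density) auto
    also have "\<dots> = (\<integral>\<^sup>+ \<omega>. (\<Sum>Q\<in>\<Omega>. ennreal (c Q) * indicator (block Q \<inter> B) \<omega>) \<partial>PiM UNIV \<mu>)"
    proof (intro nn_integral_cong)
      fix \<omega>
      have "ennreal (\<rho> \<omega>) = (\<Sum>Q\<in>\<Omega>. ennreal (c Q * indicator (block Q) \<omega>))"
        unfolding \<rho>_def c_def[symmetric] \<Omega>_def[symmetric] using c0 by (subst sum_ennreal) auto
      also have "\<dots> = (\<Sum>Q\<in>\<Omega>. ennreal (c Q) * indicator (block Q) \<omega>)"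
        by (intro sum.cong) (auto split: split_indicator)
      finally show "ennreal (\<rho> \<omega>) * indicator B \<omega> = (\<Sum>Q\<in>\<Omega>. ennreal (c Q) * indicator (block Q \<inter> B) \<omega>)"
        by (simp add: sum_distrib_right indicator_inter_arith mult.assoc)
    qed
    also have "\<dots> = (\<Sum>Q\<in>\<Omega>. \<integral>\<^sup>+ \<omega>. ennreal (c Q) * indicator (block Q \<inter> B) \<omega> \<partial>PiM UNIV \<mu>)"
      using blockM B by (intro nn_integral_sum) (auto simp: \<Omega>_def)
    also have "\<dots> = (\<Sum>Q\<in>\<Omega>. ennreal (c Q * measure (PiM UNIV \<mu>) (block Q \<inter> B)))"
      using blockM B c0
      by (intro sum.cong refl) (subst nn_integral_cmult_indicator, auto simp: \<Omega>_def emeasure_eq_measure ennreal_mult)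
    finally show ?thesis .
  qed
  show "emeasure N (block Q) = ennreal (P Q)" if Q: "Q \<in> PiE UNIV \<Lambda>" for Q
  proof -
    have "emeasure N (block Q) = (\<Sum>R\<in>\<Omega>. ennreal (c R * measure (PiM UNIV \<mu>) (block R \<inter> block Q)))"
      using N blockM[OF Q] .
    also have "\<dots> = (\<Sum>R\<in>\<Omega>. if R = Q then ennreal (P Q) else 0)"
    proof (intro sum.cong refl)
      fix R assume R: "R \<in> \<Omega>"
      show "ennreal (c R * measure (PiM UNIV \<mu>) (block R \<inter> block Q)) = (if R = Q then ennreal (P Q) else 0)"
      proof (cases "R = Q")
        case True then show ?thesis using P_c[OF R] mblock[OF Q] by simp
      next
        case False
        then have "block R \<inter> block Q = {}" by (auto simp: block_def fun_eq_iff)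
        then show ?thesis using False by simp
      qed
    qed
    also have "\<dots> = ennreal (P Q)" using Q finC by (simp add: \<Omega>_def)
    finally show ?thesis .
  qed
  show "emeasure N {\<omega> \<in> space (PiM UNIV \<mu>). \<omega> i \<in> A} = emeasure (\<mu> i) A" if A: "A \<in> sets (\<mu> i)" for i A
  proof -
    define B where "B = {\<omega> \<in> space (PiM UNIV \<mu>). \<omega> i \<in> A}"
    have B: "B \<in> sets (PiM UNIV \<mu>)" unfolding B_def using A by measurable
    \<comment> \<open>\<open>v l\<close> is the conditional probability of \<open>A\<close> in the
      cell \<open>l\<close>, with value 0 on null cells. By the product structure inside a block it
      depends on the label in factor \<open>i\<close> only, which reduces the sum over blocks to a
      marginal sum.\<close>
    define v where "v l = measure (\<mu> i) (C i l \<inter> A) / a i l" for l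
    have Cl: "C i l \<in> sets (\<mu> i)" if "l \<in> \<Lambda> i" for l using meas[OF that] by (simp add: C_def)
    have v: "a i l * v l = measure (\<mu> i) (C i l \<inter> A)" if "l \<in> \<Lambda> i" for l
    proof (cases "a i l = 0")
      case True
      then have "measure (\<mu> i) (C i l \<inter> A) = 0"
        using M.finite_measure_mono[of "C i l \<inter> A" "C i l" i] Cl[OF that]
        by (simp add: a_def C_def measure_le_0_iff)
      then show ?thesis by (simp add: v_def)
    qed (simp add: v_def)
    have cv: "c Q * measure (PiM UNIV \<mu>) (block Q \<inter> B) = P Q * v (Q i)" if Q: "Q \<in> \<Omega>" for Q
    proof -
      have Qi: "Q i \<in> \<Lambda> i" using Q by (auto simp: \<Omega>_def)
      have "block Q \<inter> B = PiE UNIV (\<lambda>k. if k = i then C i (Q i) \<inter> A else C k (Q k))"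
        unfolding block using sets.sets_into_space[OF A]
        by (auto simp: B_def C_def space_PiM PiE_def Pi_def split: if_splits)
      then have "measure (PiM UNIV \<mu>) (block Q \<inter> B) =
          (\<Prod>k\<in>UNIV. measure (\<mu> k) (if k = i then C i (Q i) \<inter> A else C k (Q k)))"
        using box[of "\<lambda>k. if k = i then C i (Q i) \<inter> A else C k (Q k)"] CM[OF Q] A by auto
      also have "\<dots> = measure (\<mu> i) (C i (Q i) \<inter> A) * (\<Prod>k\<in>UNIV-{i}. a k (Q k))"
        by (subst prod.remove[of _ i]) (auto simp: a_def C_def intro!: prod.cong)
      also have "\<dots> = v (Q i) * (\<Prod>k\<in>UNIV. a k (Q k))"
        using v[OF Qi] by (subst (2) prod.remove[of _ i]) (auto simp: mult.commute mult.left_commute)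
      finally have "c Q * measure (PiM UNIV \<mu>) (block Q \<inter> B) = (c Q * (\<Prod>k\<in>UNIV. a k (Q k))) * v (Q i)"
        by simp
      then show ?thesis using P_c[OF Q] by simp
    qed
    have "emeasure N B = (\<Sum>Q\<in>\<Omega>. ennreal (P Q * v (Q i)))" using N[OF B] cv by simp
    also have "\<dots> = ennreal (\<Sum>Q\<in>\<Omega>. P Q * v (Q i))"
      using P0 by (intro sum_ennreal) (auto simp: \<Omega>_def v_def a_def)
    also have "(\<Sum>Q\<in>\<Omega>. P Q * v (Q i)) = (\<Sum>l\<in>\<Lambda> i. a i l * v l)"
      using finC fin marg by (intro sum_marginal) (auto simp: \<Omega>_def a_def)
    also have "\<dots> = (\<Sum>l\<in>\<Lambda> i. measure (\<mu> i) (C i l \<inter> A))" using v by simp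
    also have "\<dots> = measure (\<mu> i) (\<Union>l\<in>\<Lambda> i. C i l \<inter> A)"
      using fin A Cl by (intro M.finite_measure_finite_Union[symmetric]) (auto simp: disjoint_family_on_def C_def)
    also have "\<dots> = measure (\<mu> i) A"
    proof (rule measure_eq_AE)
      show "AE x in \<mu> i. x \<in> (\<Union>l\<in>\<Lambda> i. C i l \<inter> A) \<longleftrightarrow> x \<in> A"
        using ae[of i] AE_space by eventually_elim (auto simp: C_def)
      show "(\<Union>l\<in>\<Lambda> i. C i l \<inter> A) \<in> sets (\<mu> i)"
        using fin A Cl by (intro sets.finite_UN sets.Int) auto
    qed (rule A)
    finally show ?thesis by (simp add: B_def M.emeasure_eq_measure)
  qed
qed


text \<open>Once one factor \<open>j\<close> has been dropped from the logarithm of the density, the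
  entropy separates into the entropies of the cell distributions of the other factors. The index
  \<open>j\<close> is left free so that the factor with the most expensive subdivision can be the
  one discarded.\<close>

lemma block_plan:
  fixes X :: "'m::finite \<Rightarrow> 'a::euclidean_space set" and \<mu> :: "'m \<Rightarrow> 'a measure"
    and q :: "'m \<Rightarrow> 'a \<Rightarrow> 'l" and P :: "('m \<Rightarrow> 'l) \<Rightarrow> real"
  assumes \<mu>: "\<And>i. borel_prob_measure_on (X i) (\<mu> i)" and fin: "\<And>i. finite (\<Lambda> i)"
    and meas: "\<And>i l. l \<in> \<Lambda> i \<Longrightarrow> {x \<in> X i. q i x = l} \<in> sets (\<mu> i)"
    and ae: "\<And>i. AE x in \<mu> i. q i x \<in> \<Lambda> i"
    and P0: "\<And>Q. Q \<in> PiE UNIV \<Lambda> \<Longrightarrow> 0 \<le> P Q"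
    and marg: "\<And>i l. l \<in> \<Lambda> i \<Longrightarrow> (\<Sum>Q\<in>{Q \<in> PiE UNIV \<Lambda>. Q i = l}. P Q) = measure (\<mu> i) {x \<in> X i. q i x = l}"
  obtains \<gamma> where "\<gamma> \<in> couplings X \<mu>"
    "rel_entropy \<gamma> (prod_measure X \<mu>) \<le> ereal (\<Sum>i\<in>UNIV - {j}. ln (card (\<Lambda> i)))"
    "\<And>Q. Q \<in> PiE UNIV \<Lambda> \<Longrightarrow> {x \<in> prod_set X. \<forall>i. q i (x $ i) = Q i} \<in> sets \<gamma>"
    "\<And>Q. Q \<in> PiE UNIV \<Lambda> \<Longrightarrow> measure \<gamma> {x \<in> prod_set X. \<forall>i. q i (x $ i) = Q i} = P Q"
proof -
  have sets\<mu>: "sets (\<mu> i) = sets (restrict_space borel (X i))" for i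
    using \<mu> by (simp add: borel_prob_measure_on_def)
  then have space\<mu>: "space (\<mu> i) = X i" for i
    by (simp add: sets_eq_imp_space_eq[OF sets\<mu>] space_restrict_space)
  have prob: "prob_space (\<mu> i)" for i using \<mu> by (simp add: borel_prob_measure_on_def)
  interpret product_prob_space \<mu> UNIV
    by (intro product_prob_space.intro product_sigma_finite.intro product_prob_space_axioms.intro prob)
       (use prob prob_space_imp_sigma_finite in blast)
  interpret finite_product_prob_space \<mu> UNIV by unfold_locales simp
  let ?M = "PiM UNIV \<mu>"
  let ?R = "restrict_space borel (prod_set X)"
  define a where "a i l = measure (\<mu> i) {x \<in> space (\<mu> i). q i x = l}" for i l
  define block where "block Q = {\<omega> \<in> space ?M. \<forall>i. q i (\<omega> i) = Q i}" for Q
  define c where "c Q = P Q / (\<Prod>i\<in>UNIV. a i (Q i))" for Q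
  define \<Omega> where "\<Omega> = PiE UNIV \<Lambda>"
  define \<rho> where "\<rho> \<omega> = (\<Sum>Q\<in>\<Omega>. c Q * indicator (block Q) \<omega>)" for \<omega>
  define N where "N = density ?M (\<lambda>\<omega>. ennreal (\<rho> \<omega>))"
  have meas': "\<And>i l. l \<in> \<Lambda> i \<Longrightarrow> {x \<in> space (\<mu> i). q i x = l} \<in> sets (\<mu> i)"
    using meas by (simp add: space\<mu>)
  have marg': "\<And>i l. l \<in> \<Lambda> i \<Longrightarrow> (\<Sum>Q\<in>{Q \<in> PiE UNIV \<Lambda>. Q i = l}. P Q) = measure (\<mu> i) {x \<in> space (\<mu> i). q i x = l}"
    using marg by (simp add: space\<mu>)
  have bd1: "block Q \<in> sets ?M" if "Q \<in> \<Omega>" for Q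
    unfolding N_def \<rho>_def c_def \<Omega>_def block_def a_def
    by (rule block_density(1)[OF prob fin meas' ae P0 marg']) (use that in \<open>simp_all add: \<Omega>_def\<close>)
  have bd2: "measure ?M (block Q) = (\<Prod>i\<in>UNIV. a i (Q i))" if "Q \<in> \<Omega>" for Q
    unfolding N_def \<rho>_def c_def \<Omega>_def block_def a_def
    by (rule block_density(2)[OF prob fin meas' ae P0 marg']) (use that in \<open>simp_all add: \<Omega>_def\<close>)
  have bd3: "\<rho> \<in> borel_measurable ?M"
    unfolding N_def \<rho>_def c_def \<Omega>_def block_def a_def
    by (rule block_density(3)[OF prob fin meas' ae P0 marg'])
  have bd4: "emeasure N (block Q) = ennreal (P Q)" if "Q \<in> \<Omega>" for Q
    unfolding N_def \<rho>_def c_def \<Omega>_def block_def a_def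
    by (rule block_density(4)[OF prob fin meas' ae P0 marg']) (use that in \<open>simp_all add: \<Omega>_def\<close>)
  have bd5: "emeasure N {\<omega> \<in> space ?M. \<omega> i \<in> A} = emeasure (\<mu> i) A" if "A \<in> sets (\<mu> i)" for i A
    unfolding N_def \<rho>_def c_def \<Omega>_def block_def a_def
    by (rule block_density(5)[OF prob fin meas' ae P0 marg']) (use that in \<open>simp_all add: \<Omega>_def\<close>)
  have fin\<Omega>: "finite \<Omega>" unfolding \<Omega>_def using fin by (intro finite_PiE) auto
  have a0: "0 \<le> a i l" for i l by (simp add: a_def)
  have asum: "(\<Sum>l\<in>\<Lambda> i. a i l) = 1" for i
  proof -
    have "(\<Sum>l\<in>\<Lambda> i. a i l) = measure (\<mu> i) (\<Union>l\<in>\<Lambda> i. {x \<in> space (\<mu> i). q i x = l})"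
      unfolding a_def using fin meas'
      by (intro M.finite_measure_finite_Union[symmetric]) (auto simp: disjoint_family_on_def)
    also have "\<dots> = measure (\<mu> i) (space (\<mu> i))"
    proof (rule measure_eq_AE)
      show "AE x in \<mu> i. x \<in> (\<Union>l\<in>\<Lambda> i. {x \<in> space (\<mu> i). q i x = l}) \<longleftrightarrow> x \<in> space (\<mu> i)"
        using ae[of i] AE_space by eventually_elim auto
      show "(\<Union>l\<in>\<Lambda> i. {x \<in> space (\<mu> i). q i x = l}) \<in> sets (\<mu> i)"
        using fin meas' by (intro sets.finite_UN) auto
    qed simp
    finally show ?thesis by (simp add: M.prob_space)
  qed
  have vl: "vec_lambda \<in> measurable ?M ?R" by (rule measurable_vec_lambda_prod_set[OF \<mu>])
  have vn: "vec_nth \<in> measurable ?R ?M"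
  proof -
    have "(\<lambda>x i. x $ i) \<in> measurable ?R ?M"
    proof (rule measurable_PiM_single')
      fix i
      have "(\<lambda>x. x $ i) \<in> measurable ?R (restrict_space borel (X i))"
        by (intro measurable_restrict_space3 borel_measurable_continuous_onI)
           (auto simp: prod_set_def intro!: continuous_intros)
      then show "(\<lambda>x. x $ i) \<in> measurable ?R (\<mu> i)"
        using measurable_cong_sets[OF refl sets\<mu>[of i], of ?R] by simp
    qed (auto simp: space_restrict_space prod_set_def space\<mu>)
    then show ?thesis by simp
  qed
  have setsN: "sets N = sets ?M" by (simp add: N_def)
  have vlN: "vec_lambda \<in> measurable N ?R" using vl measurable_cong_sets[OF setsN refl] by blast
  define \<gamma> where "\<gamma> = distr N ?R vec_lambda"
  have probN: "prob_space N"
  proof (rule prob_spaceI)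
    \<comment> \<open>The total mass is read off from the marginal in an arbitrary factor, as the
      condition on that coordinate holds everywhere.\<close>
    have "{\<omega> \<in> space ?M. \<omega> undefined \<in> space (\<mu> undefined)} = space N"
      by (auto simp: N_def space_PiM)
    then show "emeasure N (space N) = 1"
      using bd5[OF sets.top, of undefined] by (simp add: M.emeasure_space_1)
  qed
  have block_vec: "vec_lambda -` {x \<in> prod_set X. \<forall>i. q i (x $ i) = Q i} \<inter> space ?M = block Q" for Q
    by (auto simp: block_def prod_set_def space_PiM space\<mu>)
  have vec_block: "vec_nth -` block Q \<inter> space ?R = {x \<in> prod_set X. \<forall>i. q i (x $ i) = Q i}" for Q
    by (auto simp: block_def space_restrict_space prod_set_def space_PiM space\<mu>)
  have cellR: "{x \<in> prod_set X. \<forall>i. q i (x $ i) = Q i} \<in> sets ?R" if "Q \<in> \<Omega>" for Q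
    using measurable_sets[OF vn bd1] that unfolding vec_block \<Omega>_def by blast
  have mcell: "measure \<gamma> {x \<in> prod_set X. \<forall>i. q i (x $ i) = Q i} = P Q" if "Q \<in> \<Omega>" for Q
  proof -
    have "measure \<gamma> {x \<in> prod_set X. \<forall>i. q i (x $ i) = Q i} = measure N (block Q)"
      unfolding \<gamma>_def measure_distr[OF vlN cellR[OF that]] using block_vec[of Q] by (simp add: N_def)
    then show ?thesis using bd4[of Q] P0 that by (simp add: measure_def \<Omega>_def)
  qed
  have coup: "\<gamma> \<in> couplings X \<mu>"
    unfolding couplings_def borel_prob_measure_on_def
  proof (intro CollectI conjI allI)
    show "prob_space \<gamma>" unfolding \<gamma>_def by (rule prob_space.prob_space_distr[OF probN vlN])
    show "sets \<gamma> = sets ?R" by (simp add: \<gamma>_def)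
    fix i
    let ?Ri = "restrict_space borel (X i)"
    have "(\<lambda>x. x $ i) \<in> measurable ?R ?Ri"
      by (intro measurable_restrict_space3 borel_measurable_continuous_onI)
         (auto simp: prod_set_def intro!: continuous_intros)
    then have eq: "distr \<gamma> ?Ri (\<lambda>x. x $ i) = distr N ?Ri (\<lambda>\<omega>. \<omega> i)"
      unfolding \<gamma>_def using vlN by (subst distr_distr) (auto simp: o_def)
    show "distr \<gamma> ?Ri (\<lambda>x. x $ i) = \<mu> i"
    proof (rule measure_eqI)
      fix A assume "A \<in> sets (distr \<gamma> ?Ri (\<lambda>x. x $ i))"
      then have A: "A \<in> sets (\<mu> i)" "A \<in> sets ?Ri" using sets\<mu>[of i] by auto
      have mi: "(\<lambda>\<omega>. \<omega> i) \<in> measurable N ?Ri"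
        using measurable_component_singleton[of i UNIV \<mu>] measurable_cong_sets[OF setsN sets\<mu>[of i, symmetric]]
        by blast
      have "emeasure (distr N ?Ri (\<lambda>\<omega>. \<omega> i)) A = emeasure N ((\<lambda>\<omega>. \<omega> i) -` A \<inter> space N)"
        by (rule emeasure_distr[OF mi A(2)])
      also have "(\<lambda>\<omega>. \<omega> i) -` A \<inter> space N = {\<omega> \<in> space ?M. \<omega> i \<in> A}" by (auto simp: N_def)
      finally show "emeasure (distr \<gamma> ?Ri (\<lambda>x. x $ i)) A = emeasure (\<mu> i) A"
        unfolding eq using bd5[OF A(1)] by simp
    qed (simp add: sets\<mu>)
  qed
  define \<nu> where "\<nu> = prod_measure X \<mu>"
  have \<nu>: "\<nu> = distr ?M ?R vec_lambda" by (simp add: \<nu>_def prod_measure_def)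
  have prob\<nu>: "prob_space \<nu>" unfolding \<nu> by (rule prob_space_distr[OF vl])
  have dens: "\<gamma> = density \<nu> (\<lambda>x. ennreal (\<rho> (vec_nth x)))"
  proof -
    have "(\<lambda>x. ennreal (\<rho> (vec_nth x))) \<in> borel_measurable ?R"
      using measurable_compose[OF vn bd3] by measurable
    then show ?thesis unfolding \<nu> \<gamma>_def N_def using vl by (subst density_distr) (auto simp: vec_lambda_inverse)
  qed
  have \<rho>R: "(\<lambda>x. \<rho> (vec_nth x)) \<in> borel_measurable \<nu>"
    using measurable_compose[OF vn bd3] by (simp add: \<nu>)
  have c0: "0 \<le> c Q" if "Q \<in> \<Omega>" for Q
    using P0 that a0 unfolding c_def \<Omega>_def by (intro divide_nonneg_nonneg prod_nonneg) auto
  have \<rho>0: "0 \<le> \<rho> \<omega>" for \<omega> unfolding \<rho>_def using c0 by (intro sum_nonneg) auto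
  have P_le: "P Q \<le> a i (Q i)" if "Q \<in> \<Omega>" for Q i
  proof -
    have "P Q \<le> (\<Sum>R\<in>{R \<in> \<Omega>. R i = Q i}. P R)"
      using that fin\<Omega> P0 by (intro member_le_sum) (auto simp: \<Omega>_def)
    also have "\<dots> = a i (Q i)" unfolding a_def \<Omega>_def using that by (intro marg') (auto simp: \<Omega>_def)
    finally show ?thesis .
  qed
  \<comment> \<open>The blocks are disjoint, so at most one term of the density is nonzero at a
    point and the logarithm acts on it alone; outside of all blocks both sides are 0.\<close>
  have \<rho>ln: "\<rho> \<omega> * ln (\<rho> \<omega>) = (\<Sum>Q\<in>\<Omega>. c Q * ln (c Q) * indicator (block Q) \<omega>)" for \<omega>
  proof (cases "\<exists>R\<in>\<Omega>. \<omega> \<in> block R")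
    case True
    then obtain R where R: "R \<in> \<Omega>" "\<omega> \<in> block R" by blast
    have ind: "indicator (block Q) \<omega> = (if Q = R then 1 else 0 :: real)" for Q
      using R(2) by (auto simp: block_def fun_eq_iff split: split_indicator)
    show ?thesis using R(1) fin\<Omega> by (simp add: \<rho>_def ind if_distrib cong: if_cong)
  next
    case False
    then show ?thesis by (simp add: \<rho>_def)
  qed
  have ent: "rel_entropy \<gamma> \<nu> \<le> ereal (\<Sum>i\<in>UNIV - {j}. ln (card (\<Lambda> i)))"
  proof -
    interpret \<nu>: prob_space \<nu> by (rule prob\<nu>)
    have "AE x in \<nu>. ennreal (\<rho> (vec_nth x)) = RN_deriv \<nu> \<gamma> x"
      using \<rho>R dens by (intro \<nu>.RN_deriv_unique) auto
    then have "AE x in \<nu>. enn2real (RN_deriv \<nu> \<gamma> x) = \<rho> (vec_nth x)"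
      by eventually_elim (metis enn2real_ennreal \<rho>0)
    then have "AE x in \<nu>. (let r = enn2real (RN_deriv \<nu> \<gamma> x) in r * ln r) = \<rho> (vec_nth x) * ln (\<rho> (vec_nth x))"
      by eventually_elim (simp add: Let_def)
    moreover have "sets \<gamma> = sets \<nu>" "absolutely_continuous \<nu> \<gamma>"
      using \<rho>R by (auto simp: dens intro!: absolutely_continuousI_density)
    ultimately have "rel_entropy \<gamma> \<nu> = ext_integral \<nu> (\<lambda>x. \<rho> (vec_nth x) * ln (\<rho> (vec_nth x)))"
      unfolding rel_entropy_def by (simp add: ext_integral_cong_AE)
    also have "\<dots> = ext_integral \<nu> (\<lambda>x. \<Sum>Q\<in>\<Omega>. c Q * ln (c Q) * indicator (block Q) (vec_nth x))"
      by (simp add: \<rho>ln)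
    also have "\<dots> = ereal (\<Sum>Q\<in>\<Omega>. c Q * ln (c Q) * (\<Prod>i\<in>UNIV. a i (Q i)))"
    proof -
      have ind: "indicator (block Q) (vec_nth x) = (indicator {x \<in> prod_set X. \<forall>i. q i (x $ i) = Q i} x :: real)" for Q x
        using vec_block[of Q] by (auto simp: block_def space_PiM space\<mu> prod_set_def split: split_indicator)
      have cell\<nu>: "{x \<in> prod_set X. \<forall>i. q i (x $ i) = Q i} \<in> sets \<nu>" if "Q \<in> \<Omega>" for Q
        using cellR[OF that] by (simp add: \<nu>)
      have m: "measure \<nu> {x \<in> prod_set X. \<forall>i. q i (x $ i) = Q i} = (\<Prod>i\<in>UNIV. a i (Q i))" if "Q \<in> \<Omega>" for Q
        unfolding \<nu> measure_distr[OF vl cellR[OF that]] block_vec using bd2[of Q] that by (simp add: \<Omega>_def)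
      have int: "integrable \<nu> (\<lambda>x. c Q * ln (c Q) * indicator {x \<in> prod_set X. \<forall>i. q i (x $ i) = Q i} x)" if "Q \<in> \<Omega>" for Q
        using cell\<nu>[OF that] by (intro integrable_mult_right integrable_real_indicator) (auto simp: \<nu>.emeasure_eq_measure)
      have "(\<integral>x. (\<Sum>Q\<in>\<Omega>. c Q * ln (c Q) * indicator {x \<in> prod_set X. \<forall>i. q i (x $ i) = Q i} x) \<partial>\<nu>) =
          (\<Sum>Q\<in>\<Omega>. c Q * ln (c Q) * (\<Prod>i\<in>UNIV. a i (Q i)))"
        using int cell\<nu> m by (subst Bochner_Integration.integral_sum) (auto intro!: sum.cong)
      then show ?thesis
        unfolding ind using int by (subst ext_integral_eq_integral) (auto intro!: Bochner_Integration.integrable_sum)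
    qed
    also have "\<dots> \<le> ereal (\<Sum>i\<in>UNIV - {j}. ln (card (\<Lambda> i)))"
      unfolding ereal_less_eq
    proof -
      have "c Q * ln (c Q) * (\<Prod>i\<in>UNIV. a i (Q i)) \<le> P Q * (\<Sum>i\<in>UNIV - {j}. - ln (a i (Q i)))" if Q: "Q \<in> \<Omega>" for Q
      proof (cases "P Q = 0")
        case False
        then have pos: "0 < P Q" using P0[of Q] Q by (simp add: \<Omega>_def)
        have ai: "0 < a i (Q i)" for i using P_le[OF Q, of i] pos by linarith
        then have pr: "0 < (\<Prod>i\<in>UNIV. a i (Q i))" by (intro prod_pos) auto
        have "a i (Q i) \<noteq> 0" for i using ai[of i] by simp
        then have "ln (c Q) = ln (P Q) - (\<Sum>i\<in>UNIV. ln (a i (Q i)))"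
          unfolding c_def using pos pr ai by (simp add: ln_div ln_prod)
        also have "(\<Sum>i\<in>UNIV. ln (a i (Q i))) = ln (a j (Q j)) + (\<Sum>i\<in>UNIV - {j}. ln (a i (Q i)))"
          by (rule sum.remove) auto
        also have "ln (P Q) \<le> ln (a j (Q j))" using P_le[OF Q, of j] pos ai[of j] by simp
        finally have "ln (c Q) \<le> (\<Sum>i\<in>UNIV - {j}. - ln (a i (Q i)))" by (simp add: sum_negf)
        then have le: "P Q * ln (c Q) \<le> P Q * (\<Sum>i\<in>UNIV - {j}. - ln (a i (Q i)))" using pos by (intro mult_left_mono) auto
        have "c Q * (\<Prod>i\<in>UNIV. a i (Q i)) = P Q"
          using pr by (metis c_def less_irrefl nonzero_eq_divide_eq)
        then have *: "c Q * ln (c Q) * (\<Prod>i\<in>UNIV. a i (Q i)) = P Q * ln (c Q)"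
          by (metis mult.commute mult.left_commute)
        show ?thesis unfolding * by (rule le)
      qed (simp add: c_def)
      then have "(\<Sum>Q\<in>\<Omega>. c Q * ln (c Q) * (\<Prod>i\<in>UNIV. a i (Q i))) \<le> (\<Sum>Q\<in>\<Omega>. P Q * (\<Sum>i\<in>UNIV - {j}. - ln (a i (Q i))))"
        by (rule sum_mono)
      also have "\<dots> = (\<Sum>i\<in>UNIV - {j}. \<Sum>Q\<in>\<Omega>. P Q * - ln (a i (Q i)))"
        unfolding sum_distrib_left by (rule sum.swap)
      also have "\<dots> = (\<Sum>i\<in>UNIV - {j}. \<Sum>l\<in>\<Lambda> i. a i l * - ln (a i l))"
        using fin\<Omega> fin marg' by (intro sum.cong refl sum_marginal) (auto simp: \<Omega>_def a_def)
      also have "\<dots> \<le> (\<Sum>i\<in>UNIV - {j}. ln (card (\<Lambda> i)))"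
        using fin a0 asum by (intro sum_mono entropy_le_ln_card) auto
      finally show "(\<Sum>Q\<in>\<Omega>. c Q * ln (c Q) * (\<Prod>i\<in>UNIV. a i (Q i))) \<le> (\<Sum>i\<in>UNIV - {j}. ln (card (\<Lambda> i)))" .
    qed
    finally show ?thesis .
  qed
  show ?thesis
    using that[OF coup ent[unfolded \<nu>_def]] cellR mcell by (simp add: \<gamma>_def \<Omega>_def)
qed

section \<open>Couplings, their marginals and supports\<close>

lemma coupling_bounds:
  fixes X :: "'m::finite \<Rightarrow> 'a::euclidean_space set" and \<mu> :: "'m \<Rightarrow> 'a measure"
    and u :: "'m \<Rightarrow> 'a \<Rightarrow> real"
  assumes \<gamma>: "\<gamma> \<in> couplings X \<mu>"
    and K: "\<And>i. AE x in \<mu> i. x \<in> K i"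
    and u: "\<And>i. u i \<in> borel_measurable (\<mu> i)" "\<And>i x. \<bar>u i x\<bar> \<le> R"
  shows "AE x in \<gamma>. \<forall>i. x $ i \<in> K i"
    and "integrable \<gamma> (\<lambda>x. \<Sum>i\<in>UNIV. u i (x $ i))"
    and "(\<integral>x. (\<Sum>i\<in>UNIV. u i (x $ i)) \<partial>\<gamma>) = (\<Sum>i\<in>UNIV. \<integral>x. u i x \<partial>\<mu> i)"
proof -
  have g: "prob_space \<gamma>" "sets \<gamma> = sets (restrict_space borel (prod_set X))"
    and m: "\<And>i. distr \<gamma> (restrict_space borel (X i)) (\<lambda>x. x $ i) = \<mu> i"
    using \<gamma> by (auto simp: couplings_def borel_prob_measure_on_def)
  interpret prob_space \<gamma> by (rule g(1))
  have sets\<mu>: "sets (\<mu> i) = sets (restrict_space borel (X i))" for i using m[of i] by (metis sets_distr)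
  have meas: "(\<lambda>x. x $ i) \<in> measurable \<gamma> (restrict_space borel (X i))" for i
  proof -
    have "(\<lambda>x. x $ i) \<in> measurable (restrict_space borel (prod_set X)) (restrict_space borel (X i))"
      by (intro measurable_restrict_space3 borel_measurable_continuous_onI)
         (auto simp: prod_set_def intro!: continuous_intros)
    then show ?thesis using measurable_cong_sets[OF g(2) refl] by blast
  qed
  have "AE x in \<gamma>. x $ i \<in> K i" for i
    using AE_distrD[OF meas[of i], unfolded m, OF K[of i]] .
  then show "AE x in \<gamma>. \<forall>i. x $ i \<in> K i" by (simp add: AE_all_countable)
  have um: "u i \<in> borel_measurable (restrict_space borel (X i))" for i
    using u(1)[of i] measurable_cong_sets[OF sets\<mu>[of i] refl] by blast
  have int: "integrable \<gamma> (\<lambda>x. u i (x $ i))" for i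
    using u(2) measurable_compose[OF meas um]
    by (intro integrable_const_bound[of _ R]) auto
  then show "integrable \<gamma> (\<lambda>x. \<Sum>i\<in>UNIV. u i (x $ i))" by (intro Bochner_Integration.integrable_sum) auto
  \<comment> \<open>A function of one coordinate has the same integral under every coupling. This is
    what lets potentials be compared between the block plan, the discrete plan and arbitrary
    competitors.\<close>
  have "(\<integral>x. u i (x $ i) \<partial>\<gamma>) = (\<integral>x. u i x \<partial>\<mu> i)" for i
    using integral_distr[OF meas um, of i] m[of i] by simp
  then show "(\<integral>x. (\<Sum>i\<in>UNIV. u i (x $ i)) \<partial>\<gamma>) = (\<Sum>i\<in>UNIV. \<integral>x. u i x \<partial>\<mu> i)"
    using int by (subst Bochner_Integration.integral_sum) auto
qed

lemma measure_support_subset: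
  assumes "borel_prob_measure_on X \<mu>"
  shows "measure_support \<mu> \<subseteq> X"
proof -
  have "space \<mu> = space (restrict_space borel X)"
    using assms by (intro sets_eq_imp_space_eq) (simp add: borel_prob_measure_on_def)
  then show ?thesis by (auto simp: measure_support_def space_restrict_space)
qed

text \<open>The complement of the support is a union of open null sets, and by the Lindelof property
  countably many of them suffice.\<close>

lemma AE_measure_support:
  fixes \<mu> :: "'a::euclidean_space measure"
  assumes "borel_prob_measure_on X \<mu>"
  shows "AE x in \<mu>. x \<in> measure_support \<mu>"
proof -
  have sets\<mu>: "sets \<mu> = sets (restrict_space borel X)"
    using assms by (simp add: borel_prob_measure_on_def)
  then have space\<mu>: "space \<mu> = X" by (simp add: sets_eq_imp_space_eq[OF sets\<mu>] space_restrict_space)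
  define \<U> where "\<U> = {U. open U \<and> emeasure \<mu> (U \<inter> space \<mu>) = 0}"
  obtain \<V> where V: "\<V> \<subseteq> \<U>" "countable \<V>" "\<Union>\<V> = \<Union>\<U>"
    using Lindelof[of \<U>] by (auto simp: \<U>_def)
  have "(\<Union>U\<in>\<V>. U \<inter> space \<mu>) \<in> null_sets \<mu>"
  proof (rule null_sets_UN')
    show "countable \<V>" by (rule V(2))
    fix U assume "U \<in> \<V>"
    then have U: "open U" "emeasure \<mu> (U \<inter> space \<mu>) = 0" using V(1) by (auto simp: \<U>_def)
    have "U \<inter> space \<mu> \<in> sets \<mu>"
      using U(1) unfolding sets\<mu> space\<mu> sets_restrict_space by (auto simp: Int_commute)
    then show "U \<inter> space \<mu> \<in> null_sets \<mu>" using U(2) by auto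
  qed
  moreover have "{x \<in> space \<mu>. x \<notin> measure_support \<mu>} \<subseteq> (\<Union>U\<in>\<V>. U \<inter> space \<mu>)"
  proof
    fix x assume "x \<in> {x \<in> space \<mu>. x \<notin> measure_support \<mu>}"
    then obtain U where "x \<in> space \<mu>" "open U" "x \<in> U" "emeasure \<mu> (U \<inter> space \<mu>) = 0"
      by (auto simp: measure_support_def)
    then have "x \<in> \<Union>\<U>" "x \<in> space \<mu>" by (auto simp: \<U>_def)
    then show "x \<in> (\<Union>U\<in>\<V>. U \<inter> space \<mu>)" using V(3) by blast
  qed
  ultimately show ?thesis by (rule AE_I')
qed

section \<open>Changing one coordinate: slices of a function on the product\<close>

definition vec_upd :: "'a ^ 'm \<Rightarrow> 'm \<Rightarrow> 'a \<Rightarrow> 'a ^ 'm" where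
  "vec_upd v i y = (\<chi> j. if j = i then y else v $ j)"

lemma vec_upd_nth [simp]: "vec_upd v i y $ j = (if j = i then y else v $ j)"
  by (simp add: vec_upd_def)

lemma vec_upd_same [simp]: "vec_upd v i (v $ i) = v"
  by (simp add: vec_eq_iff)

lemma vec_upd_in_prod_set: "v \<in> prod_set X \<Longrightarrow> y \<in> X i \<Longrightarrow> vec_upd v i y \<in> prod_set X"
  by (simp add: prod_set_def)

lemma vec_upd_diff:
  fixes v :: "'a::euclidean_space ^ 'm::finite"
  shows "vec_upd v i y - vec_upd v i z = axis i (y - z)"
  by (simp add: vec_eq_iff axis_def)

lemma norm_axis_eq:
  fixes z :: "'a::euclidean_space"
  shows "norm (axis i z :: 'a ^ 'm::finite) = norm z"
proof -
  have "(\<Sum>j\<in>UNIV. (norm ((axis i z :: 'a ^ 'm) $ j))\<^sup>2) = (\<Sum>j\<in>UNIV. if j = i then (norm z)\<^sup>2 else 0)"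
    by (intro sum.cong) (auto simp: axis_def)
  then show ?thesis by (simp add: norm_vec_def L2_set_def)
qed

lemma linear_axis: "linear (\<lambda>z :: 'a::euclidean_space. axis i z :: 'a ^ 'm::finite)"
  by (rule linearI) (auto simp: vec_eq_iff axis_def)

lemma sum_axis:
  fixes v :: "'a::euclidean_space ^ 'm::finite"
  shows "(\<Sum>i\<in>UNIV. axis i (v $ i)) = v"
  by (simp add: vec_eq_iff axis_def sum.delta)

lemma norm_vec_le_sum:
  fixes v :: "'a::euclidean_space ^ 'm::finite"
  shows "norm v \<le> (\<Sum>i\<in>UNIV. norm (v $ i))"
  unfolding norm_vec_def by (rule L2_set_le_sum) simp

lemma compact_prod_set:
  fixes K :: "'m::finite \<Rightarrow> 'a::euclidean_space set"
  assumes "\<And>i. compact (K i)"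
  shows "compact (prod_set K)"
proof -
  have "closed (prod_set K)"
  proof -
    have "prod_set K = (\<Inter>i. (\<lambda>x. x $ i) -` K i)" by (auto simp: prod_set_def)
    moreover have "closed ((\<lambda>x :: 'a ^ 'm. x $ i) -` K i)" for i
      using assms compact_imp_closed by (intro continuous_closed_vimage) (auto intro!: continuous_intros)
    ultimately show ?thesis by auto
  qed
  moreover have "bounded (prod_set K)"
  proof -
    have "\<exists>b. \<forall>x\<in>K i. norm x \<le> b" for i using assms compact_imp_bounded bounded_iff by metis
    then obtain b where b: "\<And>i x. x \<in> K i \<Longrightarrow> norm x \<le> b i" by metis
    have "norm x \<le> (\<Sum>i\<in>UNIV. b i)" if "x \<in> prod_set K" for x
      using that b by (intro order_trans[OF norm_vec_le_sum] sum_mono) (auto simp: prod_set_def)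
    then show ?thesis by (auto simp: bounded_iff)
  qed
  ultimately show ?thesis by (simp add: compact_eq_bounded_closed)
qed

lemma C2_on_submanifold_imp_taylor_on:
  fixes f :: "'a::euclidean_space \<Rightarrow> 'b::euclidean_space"
  assumes "C2_on_submanifold M f" "p \<in> M"
  shows "\<exists>r>0. \<exists>C. taylor_on C (ball p r \<inter> M) f"
proof -
  obtain U g where U: "p \<in> U" "C2_on U g" "\<And>x. x \<in> U \<inter> M \<Longrightarrow> g x = f x"
    using assms unfolding C2_on_submanifold_def by meson
  obtain r C where r: "r > 0" "ball p r \<subseteq> U" "taylor_on C (ball p r) g"
    using C2_on_imp_taylor_on[OF U(2,1)] by metis
  have "taylor_on C (ball p r \<inter> M) g" using r(3) by (rule taylor_on_mono) auto
  then have "taylor_on C (ball p r \<inter> M) f"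
    by (rule taylor_on_cong) (use U(3) r(2) in \<open>metis IntD1 IntD2 IntI subsetD\<close>)
  then show ?thesis using r(1) by blast
qed

text \<open>The embedding of a factor along an axis is isometric, so radius and constant do not
  change; all slices of the cost therefore share one constant.\<close>

lemma taylor_on_slice:
  fixes c :: "'a::euclidean_space ^ 'm::finite \<Rightarrow> real"
  assumes T: "taylor_on C (ball v r \<inter> prod_set X) c" and v: "v \<in> prod_set X"
  shows "taylor_on C (ball (v $ i) r \<inter> X i) (\<lambda>y. c (vec_upd v i y))"
  unfolding taylor_on_def
proof (intro conjI ballI)
  show "0 \<le> C" by (rule taylor_on_nonneg[OF T])
  have mem: "vec_upd v i y \<in> ball v r \<inter> prod_set X" if "y \<in> ball (v $ i) r \<inter> X i" for y
  proof -
    have "norm (vec_upd v i (v $ i) - vec_upd v i y) < r"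
      unfolding vec_upd_diff norm_axis_eq using that by (simp add: dist_norm)
    then show ?thesis using vec_upd_in_prod_set[OF v, of y i] that by (simp add: dist_norm)
  qed
  fix y assume y: "y \<in> ball (v $ i) r \<inter> X i"
  obtain A where A: "linear A" "\<And>h. norm (A h) \<le> C * norm h"
    "\<And>w. w \<in> ball v r \<inter> prod_set X \<Longrightarrow> norm (c w - c (vec_upd v i y) - A (w - vec_upd v i y)) \<le> C * (norm (w - vec_upd v i y))\<^sup>2"
    using taylor_onE[OF T mem[OF y]] by metis
  show "\<exists>A. linear A \<and> (\<forall>h. norm (A h) \<le> C * norm h) \<and>
      (\<forall>z\<in>ball (v $ i) r \<inter> X i. norm (c (vec_upd v i z) - c (vec_upd v i y) - A (z - y)) \<le> C * (norm (z - y))\<^sup>2)"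
  proof (intro exI[of _ "\<lambda>h. A (axis i h)"] conjI allI ballI)
    show "linear (\<lambda>h. A (axis i h))" using linear_compose[OF linear_axis A(1)] by (simp add: o_def)
    show "norm (A (axis i h)) \<le> C * norm h" for h using A(2)[of "axis i h"] by (simp add: norm_axis_eq)
    fix z assume "z \<in> ball (v $ i) r \<inter> X i"
    from A(3)[OF mem[OF this]]
    show "norm (c (vec_upd v i z) - c (vec_upd v i y) - A (axis i (z - y))) \<le> C * (norm (z - y))\<^sup>2"
      by (simp only: vec_upd_diff norm_axis_eq)
  qed
qed

text \<open>The linear part at \<open>v\<close> splits along the axes, and on each axis it is the
  increment of a slice up to one quadratic remainder. With the remainder at \<open>w\<close> this
  makes \<open>1 + CARD('m)\<close> remainders, which absorb all interaction between different
  coordinates.\<close>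

lemma taylor_on_split_increment:
  fixes C :: real and c :: "'a::euclidean_space ^ 'm::finite \<Rightarrow> real"
  assumes T: "taylor_on C (ball v r \<inter> prod_set X) c" and v: "v \<in> prod_set X" and w: "w \<in> prod_set X"
    and r: "norm (w - v) < r"
  shows "c w \<le> c v + (\<Sum>i\<in>UNIV. c (vec_upd v i (w $ i)) - c v) + (1 + CARD('m)) * C * (norm (w - v))\<^sup>2"
proof -
  have C: "0 \<le> C" by (rule taylor_on_nonneg[OF T])
  have le: "norm (w $ i - v $ i) \<le> norm (w - v)" for i
    using Finite_Cartesian_Product.norm_nth_le[of "w - v" i] by simp
  have v': "v \<in> ball v r \<inter> prod_set X" using v r norm_ge_zero[of "w - v"] by (simp add: le_less_trans del: norm_ge_zero)
  have w': "w \<in> ball v r \<inter> prod_set X" using w r by (simp add: dist_norm norm_minus_commute)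
  have diff: "vec_upd v i (w $ i) - v = axis i (w $ i - v $ i)" for i
    using vec_upd_diff[of v i "w $ i" "v $ i"] by simp
  have m: "vec_upd v i (w $ i) \<in> ball v r \<inter> prod_set X" for i
  proof -
    have "w $ i \<in> X i" using w by (simp add: prod_set_def)
    moreover have "norm (vec_upd v i (w $ i) - v) < r"
      unfolding diff norm_axis_eq using le[of i] r by linarith
    ultimately show ?thesis using vec_upd_in_prod_set[OF v] by (simp add: dist_norm norm_minus_commute)
  qed
  obtain A where A: "linear A"
    "\<And>y. y \<in> ball v r \<inter> prod_set X \<Longrightarrow> norm (c y - c v - A (y - v)) \<le> C * (norm (y - v))\<^sup>2"
    using taylor_onE[OF T v'] by metis
  have "A (w - v) = A (\<Sum>i\<in>UNIV. axis i ((w - v) $ i))" unfolding sum_axis ..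
  also have "\<dots> = (\<Sum>i\<in>UNIV. A (axis i (w $ i - v $ i)))"
    using linear_sum[OF A(1), of "\<lambda>i. axis i ((w - v) $ i)" UNIV] by simp
  also have "\<dots> \<le> (\<Sum>i\<in>UNIV. (c (vec_upd v i (w $ i)) - c v) + C * (norm (w - v))\<^sup>2)"
  proof (rule sum_mono)
    fix i
    have "norm (c (vec_upd v i (w $ i)) - c v - A (axis i (w $ i - v $ i))) \<le> C * (norm (w $ i - v $ i))\<^sup>2"
      using A(2)[OF m[of i]] unfolding diff norm_axis_eq .
    also have "\<dots> \<le> C * (norm (w - v))\<^sup>2" using C le[of i] by (intro mult_left_mono power_mono) auto
    finally show "A (axis i (w $ i - v $ i)) \<le> (c (vec_upd v i (w $ i)) - c v) + C * (norm (w - v))\<^sup>2"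
      by (simp add: abs_le_iff)
  qed
  also have "\<dots> = (\<Sum>i\<in>UNIV. c (vec_upd v i (w $ i)) - c v) + CARD('m) * (C * (norm (w - v))\<^sup>2)"
    by (simp add: sum.distrib)
  finally have "A (w - v) \<le> (\<Sum>i\<in>UNIV. c (vec_upd v i (w $ i)) - c v) + CARD('m) * (C * (norm (w - v))\<^sup>2)" .
  moreover have "c w - c v - A (w - v) \<le> C * (norm (w - v))\<^sup>2" using A(2)[OF w'] by (simp add: abs_le_iff)
  moreover have "(1 + CARD('m)) * C * (norm (w - v))\<^sup>2 =
      C * (norm (w - v))\<^sup>2 + CARD('m) * (C * (norm (w - v))\<^sup>2)" by (simp add: algebra_simps)
  ultimately show ?thesis by linarith
qed

text \<open>Refines the coarse labels by small balls, so that the cost oscillates little on a label.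
  Labels of mass 0 are discarded because the discrete duality needs positive weights; a label of
  positive mass meets \<open>K\<close>, which provides a representative in the same coarse cell. Two
  points of a ball of radius \<open>\<eta> / 2\<close> have distance at most
  \<open>\<eta>\<close>.\<close>

lemma fine_labels:
  fixes X :: "'a::euclidean_space set" and q :: "'a \<Rightarrow> 'l"
  assumes \<mu>: "borel_prob_measure_on X \<mu>" and K: "compact K" "AE x in \<mu>. x \<in> K"
    and fin: "finite \<Lambda>" and q: "\<And>x. x \<in> K \<Longrightarrow> q x \<in> \<Lambda>"
    and meas: "\<And>l. l \<in> \<Lambda> \<Longrightarrow> {x \<in> X. q x = l} \<in> sets \<mu>" and \<eta>: "0 < \<eta>"
  obtains s :: "'a \<Rightarrow> 'l \<times> nat" and T rep where "finite T"
    "\<And>t. t \<in> T \<Longrightarrow> {x \<in> X. s x = t} \<in> sets \<mu>"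
    "\<And>t. t \<in> T \<Longrightarrow> 0 < measure \<mu> {x \<in> X. s x = t}"
    "\<And>t. t \<in> T \<Longrightarrow> rep t \<in> K"
    "AE x in \<mu>. x \<in> K \<and> s x \<in> T \<and> norm (x - rep (s x)) \<le> \<eta> \<and> q (rep (s x)) = q x"
proof -
  interpret prob_space \<mu> using \<mu> by (simp add: borel_prob_measure_on_def)
  have sets\<mu>: "sets \<mu> = sets (restrict_space borel X)" using \<mu> by (simp add: borel_prob_measure_on_def)
  have space\<mu>: "space \<mu> = X" by (simp add: sets_eq_imp_space_eq[OF sets\<mu>] space_restrict_space)
  obtain F where F: "F \<subseteq> K" "finite F" "K \<subseteq> (\<Union>p\<in>F. ball p (\<eta> / 2))"
  proof (rule compactE_image[OF K(1), of K "\<lambda>p. ball p (\<eta> / 2)"])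
    show "K \<subseteq> (\<Union>p\<in>K. ball p (\<eta> / 2))" using \<eta> by force
  qed auto
  obtain e where e: "bij_betw e {..<card F} F"
    using ex_bij_betw_nat_finite[OF F(2)] by (auto simp: lessThan_atLeast0)
  define n where "n = card F"
  define V where "V j = ball (e j) (\<eta> / 2)" for j
  have cov: "\<exists>j<n. x \<in> V j" if "x \<in> K" for x
    using subsetD[OF F(3) that] e unfolding bij_betw_def n_def V_def by (metis UN_E imageE lessThan_iff)
  define ind where "ind x = (LEAST j. x \<in> V j)" for x
  define s where "s x = (q x, ind x)" for x
  define D where "D t = {x \<in> X. s x = t \<and> x \<in> V (snd t)}" for t
  have indK: "ind x < n \<and> x \<in> V (ind x)" if x: "x \<in> K" for x
  proof -
    obtain j where j: "j < n" "x \<in> V j" using cov[OF x] by blast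
    show ?thesis unfolding ind_def using LeastI[of "\<lambda>j. x \<in> V j" j] Least_le[of "\<lambda>j. x \<in> V j" j] j by auto
  qed
  define T where "T = {t \<in> \<Lambda> \<times> {..<n}. 0 < measure \<mu> (D t)}"
  have finT: "finite T" unfolding T_def using fin by auto
  have D: "D t \<in> sets \<mu>" if t: "t \<in> \<Lambda> \<times> {..<n}" for t
  proof -
    obtain l j where lj: "t = (l, j)" "l \<in> \<Lambda>" using t by auto
    have "D t = {x \<in> X. q x = l} \<inter> (X \<inter> (V j - (\<Union>i<j. V i)))"
    proof -
      have "ind x = j \<longleftrightarrow> (\<forall>i<j. x \<notin> V i)" if "x \<in> V j" for x
      proof
        assume "ind x = j" then show "\<forall>i<j. x \<notin> V i" unfolding ind_def using not_less_Least by blast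
      next
        assume "\<forall>i<j. x \<notin> V i"
        then show "ind x = j" unfolding ind_def using that
          by (intro Least_equality) (auto simp: not_less[symmetric])
      qed
      then show ?thesis by (auto simp: D_def lj s_def)
    qed
    moreover have "X \<inter> (V j - (\<Union>i<j. V i)) \<in> sets \<mu>"
    proof -
      have "V j - (\<Union>i<j. V i) \<in> sets borel"
        by (intro sets.Diff borel_open open_UN) (auto simp: V_def)
      then show ?thesis unfolding sets\<mu> sets_restrict_space by blast
    qed
    ultimately show ?thesis using meas[OF lj(2)] by auto
  qed
  have DK: "\<exists>x. x \<in> D t \<inter> K" if "t \<in> T" for t
  proof (rule ccontr)
    assume "\<not> (\<exists>x. x \<in> D t \<inter> K)"
    then have "AE x in \<mu>. x \<notin> D t" using K(2) by (auto elim!: eventually_mono)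
    then have "measure \<mu> (D t) = 0" using D[of t] that
      by (intro measure_eq_0_null_sets) (auto simp: T_def AE_iff_null_sets)
    then show False using that by (simp add: T_def)
  qed
  then obtain rep where rep: "\<And>t. t \<in> T \<Longrightarrow> rep t \<in> D t \<inter> K" by metis
  text \<open>The label is changed outside of the balls, so that the label sets are the sets \<open>D t\<close>.\<close>
  define s' where "s' x = (if x \<in> V (ind x) then s x else (q x, n))" for x
  have eqD: "{x \<in> X. s' x = t} = D t" if "t \<in> T" for t
    using that by (auto simp: s'_def D_def s_def T_def split: if_splits)
  \<comment> \<open>Only finitely many labels are discarded and each of them is null, so almost
    every point carries a label that is kept.\<close>
  have "AE x in \<mu>. \<forall>t\<in>\<Lambda> \<times> {..<n} - T. x \<notin> D t"
  proof (rule AE_ball_countable'[OF _ countable_finite])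
    fix t assume t: "t \<in> \<Lambda> \<times> {..<n} - T"
    then have "measure \<mu> (D t) = 0" using measure_nonneg[of \<mu> "D t"] by (auto simp: T_def)
    then show "AE x in \<mu>. x \<notin> D t" using D[of t] t
      by (intro AE_not_in) (auto simp: null_sets_def emeasure_eq_measure)
  qed (use fin in auto)
  then have "AE x in \<mu>. x \<in> K \<and> s' x \<in> T \<and> norm (x - rep (s' x)) \<le> \<eta> \<and> q (rep (s' x)) = q x"
    using K(2) AE_space
  proof eventually_elim
    case (elim x)
    have i: "ind x < n" "x \<in> V (ind x)" using indK elim by auto
    then have s': "s' x = s x" by (simp add: s'_def)
    have "x \<in> D (s x)" "s x \<in> \<Lambda> \<times> {..<n}" using i elim q by (auto simp: D_def s_def space\<mu>)
    then have T: "s x \<in> T" using elim by auto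
    have "rep (s x) \<in> D (s x)" using rep[OF T] by blast
    then have "q (rep (s x)) = q x" "rep (s x) \<in> V (ind x)" by (auto simp: D_def s_def)
    moreover have "norm (x - rep (s x)) \<le> \<eta>"
    proof -
      have "dist (e (ind x)) x < \<eta> / 2" "dist (e (ind x)) (rep (s x)) < \<eta> / 2"
        using i(2) \<open>rep (s x) \<in> V (ind x)\<close> by (auto simp: V_def)
      then have "dist x (rep (s x)) < \<eta>" by (rule dist_triangle_half_r)
      then show ?thesis by (simp add: dist_norm)
    qed
    ultimately show ?case using T elim by (simp add: s')
  qed
  with finT eqD D rep show ?thesis
    by (intro that[of T s' rep]) (auto simp: T_def)
qed

text \<open>As \<open>c\<close> is nonnegative, its cost is a nonnegative integral and hence
  monotone under an inequality that holds almost everywhere. The majorant consists of bounded step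
  functions: its first part is integrated through the marginals, its second part through the masses
  of the blocks.\<close>

lemma coupling_cost_upper:
  fixes X :: "'m::finite \<Rightarrow> 'a::euclidean_space set" and \<mu> :: "'m \<Rightarrow> 'a measure"
    and u :: "'m \<Rightarrow> 'a \<Rightarrow> real"
  assumes \<gamma>: "\<gamma> \<in> couplings X \<mu>" and c: "\<And>x. x \<in> prod_set X \<Longrightarrow> 0 \<le> c x"
    and u: "\<And>i. u i \<in> borel_measurable (\<mu> i)" "\<And>i x. \<bar>u i x\<bar> \<le> R"
    and fin: "finite \<Omega>" and Z: "\<And>Q. Q \<in> \<Omega> \<Longrightarrow> Z Q \<in> sets \<gamma>"
    and le: "AE x in \<gamma>. c x \<le> (\<Sum>i\<in>UNIV. u i (x $ i)) + (\<Sum>Q\<in>\<Omega>. H Q * indicator (Z Q) x)"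
  shows "ext_integral \<gamma> c \<le> ereal ((\<Sum>i\<in>UNIV. \<integral>x. u i x \<partial>\<mu> i) + (\<Sum>Q\<in>\<Omega>. H Q * measure \<gamma> (Z Q)))"
proof -
  have g: "prob_space \<gamma>" "sets \<gamma> = sets (restrict_space borel (prod_set X))"
    using \<gamma> by (auto simp: couplings_def borel_prob_measure_on_def)
  interpret prob_space \<gamma> by (rule g(1))
  have space: "space \<gamma> = prod_set X" using sets_eq_imp_space_eq[OF g(2)] by (simp add: space_restrict_space)
  let ?W = "\<lambda>x. (\<Sum>i\<in>UNIV. u i (x $ i)) + (\<Sum>Q\<in>\<Omega>. H Q * indicator (Z Q) x)"
  note cb = coupling_bounds[OF \<gamma> _ u, of "\<lambda>_. UNIV"]
  have int2: "integrable \<gamma> (\<lambda>x. H Q * indicator (Z Q) x)" if "Q \<in> \<Omega>" for Q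
    using Z[OF that] by (intro integrable_mult_right integrable_real_indicator) (auto simp: emeasure_eq_measure)
  have intW: "integrable \<gamma> ?W"
    by (rule Bochner_Integration.integrable_add[OF cb(2) Bochner_Integration.integrable_sum[OF int2]]) auto
  have "ext_integral \<gamma> c = enn2ereal (\<integral>\<^sup>+ x. ennreal (c x) \<partial>\<gamma>)"
    using c by (intro ext_integral_nonneg) (simp add: space)
  also have "\<dots> \<le> enn2ereal (\<integral>\<^sup>+ x. ennreal (?W x) \<partial>\<gamma>)"
    using le unfolding less_eq_ennreal.rep_eq[symmetric]
    by (intro nn_integral_mono_AE) (auto elim!: eventually_mono intro: ennreal_leI)
  also have "(\<integral>\<^sup>+ x. ennreal (?W x) \<partial>\<gamma>) = ennreal (\<integral>x. ?W x \<partial>\<gamma>)"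
  proof (rule nn_integral_eq_integral[OF intW])
    show "AE x in \<gamma>. 0 \<le> ?W x" using le AE_space
    proof eventually_elim
      case (elim x) then show ?case using c[of x] by (simp add: space)
    qed
  qed
  also have "enn2ereal (ennreal (\<integral>x. ?W x \<partial>\<gamma>)) = ereal (\<integral>x. ?W x \<partial>\<gamma>)"
  proof -
    have "AE x in \<gamma>. 0 \<le> ?W x" using le AE_space
    proof eventually_elim
      case (elim x) then show ?case using c[of x] by (simp add: space)
    qed
    then show ?thesis by (simp add: integral_nonneg_AE)
  qed
  also have "(\<integral>x. ?W x \<partial>\<gamma>) = (\<Sum>i\<in>UNIV. \<integral>x. u i x \<partial>\<mu> i) + (\<Sum>Q\<in>\<Omega>. H Q * measure \<gamma> (Z Q))"
    using cb(2,3) int2 Z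
    by (simp add: Bochner_Integration.integral_add Bochner_Integration.integral_sum Bochner_Integration.integrable_sum)
  finally show ?thesis .
qed

lemma coupling_cost_lower:
  fixes X :: "'m::finite \<Rightarrow> 'a::euclidean_space set" and \<mu> :: "'m \<Rightarrow> 'a measure"
    and u :: "'m \<Rightarrow> 'a \<Rightarrow> real"
  assumes \<gamma>: "\<gamma> \<in> couplings X \<mu>" and c: "\<And>x. x \<in> prod_set X \<Longrightarrow> 0 \<le> c x"
    and u: "\<And>i. u i \<in> borel_measurable (\<mu> i)" "\<And>i x. \<bar>u i x\<bar> \<le> R"
    and le: "AE x in \<gamma>. (\<Sum>i\<in>UNIV. u i (x $ i)) \<le> c x"
  shows "ereal (\<Sum>i\<in>UNIV. \<integral>x. u i x \<partial>\<mu> i) \<le> ext_integral \<gamma> c"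
proof -
  have g: "sets \<gamma> = sets (restrict_space borel (prod_set X))"
    using \<gamma> by (auto simp: couplings_def borel_prob_measure_on_def)
  have space: "space \<gamma> = prod_set X" using sets_eq_imp_space_eq[OF g] by (simp add: space_restrict_space)
  let ?W = "\<lambda>x. \<Sum>i\<in>UNIV. u i (x $ i)"
  note cb = coupling_bounds[OF \<gamma> _ u, of "\<lambda>_. UNIV"]
  have "ereal (\<Sum>i\<in>UNIV. \<integral>x. u i x \<partial>\<mu> i) = ext_integral \<gamma> ?W"
    using cb(2,3) by (subst ext_integral_eq_integral) auto
  \<comment> \<open>The minorant may be negative; discarding its negative part only increases the
    integral, and the truncated function is still below the nonnegative cost.\<close>
  also have "\<dots> \<le> enn2ereal (\<integral>\<^sup>+ x. ennreal (?W x) \<partial>\<gamma>)"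
    unfolding ext_integral_def by (rule ereal_diff_le_self) simp
  also have "\<dots> \<le> enn2ereal (\<integral>\<^sup>+ x. ennreal (c x) \<partial>\<gamma>)"
    using le unfolding less_eq_ennreal.rep_eq[symmetric]
    by (intro nn_integral_mono_AE) (auto elim!: eventually_mono intro: ennreal_leI)
  also have "\<dots> = ext_integral \<gamma> c"
    using c by (intro ext_integral_nonneg[symmetric]) (simp add: space)
  finally show ?thesis .
qed

lemma measure_label_union:
  assumes "prob_space \<mu>" "finite S" "\<And>t. t \<in> S \<Longrightarrow> {x \<in> space \<mu>. s x = t} \<in> sets \<mu>"
    and "B \<in> sets \<mu>" "AE x in \<mu>. x \<in> B \<longleftrightarrow> s x \<in> S"
  shows "(\<Sum>t\<in>S. measure \<mu> {x \<in> space \<mu>. s x = t}) = measure \<mu> B"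
proof -
  interpret prob_space \<mu> by fact
  have "(\<Sum>t\<in>S. measure \<mu> {x \<in> space \<mu>. s x = t}) = measure \<mu> (\<Union>t\<in>S. {x \<in> space \<mu>. s x = t})"
    using assms(2,3) by (intro finite_measure_finite_Union[symmetric]) (auto simp: disjoint_family_on_def)
  also have "\<dots> = measure \<mu> B"
  proof (rule measure_eq_AE)
    show "AE x in \<mu>. x \<in> (\<Union>t\<in>S. {x \<in> space \<mu>. s x = t}) \<longleftrightarrow> x \<in> B"
      using assms(5) AE_space by eventually_elim auto
    show "(\<Union>t\<in>S. {x \<in> space \<mu>. s x = t}) \<in> sets \<mu>" using assms(2,3) by (intro sets.finite_UN) auto
  qed (rule assms(4))
  finally show ?thesis .
qed

lemma label_step_function:
  fixes b :: "'t \<Rightarrow> real"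
  assumes "prob_space \<mu>" and T: "finite T" "\<And>t. t \<in> T \<Longrightarrow> {x \<in> space \<mu>. s x = t} \<in> sets \<mu>"
  defines "u \<equiv> \<lambda>y. \<Sum>t\<in>T. b t * indicator {x \<in> space \<mu>. s x = t} y"
  shows "u \<in> borel_measurable \<mu>" and "\<bar>u y\<bar> \<le> (\<Sum>t\<in>T. \<bar>b t\<bar>)"
    and "(\<integral>y. u y \<partial>\<mu>) = (\<Sum>t\<in>T. measure \<mu> {x \<in> space \<mu>. s x = t} * b t)"
    and "y \<in> space \<mu> \<Longrightarrow> s y \<in> T \<Longrightarrow> u y = b (s y)"
proof -
  interpret prob_space \<mu> by fact
  show "u \<in> borel_measurable \<mu>" unfolding u_def using T by measurable
  show "\<bar>u y\<bar> \<le> (\<Sum>t\<in>T. \<bar>b t\<bar>)"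
    unfolding u_def by (intro order_trans[OF sum_abs] sum_mono) (auto split: split_indicator)
  have int: "integrable \<mu> (\<lambda>y. b t * indicator {x \<in> space \<mu>. s x = t} y)" if "t \<in> T" for t
    using T(2)[OF that] by (intro integrable_mult_right integrable_real_indicator) (auto simp: emeasure_eq_measure)
  show "(\<integral>y. u y \<partial>\<mu>) = (\<Sum>t\<in>T. measure \<mu> {x \<in> space \<mu>. s x = t} * b t)"
    unfolding u_def using int T(2)
    by (subst Bochner_Integration.integral_sum) (auto intro!: sum.cong)
  assume y: "y \<in> space \<mu>" "s y \<in> T"
  have "u y = (\<Sum>t\<in>T. if t = s y then b t else 0)"
    unfolding u_def using y by (intro sum.cong) auto
  then show "u y = b (s y)" using y T(1) by simp
qed

text \<open>Both sides are compared with the discrete cost, the sum of \<open>P1 x * c (R x)\<close>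
  over \<open>\<Omega>\<close>. The block plan costs at most this plus
  \<open>e1 + m * e2 + 2 * m * \<kappa>\<close>, and by the discrete potentials \<open>MOT0\<close>
  is at least this minus \<open>(1 + m) * \<kappa>\<close>; hence the factor
  \<open>3 * m + 1\<close>. Here \<open>e1\<close> pays for the interaction of coordinates,
  \<open>e2\<close> for the averaged defects of the potentials, and \<open>\<kappa>\<close> for the
  duality gap and the fine discretisation.\<close>

lemma block_estimate:
  fixes X :: "'m::finite \<Rightarrow> 'a::euclidean_space set" and \<mu> :: "'m \<Rightarrow> 'a measure"
    and c :: "'a ^ 'm \<Rightarrow> real" and q :: "'m \<Rightarrow> 'a \<Rightarrow> 'l" and e1 e2 \<kappa> \<eta> :: real
  assumes \<mu>: "\<And>i. borel_prob_measure_on (X i) (\<mu> i)"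
    and K: "\<And>i. compact (K i)" "\<And>i. K i \<subseteq> X i" "\<And>i. AE x in \<mu> i. x \<in> K i"
    and c0: "\<And>x. x \<in> prod_set X \<Longrightarrow> 0 \<le> c x"
    and fin: "\<And>i. finite (\<Lambda> i)" and q: "\<And>i x. x \<in> K i \<Longrightarrow> q i x \<in> \<Lambda> i"
    and meas: "\<And>i l. l \<in> \<Lambda> i \<Longrightarrow> {x \<in> X i. q i x = l} \<in> sets (\<mu> i)"
    and mixed: "\<And>v w. \<lbrakk>v \<in> prod_set K; w \<in> prod_set K; \<And>i. q i (v $ i) = q i (w $ i)\<rbrakk> \<Longrightarrow>
      c w \<le> c v + (\<Sum>i\<in>UNIV. c (vec_upd v i (w $ i)) - c v) + e1"
    and unif: "\<And>v w. \<lbrakk>v \<in> prod_set K; w \<in> prod_set K; \<And>i. norm (w $ i - v $ i) \<le> \<eta>\<rbrakk> \<Longrightarrow> c v \<le> c w + \<kappa>"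
    and \<eta>: "0 < \<eta>" and \<kappa>: "0 < \<kappa>"
    and cell: "\<And>i f. concave_wrt ((\<lambda>v y. c (vec_upd v i y)) ` prod_set K) (X i) f \<Longrightarrow>
      \<exists>\<omega>. (\<forall>l\<in>\<Lambda> i. 0 \<le> \<omega> l) \<and>
        (\<Sum>l\<in>\<Lambda> i. measure (\<mu> i) {x \<in> X i. q i x = l} * \<omega> l) \<le> e2 \<and>
        (\<forall>x\<in>K i. \<forall>x'\<in>K i. q i x = q i x' \<longrightarrow> (\<forall>h\<in>(\<lambda>v y. c (vec_upd v i y)) ` prod_set K. \<forall>s.
          (\<forall>y\<in>X i. f y - f x \<le> h y - h x + s) \<longrightarrow> h x' - h x - (f x' - f x) \<le> \<omega> (q i x) + s))"
  shows "\<exists>\<gamma>\<in>couplings X \<mu>.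
    rel_entropy \<gamma> (prod_measure X \<mu>) \<le> ereal (\<Sum>i\<in>UNIV - {j}. ln (card (\<Lambda> i))) \<and>
    ext_integral \<gamma> c \<le> MOT0 X \<mu> c + ereal (e1 + CARD('m) * e2 + (3 * real CARD('m) + 1) * \<kappa>)"
proof -
  have sets\<mu>: "sets (\<mu> i) = sets (restrict_space borel (X i))" for i
    using \<mu> by (simp add: borel_prob_measure_on_def)
  then have space\<mu>: "space (\<mu> i) = X i" for i
    by (simp add: sets_eq_imp_space_eq[OF sets\<mu>] space_restrict_space)
  have prob: "prob_space (\<mu> i)" for i using \<mu> by (simp add: borel_prob_measure_on_def)
  have XM: "X i \<in> sets (\<mu> i)" for i using sets.top[of "\<mu> i"] by (simp add: space\<mu>)
  define good where "good i s T rep \<longleftrightarrow> finite T \<and> (\<forall>t\<in>T. {x \<in> X i. s x = t} \<in> sets (\<mu> i)) \<and>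
      (\<forall>t\<in>T. 0 < measure (\<mu> i) {x \<in> X i. s x = t}) \<and> (\<forall>t\<in>T. rep t \<in> K i) \<and>
      (AE x in \<mu> i. x \<in> K i \<and> s x \<in> T \<and> norm (x - rep (s x)) \<le> \<eta> \<and> q i (rep (s x)) = q i x)"
    for i and s :: "'a \<Rightarrow> 'l \<times> nat" and T rep
  have "\<exists>s T rep. good i s T rep" for i
  proof (rule fine_labels[OF \<mu>[of i] K(1)[of i] K(3)[of i] fin[of i] q[of _ i] meas[of _ i] \<eta>])
    fix s :: "'a \<Rightarrow> 'l \<times> nat" and T rep
    assume "finite T" "\<And>t. t \<in> T \<Longrightarrow> {x \<in> X i. s x = t} \<in> sets (\<mu> i)"
      "\<And>t. t \<in> T \<Longrightarrow> 0 < measure (\<mu> i) {x \<in> X i. s x = t}" "\<And>t. t \<in> T \<Longrightarrow> rep t \<in> K i"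
      "AE x in \<mu> i. x \<in> K i \<and> s x \<in> T \<and> norm (x - rep (s x)) \<le> \<eta> \<and> q i (rep (s x)) = q i x"
    then show "\<exists>s T rep. good i s T rep"
      unfolding good_def by (intro exI[of _ s] exI[of _ T] exI[of _ rep] conjI ballI)
  qed
  then obtain s T rep where good: "\<And>i. good i (s i) (T i) (rep i)" by metis
  have T: "finite (T i)" "\<And>t. t \<in> T i \<Longrightarrow> {x \<in> X i. s i x = t} \<in> sets (\<mu> i)"
    "\<And>t. t \<in> T i \<Longrightarrow> 0 < measure (\<mu> i) {x \<in> X i. s i x = t}"
    "\<And>t. t \<in> T i \<Longrightarrow> rep i t \<in> K i"
    and AET: "AE x in \<mu> i. x \<in> K i \<and> s i x \<in> T i \<and> norm (x - rep i (s i x)) \<le> \<eta> \<and> q i (rep i (s i x)) = q i x" for i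
    using good[of i] unfolding good_def by blast+
  define a where "a i t = measure (\<mu> i) {x \<in> X i. s i x = t}" for i t
  have a1: "(\<Sum>t\<in>T i. a i t) = 1" for i
  proof -
    have "(\<Sum>t\<in>T i. a i t) = measure (\<mu> i) (space (\<mu> i))"
      unfolding a_def space\<mu>[symmetric]
    proof (rule measure_label_union[OF prob T(1)])
      show "AE x in \<mu> i. x \<in> space (\<mu> i) \<longleftrightarrow> s i x \<in> T i"
        using AET[of i] AE_space by eventually_elim auto
    qed (use T(2) XM in \<open>auto simp: space\<mu>\<close>)
    then show ?thesis using prob_space.prob_space[OF prob[of i]] by simp
  qed
  define \<Omega> where "\<Omega> = PiE UNIV T"
  have fin\<Omega>: "finite \<Omega>" unfolding \<Omega>_def using T(1) by (intro finite_PiE) auto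
  have \<Omega>T: "x i \<in> T i" if "x \<in> \<Omega>" for x i using that by (auto simp: \<Omega>_def)
  define R where "R x = (\<chi> i. rep i (x i))" for x
  have RK: "R x \<in> prod_set K" if "x \<in> \<Omega>" for x
    using T(4) \<Omega>T[OF that] by (simp add: R_def prod_set_def)
  obtain P1 f where P1: "\<And>x. x \<in> \<Omega> \<Longrightarrow> 0 \<le> P1 x"
    "\<And>i t. t \<in> T i \<Longrightarrow> (\<Sum>x\<in>{x\<in>\<Omega>. x i = t}. P1 x) = a i t"
    and f: "\<And>x. x \<in> \<Omega> \<Longrightarrow> (\<Sum>i\<in>UNIV. f i (x i)) \<le> c (R x)"
    "(\<Sum>x\<in>\<Omega>. P1 x * (c (R x) - (\<Sum>i\<in>UNIV. f i (x i)))) \<le> \<kappa>"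
  proof (rule discrete_duality[of T a \<kappa> "\<lambda>x. c (R x)"])
    show "0 < a i t" if "t \<in> T i" for i t using T(3)[OF that] by (simp add: a_def)
  qed (use T(1) a1 \<kappa> that in \<open>auto simp: \<Omega>_def\<close>)
  have mono: "(\<Sum>x\<in>\<Omega>. P1 x * u (x i)) = (\<Sum>t\<in>T i. a i t * u t)" for u i
    using fin\<Omega> T(1) P1(2) by (intro sum_marginal) (auto simp: \<Omega>T)
  have P1sum: "(\<Sum>x\<in>\<Omega>. P1 x) = 1" using mono[of "\<lambda>_. 1" undefined] a1 by simp
  have ne: "\<Omega> \<noteq> {}" using P1sum by auto
  define E where "E x = c (R x) - (\<Sum>i\<in>UNIV. f i (x i))" for x
  \<comment> \<open>The c-transform of the discrete potentials in the variable \<open>i\<close>,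
    defined on the whole factor and not just at representatives. The minimum over the finite set
    \<open>\<Omega>\<close> is attained, and the slice at the minimising configuration is the
    touching function required by \<open>concave_wrt\<close>.\<close>
  define \<phi> where "\<phi> i y = Min ((\<lambda>x. c (vec_upd (R x) i y) - (\<Sum>k\<in>UNIV - {i}. f k (x k))) ` \<Omega>)" for i y
  have \<phi>_le: "\<phi> i y \<le> c (vec_upd (R x) i y) - (\<Sum>k\<in>UNIV - {i}. f k (x k))" if "x \<in> \<Omega>" for i y x
    unfolding \<phi>_def using that fin\<Omega> by (intro Min_le) auto
  have \<phi>_ex: "\<exists>x\<in>\<Omega>. \<phi> i y = c (vec_upd (R x) i y) - (\<Sum>k\<in>UNIV - {i}. f k (x k))" for i y
  proof -
    have "\<phi> i y \<in> (\<lambda>x. c (vec_upd (R x) i y) - (\<Sum>k\<in>UNIV - {i}. f k (x k))) ` \<Omega>"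
      unfolding \<phi>_def using fin\<Omega> ne by (intro Min_in) auto
    then show ?thesis by blast
  qed
  have conc: "concave_wrt ((\<lambda>v y. c (vec_upd v i y)) ` prod_set K) (X i) (\<phi> i)" for i
    unfolding concave_wrt_def
  proof
    fix y assume "y \<in> X i"
    obtain x where x: "x \<in> \<Omega>" "\<phi> i y = c (vec_upd (R x) i y) - (\<Sum>k\<in>UNIV - {i}. f k (x k))"
      using \<phi>_ex by blast
    have "\<phi> i y' - \<phi> i y \<le> c (vec_upd (R x) i y') - c (vec_upd (R x) i y)" for y'
      using \<phi>_le[OF x(1), of i y'] x(2) by simp
    then show "\<exists>h\<in>(\<lambda>v y. c (vec_upd v i y)) ` prod_set K. \<forall>y'\<in>X i. \<phi> i y' - \<phi> i y \<le> h y' - h y"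
      using RK[OF x(1)] by (intro bexI[of _ "\<lambda>y. c (vec_upd (R x) i y)"]) auto
  qed
  define om where "om i \<omega> \<longleftrightarrow> (\<forall>l\<in>\<Lambda> i. 0 \<le> \<omega> l) \<and>
        (\<Sum>l\<in>\<Lambda> i. measure (\<mu> i) {x \<in> X i. q i x = l} * \<omega> l) \<le> e2 \<and>
        (\<forall>x\<in>K i. \<forall>x'\<in>K i. q i x = q i x' \<longrightarrow> (\<forall>h\<in>(\<lambda>v y. c (vec_upd v i y)) ` prod_set K. \<forall>s.
          (\<forall>y\<in>X i. \<phi> i y - \<phi> i x \<le> h y - h x + s) \<longrightarrow> h x' - h x - (\<phi> i x' - \<phi> i x) \<le> \<omega> (q i x) + s))"
    for i \<omega>
  have "\<exists>\<omega>. om i \<omega>" for i using cell[OF conc[of i]] unfolding om_def .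
  then obtain \<omega> where \<omega>: "\<And>i. om i (\<omega> i)" by metis
  have \<omega>_sum: "(\<Sum>l\<in>\<Lambda> i. measure (\<mu> i) {x \<in> X i. q i x = l} * \<omega> i l) \<le> e2" for i
    using \<omega>[of i] by (simp add: om_def)
  have \<omega>_cell: "h x' - h x - (\<phi> i x' - \<phi> i x) \<le> \<omega> i (q i x) + s"
    if "x \<in> K i" "x' \<in> K i" "q i x = q i x'" "h \<in> (\<lambda>v y. c (vec_upd v i y)) ` prod_set K"
      "\<And>y. y \<in> X i \<Longrightarrow> \<phi> i y - \<phi> i x \<le> h y - h x + s" for i x x' h s
    by (rule \<omega>[of i, unfolded om_def, THEN conjunct2, THEN conjunct2, rule_format, OF that])
  define g where "g x = (\<lambda>i. q i (rep i (x i)))" for x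
  define \<Theta> where "\<Theta> = PiE UNIV \<Lambda>"
  have fin\<Theta>: "finite \<Theta>" unfolding \<Theta>_def using fin by (intro finite_PiE) auto
  have g\<Theta>: "g x \<in> \<Theta>" if "x \<in> \<Omega>" for x using q[OF T(4)[OF \<Omega>T[OF that]]]
    unfolding g_def \<Theta>_def by (intro PiE_I) auto
  \<comment> \<open>The coarse plan is the image of the fine discrete plan under
    \<open>g\<close>.\<close>
  define P where "P Q = (\<Sum>x\<in>{x\<in>\<Omega>. g x = Q}. P1 x)" for Q
  have P0: "0 \<le> P Q" for Q unfolding P_def using P1(1) by (intro sum_nonneg) auto
  have group: "(\<Sum>Q\<in>\<Theta>. \<Sum>x\<in>{x\<in>\<Omega>. g x = Q}. h x) = (\<Sum>x\<in>\<Omega>. h x)" for h :: "_ \<Rightarrow> real"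
    using fin\<Omega> fin\<Theta> g\<Theta> by (intro sum.group) auto
  have P_sum: "(\<Sum>Q\<in>\<Theta>. P Q * h Q) = (\<Sum>x\<in>\<Omega>. P1 x * h (g x))" for h
  proof -
    have "(\<Sum>Q\<in>\<Theta>. P Q * h Q) = (\<Sum>Q\<in>\<Theta>. \<Sum>x\<in>{x\<in>\<Omega>. g x = Q}. P1 x * h (g x))"
      unfolding P_def sum_distrib_right by (intro sum.cong) auto
    then show ?thesis unfolding group .
  qed
  \<comment> \<open>Almost every point has the same coarse label as the representative of its fine
    label, so the fine labels merge exactly into the coarse cells and \<open>P\<close> has the right
    marginals without any error.\<close>
  have marg: "(\<Sum>Q\<in>{Q \<in> \<Theta>. Q i = l}. P Q) = measure (\<mu> i) {x \<in> X i. q i x = l}" if l: "l \<in> \<Lambda> i" for i l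
  proof -
    have "(\<Sum>Q\<in>{Q \<in> \<Theta>. Q i = l}. P Q) = (\<Sum>Q\<in>\<Theta>. P Q * (if Q i = l then 1 else 0))"
      using fin\<Theta> by (simp add: sum.inter_filter[symmetric] if_distrib cong: if_cong)
    also have "\<dots> = (\<Sum>x\<in>\<Omega>. P1 x * (if q i (rep i (x i)) = l then 1 else 0))"
      unfolding P_sum by (simp add: g_def)
    also have "\<dots> = (\<Sum>t\<in>T i. a i t * (if q i (rep i t) = l then 1 else 0))"
      by (rule mono)
    also have "\<dots> = (\<Sum>t\<in>{t \<in> T i. q i (rep i t) = l}. a i t)"
      using T(1)[of i] by (simp add: sum.inter_filter[symmetric] if_distrib cong: if_cong)
    also have "\<dots> = measure (\<mu> i) {x \<in> X i. q i x = l}"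
      unfolding a_def space\<mu>[symmetric]
    proof (rule measure_label_union[OF prob])
      show "AE x in \<mu> i. x \<in> {x \<in> space (\<mu> i). q i x = l} \<longleftrightarrow> s i x \<in> {t \<in> T i. q i (rep i t) = l}"
        using AET[of i] AE_space by eventually_elim auto
    qed (use T(1,2) meas[OF l] in \<open>auto simp: space\<mu>\<close>)
    finally show ?thesis .
  qed
  have aeq: "AE x in \<mu> i. q i x \<in> \<Lambda> i" for i using K(3)[of i] by eventually_elim (rule q)
  define Z where "Z Q = {x \<in> prod_set X. \<forall>i. q i (x $ i) = Q i}" for Q
  obtain \<gamma> where \<gamma>: "\<gamma> \<in> couplings X \<mu>"
    "rel_entropy \<gamma> (prod_measure X \<mu>) \<le> ereal (\<Sum>i\<in>UNIV - {j}. ln (card (\<Lambda> i)))"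
    and Z: "\<And>Q. Q \<in> \<Theta> \<Longrightarrow> Z Q \<in> sets \<gamma>" "\<And>Q. Q \<in> \<Theta> \<Longrightarrow> measure \<gamma> (Z Q) = P Q"
  proof (rule block_plan[of X \<mu> \<Lambda> q P j])
    show "(\<Sum>Q\<in>{Q \<in> PiE UNIV \<Lambda>. Q i = l}. P Q) = measure (\<mu> i) {x \<in> X i. q i x = l}" if "l \<in> \<Lambda> i" for i l
      using marg[OF that] by (simp add: \<Theta>_def)
  qed (use \<mu> fin meas aeq P0 that in \<open>auto simp: \<Theta>_def Z_def\<close>)
  define m where "m = real CARD('m)"
  \<comment> \<open>The bound for \<open>c\<close> on the block of \<open>x\<close> after
    subtracting the potentials: each of the \<open>m\<close> single-coordinate increments costs a
    cell defect \<open>\<omega>\<close> and the slack \<open>E x\<close>, and \<open>e1\<close>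
    covers the rest.\<close>
  define B where "B x = c (R x) - (\<Sum>i\<in>UNIV. \<phi> i (rep i (x i))) + (\<Sum>i\<in>UNIV. \<omega> i (g x i)) + m * E x + e1" for x
  define approx where "approx i y \<longleftrightarrow> y \<in> K i \<and> s i y \<in> T i \<and> norm (y - rep i (s i y)) \<le> \<eta> \<and> q i (rep i (s i y)) = q i y" for i y
  have \<phi>f: "f i t \<le> \<phi> i (rep i t)" if t: "t \<in> T i" for i t
  proof -
    obtain x where x: "x \<in> \<Omega>" "\<phi> i (rep i t) = c (vec_upd (R x) i (rep i t)) - (\<Sum>k\<in>UNIV - {i}. f k (x k))"
      using \<phi>_ex by blast
    have x': "x(i := t) \<in> \<Omega>" using x(1) t by (auto simp: \<Omega>_def)
    have "R (x(i := t)) = vec_upd (R x) i (rep i t)" by (simp add: R_def vec_eq_iff)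
    moreover have "(\<Sum>k\<in>UNIV. f k ((x(i := t)) k)) = f i t + (\<Sum>k\<in>UNIV - {i}. f k (x k))"
      by (subst sum.remove[of _ i]) auto
    ultimately show ?thesis using f(1)[OF x'] x(2) by simp
  qed
  have pointwise: "c y \<le> (\<Sum>i\<in>UNIV. \<phi> i (rep i (s i (y $ i))) + \<kappa>) + B x"
    if y: "\<And>i. approx i (y $ i)" and x: "x \<in> \<Omega>" "g x = (\<lambda>i. q i (y $ i))" for y x
  proof -
    have yK: "y \<in> prod_set K" using y by (simp add: approx_def prod_set_def)
    have Ri: "R x $ i = rep i (x i)" for i by (simp add: R_def)
    have gi: "q i (R x $ i) = q i (y $ i)" for i using fun_cong[OF x(2), of i] by (simp add: g_def Ri)
    have incr: "c (vec_upd (R x) i (y $ i)) - c (R x) \<le> \<phi> i (y $ i) - \<phi> i (rep i (x i)) + \<omega> i (g x i) + E x" for i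
    proof -
      define h where "h = (\<lambda>y. c (vec_upd (R x) i y))"
      have h: "h \<in> (\<lambda>v y. c (vec_upd v i y)) ` prod_set K" using RK[OF x(1)] by (auto simp: h_def)
      have hx: "h (R x $ i) = c (R x)" by (simp add: h_def)
      \<comment> \<open>The slack is the gap at \<open>x\<close>: testing the minimum in
        \<open>\<phi> i z\<close> with \<open>x\<close> and replacing \<open>\<phi> i\<close> at the
        representative by the smaller \<open>f i (x i)\<close> leaves precisely
        \<open>E x\<close>.\<close>
      have "\<phi> i z - \<phi> i (R x $ i) \<le> h z - h (R x $ i) + E x" for z
      proof -
        have "(\<Sum>k\<in>UNIV. f k (x k)) = f i (x i) + (\<Sum>k\<in>UNIV - {i}. f k (x k))"
          by (rule sum.remove) auto
        then show ?thesis
          using \<phi>_le[OF x(1), of i z] \<phi>f[OF \<Omega>T[OF x(1)], of i] hx by (simp add: E_def h_def Ri)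
      qed
      moreover have "R x $ i \<in> K i" "y $ i \<in> K i" using RK[OF x(1)] yK by (auto simp: prod_set_def)
      ultimately have "h (y $ i) - h (R x $ i) - (\<phi> i (y $ i) - \<phi> i (R x $ i)) \<le> \<omega> i (q i (R x $ i)) + E x"
        using gi[of i] h by (intro \<omega>_cell)
      then show ?thesis unfolding hx by (simp add: h_def Ri g_def)
    qed
    \<comment> \<open>A minimum of slices inherits the modulus of continuity of \<open>c\<close>.
      This exchanges \<open>\<phi> i (y $ i)\<close> for the value at a representative, so that only
      step functions have to be integrated.\<close>
    have \<phi>y: "\<phi> i (y $ i) \<le> \<phi> i (rep i (s i (y $ i))) + \<kappa>" for i
    proof -
      define z where "z = rep i (s i (y $ i))"
      have z: "z \<in> K i" "norm (y $ i - z) \<le> \<eta>" using y[of i] T(4) by (auto simp: z_def approx_def)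
      obtain x0 where x0: "x0 \<in> \<Omega>" "\<phi> i z = c (vec_upd (R x0) i z) - (\<Sum>k\<in>UNIV - {i}. f k (x0 k))"
        using \<phi>_ex by blast
      have "c (vec_upd (R x0) i (y $ i)) \<le> c (vec_upd (R x0) i z) + \<kappa>"
      proof (rule unif)
        show "vec_upd (R x0) i (y $ i) \<in> prod_set K" "vec_upd (R x0) i z \<in> prod_set K"
          using RK[OF x0(1)] yK z(1) by (auto simp: prod_set_def)
        show "norm (vec_upd (R x0) i z $ k - vec_upd (R x0) i (y $ i) $ k) \<le> \<eta>" for k
          using z(2) \<eta> by (simp add: norm_minus_commute)
      qed
      then show ?thesis using \<phi>_le[OF x0(1), of i "y $ i"] x0(2) by (simp add: z_def)
    qed
    have "c y \<le> c (R x) + (\<Sum>i\<in>UNIV. c (vec_upd (R x) i (y $ i)) - c (R x)) + e1"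
      using RK[OF x(1)] yK gi by (rule mixed)
    also have "(\<Sum>i\<in>UNIV. c (vec_upd (R x) i (y $ i)) - c (R x)) \<le>
        (\<Sum>i\<in>UNIV. (\<phi> i (rep i (s i (y $ i))) + \<kappa>) - \<phi> i (rep i (x i)) + \<omega> i (g x i) + E x)"
      using incr \<phi>y by (intro sum_mono) (smt (verit))
    also have "\<dots> = (\<Sum>i\<in>UNIV. \<phi> i (rep i (s i (y $ i))) + \<kappa>) - (\<Sum>i\<in>UNIV. \<phi> i (rep i (x i))) +
        (\<Sum>i\<in>UNIV. \<omega> i (g x i)) + m * E x"
      by (simp only: sum.distrib sum_subtractf sum_constant m_def)
    finally show ?thesis by (simp add: B_def)
  qed
  define S where "S Q = (\<Sum>x\<in>{x\<in>\<Omega>. g x = Q}. P1 x * B x)" for Q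
  \<comment> \<open>\<open>H Q\<close> is the mean of \<open>B\<close> over the fine configurations
    in the block \<open>Q\<close>. Each of them gives a bound for \<open>c\<close> on the block,
    hence so does the mean, and the means recombine to the full average under
    \<open>P1\<close>.\<close>
  define H where "H Q = S Q / P Q" for Q
  have HP: "H Q * P Q = S Q" for Q
  proof (cases "P Q = 0")
    case True
    have "\<forall>x\<in>{x\<in>\<Omega>. g x = Q}. P1 x = 0"
      using True fin\<Omega> P1(1) unfolding P_def by (subst (asm) sum_nonneg_eq_0_iff) auto
    then have "S Q = 0" unfolding S_def by (intro sum.neutral) auto
    then show ?thesis using True by simp
  qed (simp add: H_def)
  have T2: "\<And>t. t \<in> T i \<Longrightarrow> {x \<in> space (\<mu> i). s i x = t} \<in> sets (\<mu> i)" for i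
    using T(2) by (simp add: space\<mu>)
  define st where "st i b y = (\<Sum>t\<in>T i. b t * indicator {x \<in> space (\<mu> i). s i x = t} y)"
    for i and b :: "'l \<times> nat \<Rightarrow> real" and y
  have st: "st i b \<in> borel_measurable (\<mu> i)" "\<bar>st i b y\<bar> \<le> (\<Sum>t\<in>T i. \<bar>b t\<bar>)"
    "(\<integral>y. st i b y \<partial>\<mu> i) = (\<Sum>t\<in>T i. a i t * b t)"
    "y \<in> X i \<Longrightarrow> s i y \<in> T i \<Longrightarrow> st i b y = b (s i y)" for i b y
    unfolding st_def a_def space\<mu>[symmetric]
    using label_step_function[OF prob[of i] T(1)[of i] T2[of _ i], where b = b] by blast+
  define u where "u i = st i (\<lambda>t. \<phi> i (rep i t) + \<kappa>)" for i
  have u: "u i \<in> borel_measurable (\<mu> i)" "(\<integral>y. u i y \<partial>\<mu> i) = (\<Sum>t\<in>T i. a i t * (\<phi> i (rep i t) + \<kappa>))"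
    "\<And>y. y \<in> X i \<Longrightarrow> s i y \<in> T i \<Longrightarrow> u i y = \<phi> i (rep i (s i y)) + \<kappa>" for i
    unfolding u_def by (rule st(1), rule st(3), rule st(4))
  have ub: "\<bar>u i y\<bar> \<le> (\<Sum>i\<in>UNIV. \<Sum>t\<in>T i. \<bar>\<phi> i (rep i t) + \<kappa>\<bar>)" for i y
  proof -
    have "\<bar>u i y\<bar> \<le> (\<Sum>t\<in>T i. \<bar>\<phi> i (rep i t) + \<kappa>\<bar>)" unfolding u_def by (rule st(2))
    also have "\<dots> \<le> (\<Sum>i\<in>UNIV. \<Sum>t\<in>T i. \<bar>\<phi> i (rep i t) + \<kappa>\<bar>)"
      by (rule member_le_sum[of i UNIV "\<lambda>i. \<Sum>t\<in>T i. \<bar>\<phi> i (rep i t) + \<kappa>\<bar>"]) (auto intro: sum_nonneg)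
    finally show ?thesis .
  qed
  have g\<gamma>: "prob_space \<gamma>" "sets \<gamma> = sets (restrict_space borel (prod_set X))"
    using \<gamma>(1) by (auto simp: couplings_def borel_prob_measure_on_def)
  have space\<gamma>: "space \<gamma> = prod_set X" using sets_eq_imp_space_eq[OF g\<gamma>(2)] by (simp add: space_restrict_space)
  have AEapprox: "AE y in \<gamma>'. \<forall>i. approx i (y $ i)" if "\<gamma>' \<in> couplings X \<mu>" for \<gamma>'
    using coupling_bounds(1)[OF that, of "\<lambda>i. {y. approx i y}" "\<lambda>_ _. 0" 0] AET by (simp add: approx_def)
  have "AE y in \<gamma>. \<forall>Q\<in>{Q\<in>\<Theta>. P Q = 0}. y \<notin> Z Q"
  proof (rule AE_ball_countable'[OF _ countable_finite])
    fix Q assume Q: "Q \<in> {Q\<in>\<Theta>. P Q = 0}"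
    then have "emeasure \<gamma> (Z Q) = 0"
      using Z(2)[of Q] finite_measure.emeasure_eq_measure[OF prob_space.finite_measure[OF g\<gamma>(1)]] by simp
    then show "AE y in \<gamma>. y \<notin> Z Q" using Z(1)[of Q] Q by (intro AE_not_in) auto
  qed (use fin\<Theta> in auto)
  then have "AE y in \<gamma>. c y \<le> (\<Sum>i\<in>UNIV. u i (y $ i)) + (\<Sum>Q\<in>\<Theta>. H Q * indicator (Z Q) y)"
    using AEapprox[OF \<gamma>(1)] AE_space
  proof eventually_elim
    case (elim y)
    define Q where "Q = (\<lambda>i. q i (y $ i))"
    have yX: "y \<in> prod_set X" using elim by (simp add: space\<gamma>)
    have Q\<Theta>: "Q \<in> \<Theta>" using q elim by (auto simp: \<Theta>_def Q_def approx_def)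
    have yZ: "y \<in> Z Q' \<longleftrightarrow> Q' = Q" for Q' using yX by (auto simp: Z_def Q_def)
    \<comment> \<open>Almost every point avoids the finitely many blocks of mass 0, so the division
      in \<open>H Q\<close> is genuine here.\<close>
    have PQ: "0 < P Q" using elim Q\<Theta> yZ[of Q] P0[of Q] by (auto simp: less_le)
    have uy: "(\<Sum>i\<in>UNIV. u i (y $ i)) = (\<Sum>i\<in>UNIV. \<phi> i (rep i (s i (y $ i))) + \<kappa>)"
      using yX elim by (intro sum.cong refl u(3)) (auto simp: prod_set_def approx_def)
    have "P Q * (c y - (\<Sum>i\<in>UNIV. u i (y $ i))) = (\<Sum>x\<in>{x\<in>\<Omega>. g x = Q}. P1 x * (c y - (\<Sum>i\<in>UNIV. u i (y $ i))))"
      by (simp add: P_def sum_distrib_right)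
    also have "\<dots> \<le> S Q"
      unfolding S_def
    proof (intro sum_mono mult_left_mono)
      fix x assume "x \<in> {x\<in>\<Omega>. g x = Q}"
      then show "c y - (\<Sum>i\<in>UNIV. u i (y $ i)) \<le> B x" "0 \<le> P1 x"
        using pointwise[of y x] elim P1(1) uy by (auto simp: Q_def)
    qed
    finally have "c y - (\<Sum>i\<in>UNIV. u i (y $ i)) \<le> H Q"
      using PQ by (simp add: H_def pos_le_divide_eq mult.commute)
    moreover have "(\<Sum>Q'\<in>\<Theta>. H Q' * indicator (Z Q') y) = (\<Sum>Q'\<in>\<Theta>. if Q' = Q then H Q' else 0)"
      using yZ by (intro sum.cong) (auto split: split_indicator)
    ultimately show ?case using Q\<Theta> fin\<Theta> by simp
  qed
  then have "ext_integral \<gamma> c \<le> ereal ((\<Sum>i\<in>UNIV. \<integral>x. u i x \<partial>\<mu> i) + (\<Sum>Q\<in>\<Theta>. H Q * measure \<gamma> (Z Q)))"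
    using \<gamma>(1) c0 u(1) ub fin\<Theta> Z(1) by (intro coupling_cost_upper) auto
  also have "(\<Sum>i\<in>UNIV. \<integral>x. u i x \<partial>\<mu> i) + (\<Sum>Q\<in>\<Theta>. H Q * measure \<gamma> (Z Q)) \<le>
      (\<Sum>x\<in>\<Omega>. P1 x * c (R x)) + (e1 + m * e2 + 2 * m * \<kappa>)"
  proof -
    have 1: "(\<Sum>i\<in>UNIV. \<integral>x. u i x \<partial>\<mu> i) = (\<Sum>i\<in>UNIV. \<Sum>x\<in>\<Omega>. P1 x * \<phi> i (rep i (x i))) + m * \<kappa>"
    proof -
      have "(\<integral>y. u i y \<partial>\<mu> i) = (\<Sum>x\<in>\<Omega>. P1 x * \<phi> i (rep i (x i))) + \<kappa>" for i
        using mono[of "\<lambda>t. \<phi> i (rep i t)" i] a1[of i]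
        by (simp add: u(2) distrib_left sum.distrib sum_distrib_right[symmetric])
      then show ?thesis by (simp add: sum.distrib m_def)
    qed
    \<comment> \<open>The fibres of \<open>g\<close> reassemble to \<open>\<Omega>\<close>. In the
      total the sums of \<open>\<phi>\<close> cancel against those in \<open>1\<close>, because
      \<open>P1\<close> has the marginals \<open>a i\<close>; only defects and gaps remain.\<close>
    have "(\<Sum>Q\<in>\<Theta>. H Q * measure \<gamma> (Z Q)) = (\<Sum>Q\<in>\<Theta>. S Q)" using HP Z(2) by simp
    also have "\<dots> = (\<Sum>x\<in>\<Omega>. P1 x * B x)" unfolding S_def by (rule group)
    also have "\<dots> = (\<Sum>x\<in>\<Omega>. P1 x * c (R x)) - (\<Sum>x\<in>\<Omega>. \<Sum>i\<in>UNIV. P1 x * \<phi> i (rep i (x i)))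
        + (\<Sum>x\<in>\<Omega>. \<Sum>i\<in>UNIV. P1 x * \<omega> i (g x i)) + m * (\<Sum>x\<in>\<Omega>. P1 x * E x) + e1 * (\<Sum>x\<in>\<Omega>. P1 x)"
      by (simp add: B_def algebra_simps sum.distrib sum_subtractf sum_distrib_left)
    also have "(\<Sum>x\<in>\<Omega>. \<Sum>i\<in>UNIV. P1 x * \<phi> i (rep i (x i))) = (\<Sum>i\<in>UNIV. \<Sum>x\<in>\<Omega>. P1 x * \<phi> i (rep i (x i)))"
      by (rule sum.swap)
    also have "(\<Sum>x\<in>\<Omega>. \<Sum>i\<in>UNIV. P1 x * \<omega> i (g x i)) = (\<Sum>i\<in>UNIV. \<Sum>x\<in>\<Omega>. P1 x * \<omega> i (g x i))"
      by (rule sum.swap)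
    finally have 2: "(\<Sum>Q\<in>\<Theta>. H Q * measure \<gamma> (Z Q)) = (\<Sum>x\<in>\<Omega>. P1 x * c (R x)) - (\<Sum>i\<in>UNIV. \<Sum>x\<in>\<Omega>. P1 x * \<phi> i (rep i (x i)))
        + (\<Sum>i\<in>UNIV. \<Sum>x\<in>\<Omega>. P1 x * \<omega> i (g x i)) + m * (\<Sum>x\<in>\<Omega>. P1 x * E x) + e1 * (\<Sum>x\<in>\<Omega>. P1 x)" .
    have 3: "(\<Sum>i\<in>UNIV. \<Sum>x\<in>\<Omega>. P1 x * \<omega> i (g x i)) \<le> m * e2"
    proof -
      have "(\<Sum>x\<in>\<Omega>. P1 x * \<omega> i (g x i)) \<le> e2" for i
      proof -
        have "(\<Sum>x\<in>\<Omega>. P1 x * \<omega> i (g x i)) = (\<Sum>Q\<in>\<Theta>. P Q * \<omega> i (Q i))"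
          using P_sum[of "\<lambda>Q. \<omega> i (Q i)"] by simp
        also have "\<dots> = (\<Sum>l\<in>\<Lambda> i. measure (\<mu> i) {x \<in> X i. q i x = l} * \<omega> i l)"
          using fin\<Theta> fin marg by (intro sum_marginal) (auto simp: \<Theta>_def)
        finally show ?thesis using \<omega>_sum by simp
      qed
      then show ?thesis using sum_bounded_above[of UNIV "\<lambda>i. \<Sum>x\<in>\<Omega>. P1 x * \<omega> i (g x i)" e2] by (simp add: m_def)
    qed
    have 4: "m * (\<Sum>x\<in>\<Omega>. P1 x * E x) \<le> m * \<kappa>"
      using f(2) by (intro mult_left_mono) (auto simp: E_def m_def)
    show ?thesis unfolding 1 2 P1sum using 3 4 by linarith
  qed
  finally have upper: "ext_integral \<gamma> c \<le> ereal ((\<Sum>x\<in>\<Omega>. P1 x * c (R x)) + (e1 + m * e2 + 2 * m * \<kappa>))"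
    by simp
  \<comment> \<open>Weak duality for an arbitrary competitor: the lifted functions
    \<open>f i (s i y) - \<kappa>\<close> are dual feasible almost everywhere, and their integrals
    depend on the marginals only, so they can be evaluated with \<open>P1\<close>.\<close>
  have lower: "ereal ((\<Sum>x\<in>\<Omega>. P1 x * c (R x)) - (1 + m) * \<kappa>) \<le> MOT0 X \<mu> c"
    unfolding MOT0_def
  proof (rule INF_greatest)
    fix \<gamma>' assume \<gamma>': "\<gamma>' \<in> couplings X \<mu>"
    define v where "v i = st i (\<lambda>t. f i t - \<kappa>)" for i
    have v: "v i \<in> borel_measurable (\<mu> i)" "(\<integral>y. v i y \<partial>\<mu> i) = (\<Sum>t\<in>T i. a i t * (f i t - \<kappa>))"
      "\<And>y. y \<in> X i \<Longrightarrow> s i y \<in> T i \<Longrightarrow> v i y = f i (s i y) - \<kappa>" for i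
      unfolding v_def by (rule st(1), rule st(3), rule st(4))
    have vb: "\<bar>v i y\<bar> \<le> (\<Sum>i\<in>UNIV. \<Sum>t\<in>T i. \<bar>f i t - \<kappa>\<bar>)" for i y
    proof -
      have "\<bar>v i y\<bar> \<le> (\<Sum>t\<in>T i. \<bar>f i t - \<kappa>\<bar>)" unfolding v_def by (rule st(2))
      also have "\<dots> \<le> (\<Sum>i\<in>UNIV. \<Sum>t\<in>T i. \<bar>f i t - \<kappa>\<bar>)"
        by (rule member_le_sum[of i UNIV "\<lambda>i. \<Sum>t\<in>T i. \<bar>f i t - \<kappa>\<bar>"]) (auto intro: sum_nonneg)
      finally show ?thesis .
    qed
    have "(\<Sum>i\<in>UNIV. \<integral>x. v i x \<partial>\<mu> i) = (\<Sum>i\<in>UNIV. \<Sum>x\<in>\<Omega>. P1 x * f i (x i)) - m * \<kappa>"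
    proof -
      have "(\<integral>y. v i y \<partial>\<mu> i) = (\<Sum>x\<in>\<Omega>. P1 x * f i (x i)) - \<kappa>" for i
        using mono[of "f i" i] a1[of i]
        by (simp add: v(2) right_diff_distrib sum_subtractf sum_distrib_right[symmetric])
      then show ?thesis by (simp add: sum_subtractf m_def)
    qed
    moreover have "(\<Sum>i\<in>UNIV. \<Sum>x\<in>\<Omega>. P1 x * f i (x i)) = (\<Sum>x\<in>\<Omega>. P1 x * c (R x)) - (\<Sum>x\<in>\<Omega>. P1 x * E x)"
      by (subst sum.swap) (simp add: E_def right_diff_distrib sum_subtractf sum_distrib_left)
    moreover have "(\<Sum>x\<in>\<Omega>. P1 x * E x) \<le> \<kappa>" using f(2) by (simp add: E_def)
    ultimately have "(\<Sum>x\<in>\<Omega>. P1 x * c (R x)) - (1 + m) * \<kappa> \<le> (\<Sum>i\<in>UNIV. \<integral>x. v i x \<partial>\<mu> i)"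
      by (simp add: distrib_right)
    also have "ereal (\<Sum>i\<in>UNIV. \<integral>x. v i x \<partial>\<mu> i) \<le> ext_integral \<gamma>' c"
    proof (rule coupling_cost_lower[OF \<gamma>' c0 v(1) vb])
      have space\<gamma>': "space \<gamma>' = prod_set X"
      proof -
        have "sets \<gamma>' = sets (restrict_space borel (prod_set X))"
          using \<gamma>' by (auto simp: couplings_def borel_prob_measure_on_def)
        from sets_eq_imp_space_eq[OF this] show ?thesis by (simp add: space_restrict_space)
      qed
      show "AE y in \<gamma>'. (\<Sum>i\<in>UNIV. v i (y $ i)) \<le> c y"
        using AEapprox[OF \<gamma>'] AE_space
      proof eventually_elim
        case (elim y)
        define x where "x = (\<lambda>i. s i (y $ i))"
        have x\<Omega>: "x \<in> \<Omega>" using elim by (auto simp: \<Omega>_def x_def approx_def)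
        have yX: "y \<in> prod_set X" using elim by (simp add: space\<gamma>')
        have "(\<Sum>i\<in>UNIV. v i (y $ i)) = (\<Sum>i\<in>UNIV. f i (x i) - \<kappa>)"
          using yX elim by (intro sum.cong refl) (auto simp: v(3) prod_set_def approx_def x_def)
        also have "\<dots> = (\<Sum>i\<in>UNIV. f i (x i)) - m * \<kappa>" by (simp add: sum_subtractf m_def)
        \<comment> \<open>Of the \<open>m\<close> copies of \<open>\<kappa>\<close> at least one is
          available, and it pays for replacing \<open>R x\<close> by \<open>y\<close>.\<close>
        also have "\<dots> \<le> c (R x) - 1 * \<kappa>"
          using f(1)[OF x\<Omega>] \<kappa> by (intro diff_mono mult_right_mono) (auto simp: m_def Suc_le_eq)
        also have "c (R x) \<le> c y + \<kappa>"
          using elim by (intro unif RK[OF x\<Omega>]) (auto simp: prod_set_def approx_def R_def x_def)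
        finally show ?case by simp
      qed
    qed
    finally show "ereal ((\<Sum>x\<in>\<Omega>. P1 x * c (R x)) - (1 + m) * \<kappa>) \<le> ext_integral \<gamma>' c" by simp
  qed
  have "ereal ((\<Sum>x\<in>\<Omega>. P1 x * c (R x)) + (e1 + m * e2 + 2 * m * \<kappa>)) =
      ereal ((\<Sum>x\<in>\<Omega>. P1 x * c (R x)) - (1 + m) * \<kappa>) + ereal (e1 + m * e2 + (3 * m + 1) * \<kappa>)"
    by (simp add: algebra_simps)
  also have "\<dots> \<le> MOT0 X \<mu> c + ereal (e1 + m * e2 + (3 * m + 1) * \<kappa>)"
    by (intro add_right_mono lower)
  finally have "ext_integral \<gamma> c \<le> MOT0 X \<mu> c + ereal (e1 + m * e2 + (3 * m + 1) * \<kappa>)"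
    using upper order_trans by blast
  then show ?thesis using \<gamma> unfolding m_def by blast
qed

section \<open>The upper bound for small \<epsilon>, with the block scale tied to \<epsilon>\<close>

theorem theorem3p7:
  fixes X :: "'m::finite \<Rightarrow> (real ^ 'N::finite) set"
    and d :: "'m \<Rightarrow> nat"
    and \<mu> :: "'m \<Rightarrow> (real ^ 'N) measure"
    and c :: "(real ^ 'N) ^ 'm \<Rightarrow> real"
  assumes "CARD('m) \<ge> 2"
    and "\<And>i. C2_submanifold (d i) (X i)"
    and "\<And>i. borel_prob_measure_on (X i) (\<mu> i)"
    and "\<And>i. compact (measure_support (\<mu> i))"
    and "\<And>i. bounded_density_wrt (restrict_space (hausdorff_measure (d i)) (X i)) (\<mu> i)"
    and "\<And>x. x \<in> prod_set X \<Longrightarrow> c x \<ge> 0"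
    and "C2_on_submanifold (prod_set X) c"
  shows "\<exists>\<epsilon>0 C :: real. \<epsilon>0 > 0 \<and> C \<ge> 0 \<and>
    (\<forall>\<epsilon>. 0 < \<epsilon> \<and> \<epsilon> \<le> \<epsilon>0 \<longrightarrow>
      MOT X \<mu> c \<epsilon> \<le> MOT0 X \<mu> c +
        ereal (1 / 2 * ((\<Sum>i\<in>UNIV. real (d i)) - real (MAX i. d i)) * \<epsilon> * ln (1 / \<epsilon>) + C * \<epsilon>))"
proof -
  let ?K = "\<lambda>i. measure_support (\<mu> i)"
  have K: "\<And>i. compact (?K i)" "\<And>i. ?K i \<subseteq> X i" "\<And>i. AE x in \<mu> i. x \<in> ?K i"
    using assms(4) measure_support_subset[OF assms(3)] AE_measure_support[OF assms(3)] by auto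
  have KX: "prod_set ?K \<subseteq> prod_set X" using K(2) by (auto simp: prod_set_def)
  have local: "\<exists>r>0. \<exists>C. taylor_on C (ball p r \<inter> prod_set X) c" if "p \<in> prod_set ?K" for p
    by (rule C2_on_submanifold_imp_taylor_on[OF assms(7) subsetD[OF KX that]])
  have compK: "compact (prod_set ?K)" by (rule compact_prod_set[OF K(1)])
  have "\<exists>r C. 0 < r \<and> 0 \<le> C \<and> (\<forall>v\<in>prod_set ?K. taylor_on C (ball v r \<inter> prod_set X) c)"
    by (rule taylor_on_uniform[OF compK local]) blast+
  then obtain r C where r: "0 < r" and C: "0 \<le> C"
    and T: "\<And>v. v \<in> prod_set ?K \<Longrightarrow> taylor_on C (ball v r \<inter> prod_set X) c"
    by blast
  have family: "\<exists>r>0. \<exists>C. \<forall>h\<in>(\<lambda>v y. c (vec_upd v i y)) ` prod_set ?K. taylor_on C (ball p r \<inter> X i) h"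
    if p: "p \<in> ?K i" for i p
  proof (intro exI conjI ballI)
    show "0 < r" by (rule r)
    fix h assume "h \<in> (\<lambda>v y. c (vec_upd v i y)) ` prod_set ?K"
    then obtain v where v: "v \<in> prod_set ?K" "h = (\<lambda>y. c (vec_upd v i y))" by auto
    \<comment> \<open>A slice in direction \<open>i\<close> does not see the \<open>i\<close>-th
      coordinate of its base point. Moving this coordinate to \<open>p\<close> stays in the product
      of the supports, so the uniform Taylor ball of \<open>c\<close> there yields one around
      \<open>p\<close> with the same radius for all slices.\<close>
    have v': "vec_upd v i p \<in> prod_set ?K" by (rule vec_upd_in_prod_set[OF v(1) p])
    have "vec_upd (vec_upd v i p) i y = vec_upd v i y" for y by (simp add: vec_eq_iff)
    then show "taylor_on C (ball p r \<inter> X i) h"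
      using taylor_on_slice[OF T[OF v'] subsetD[OF KX v'], of i] v(2) by simp
  qed
  define good where "good i C \<delta> q \<Lambda> \<longleftrightarrow> finite \<Lambda> \<and> card \<Lambda> * \<delta> ^ d i \<le> C \<and>
      (\<forall>x\<in>?K i. q x \<in> \<Lambda>) \<and> (\<forall>l\<in>\<Lambda>. {x \<in> X i. q x = l} \<in> sets (\<mu> i)) \<and>
      (\<forall>x\<in>?K i. \<forall>x'\<in>?K i. q x = q x' \<longrightarrow> norm (x' - x) \<le> C * \<delta>) \<and>
      (\<forall>f. concave_wrt ((\<lambda>v y. c (vec_upd v i y)) ` prod_set ?K) (X i) f \<longrightarrow> (\<exists>\<omega>. (\<forall>l\<in>\<Lambda>. 0 \<le> \<omega> l) \<and>
        (\<Sum>l\<in>\<Lambda>. measure (\<mu> i) {x \<in> X i. q x = l} * \<omega> l) \<le> C * \<delta>\<^sup>2 \<and>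
        (\<forall>x\<in>?K i. \<forall>x'\<in>?K i. q x = q x' \<longrightarrow> (\<forall>h\<in>(\<lambda>v y. c (vec_upd v i y)) ` prod_set ?K. \<forall>s.
          (\<forall>y\<in>X i. f y - f x \<le> h y - h x + s) \<longrightarrow> h x' - h x - (f x' - f x) \<le> \<omega> (q x) + s))))"
    for i and C \<delta> :: real and q :: "real ^ 'N \<Rightarrow> nat \<times> (real ^ 'N \<Rightarrow> int)" and \<Lambda>
  have "\<exists>C \<delta>0. 0 \<le> C \<and> 0 < \<delta>0 \<and> (\<forall>\<delta>. 0 < \<delta> \<longrightarrow> \<delta> \<le> \<delta>0 \<longrightarrow> (\<exists>q \<Lambda>. good i C \<delta> q \<Lambda>))" for i
  proof (rule cells[OF assms(2)[of i] assms(3)[of i] assms(5)[of i] K(1)[of i] K(2)[of i] family[of _ i]])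
    fix C \<delta>0 :: real
    assume C: "0 \<le> C" "0 < \<delta>0" and mesh: "\<And>\<delta>::real. 0 < \<delta> \<Longrightarrow> \<delta> \<le> \<delta>0 \<Longrightarrow> \<exists>(q :: real ^ 'N \<Rightarrow> nat \<times> (real ^ 'N \<Rightarrow> int)) \<Lambda>. finite \<Lambda> \<and> card \<Lambda> * \<delta> ^ d i \<le> C \<and>
      (\<forall>x\<in>?K i. q x \<in> \<Lambda>) \<and> (\<forall>l\<in>\<Lambda>. {x \<in> X i. q x = l} \<in> sets (\<mu> i)) \<and>
      (\<forall>x\<in>?K i. \<forall>x'\<in>?K i. q x = q x' \<longrightarrow> norm (x' - x) \<le> C * \<delta>) \<and>
      (\<forall>f. concave_wrt ((\<lambda>v y. c (vec_upd v i y)) ` prod_set ?K) (X i) f \<longrightarrow> (\<exists>\<omega>. (\<forall>l\<in>\<Lambda>. 0 \<le> \<omega> l) \<and>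
        (\<Sum>l\<in>\<Lambda>. measure (\<mu> i) {x \<in> X i. q x = l} * \<omega> l) \<le> C * \<delta>\<^sup>2 \<and>
        (\<forall>x\<in>?K i. \<forall>x'\<in>?K i. q x = q x' \<longrightarrow> (\<forall>h\<in>(\<lambda>v y. c (vec_upd v i y)) ` prod_set ?K. \<forall>s.
          (\<forall>y\<in>X i. f y - f x \<le> h y - h x + s) \<longrightarrow> h x' - h x - (f x' - f x) \<le> \<omega> (q x) + s))))"
    show "\<exists>C \<delta>0. 0 \<le> C \<and> 0 < \<delta>0 \<and> (\<forall>\<delta>. 0 < \<delta> \<longrightarrow> \<delta> \<le> \<delta>0 \<longrightarrow> (\<exists>q \<Lambda>. good i C \<delta> q \<Lambda>))"
      unfolding good_def by (rule exI[of _ C], rule exI[of _ \<delta>0], intro conjI allI impI C mesh)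
  qed
  then obtain b \<delta>0 where b: "\<And>i. 0 \<le> b i" "\<And>i. 0 < \<delta>0 i"
    and cells: "\<And>i \<delta>. 0 < \<delta> \<Longrightarrow> \<delta> \<le> \<delta>0 i \<Longrightarrow> \<exists>q \<Lambda>. good i (b i) \<delta> q \<Lambda>"
    by metis
  define m where "m = real CARD('m)"
  define D where "D = (\<Sum>i\<in>UNIV. b i)"
  have m: "1 \<le> m" by (simp add: m_def Suc_le_eq)
  have D: "0 \<le> D" "b i \<le> D" for i
    unfolding D_def using b(1) by (auto intro: sum_nonneg member_le_sum)
  \<comment> \<open>The three bounds make \<open>ln \<delta>\<close> nonpositive, keep the diameter
    \<open>D * \<delta>\<close> of a block below the Taylor radius \<open>r\<close>, and admit the
    scale in every factor.\<close>
  define \<delta>1 where "\<delta>1 = Min (insert 1 (insert (r / (2 * (D + 1))) (range \<delta>0)))"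
  have \<delta>1: "0 < \<delta>1" unfolding \<delta>1_def using b(2) r D(1) by (subst Min_gr_iff) auto
  have \<delta>1_le: "\<delta>1 \<le> 1" "\<delta>1 \<le> r / (2 * (D + 1))" "\<delta>1 \<le> \<delta>0 i" for i
    unfolding \<delta>1_def by (rule Min_le, simp, simp)+
  define L where "L = (\<Sum>i\<in>UNIV. ln (max 1 (b i)))"
  \<comment> \<open>The summands are the coordinate interaction, the averaged defects, the loss from
    the tolerance \<open>\<kappa> = \<epsilon>\<close>, and the part \<open>L\<close> of the
    logarithmic cell numbers that stays bounded as \<epsilon> tends to 0.\<close>
  define C' where "C' = (1 + m) * C * D\<^sup>2 + m * D + (3 * m + 1) + L"
  have "(MAX i. d i) \<in> range d" by (rule Max_in) auto
  then obtain j where j: "d j = (MAX i. d i)" by (metis rangeE)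
  have C': "0 \<le> C'"
    unfolding C'_def L_def using C D(1) m by (intro add_nonneg_nonneg sum_nonneg) auto
  show ?thesis
  proof (rule exI[of _ "\<delta>1\<^sup>2"], rule exI[of _ C'], intro conjI allI impI)
    show "0 < \<delta>1\<^sup>2" using \<delta>1 by simp
    show "0 \<le> C'" by (rule C')
    fix \<epsilon> :: real assume \<epsilon>: "0 < \<epsilon> \<and> \<epsilon> \<le> \<delta>1\<^sup>2"
    define \<delta> where "\<delta> = sqrt \<epsilon>"
    have \<delta>: "0 < \<delta>" "\<delta>\<^sup>2 = \<epsilon>" "\<delta> \<le> \<delta>1"
      using \<epsilon> \<delta>1 real_sqrt_le_mono[of \<epsilon> "\<delta>1\<^sup>2"] by (auto simp: \<delta>_def)
    have "\<exists>q \<Lambda>. good i (b i) \<delta> q \<Lambda>" for i using cells \<delta>(1) order_trans[OF \<delta>(3) \<delta>1_le(3)] by blast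
    then obtain q \<Lambda> where good: "\<And>i. good i (b i) \<delta> (q i) (\<Lambda> i)" by metis
    have fin: "finite (\<Lambda> i)" and card: "card (\<Lambda> i) * \<delta> ^ d i \<le> b i"
      and q: "\<And>x. x \<in> ?K i \<Longrightarrow> q i x \<in> \<Lambda> i"
      and meas: "\<And>l. l \<in> \<Lambda> i \<Longrightarrow> {x \<in> X i. q i x = l} \<in> sets (\<mu> i)"
      and small: "\<And>x x'. x \<in> ?K i \<Longrightarrow> x' \<in> ?K i \<Longrightarrow> q i x = q i x' \<Longrightarrow> norm (x' - x) \<le> b i * \<delta>" for i
      using good[of i] by (simp_all add: good_def)
    \<comment> \<open>\<open>C * (1 + r)\<close> is a Lipschitz constant of \<open>c\<close> at
      distances up to \<open>r\<close>; the added 1 makes it safe to divide by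
      \<open>k\<close>.\<close>
    define k where "k = C * (1 + r) + 1"
    have k: "0 < k" using C r by (simp add: k_def add_nonneg_pos)
    \<comment> \<open>Points whose coordinates differ by at most \<open>\<eta>\<close> have distance
      at most \<open>m * \<eta>\<close>: the first entry keeps this below the Taylor radius, the
      second one makes the oscillation of \<open>c\<close> at most
      \<open>\<epsilon>\<close>.\<close>
    define \<eta> where "\<eta> = min (r / (2 * m)) (\<epsilon> / (k * m))"
    have \<eta>: "0 < \<eta>" "m * \<eta> < r" "k * (m * \<eta>) \<le> \<epsilon>"
    proof -
      show "0 < \<eta>" using r m k \<epsilon> by (simp add: \<eta>_def)
      have "m * \<eta> \<le> m * (r / (2 * m))" using m by (intro mult_left_mono) (auto simp: \<eta>_def)
      also have "\<dots> < r" using m r by simp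
      finally show "m * \<eta> < r" .
      have "k * (m * \<eta>) \<le> k * (m * (\<epsilon> / (k * m)))"
        using m k by (intro mult_left_mono) (auto simp: \<eta>_def)
      also have "\<dots> = \<epsilon>" using m k by simp
      finally show "k * (m * \<eta>) \<le> \<epsilon>" .
    qed
    have "\<exists>\<gamma>\<in>couplings X \<mu>.
      rel_entropy \<gamma> (prod_measure X \<mu>) \<le> ereal (\<Sum>i\<in>UNIV - {j}. ln (card (\<Lambda> i))) \<and>
      ext_integral \<gamma> c \<le> MOT0 X \<mu> c +
        ereal ((1 + m) * C * (D * \<delta>)\<^sup>2 + CARD('m) * (D * \<delta>\<^sup>2) + (3 * real CARD('m) + 1) * \<epsilon>)"
    proof (rule block_estimate[OF assms(3) K assms(6) fin q meas _ _ \<eta>(1)])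
      fix v w assume vw: "v \<in> prod_set ?K" "w \<in> prod_set ?K" "\<And>i. q i (v $ i) = q i (w $ i)"
      have "norm (w - v) \<le> (\<Sum>i\<in>UNIV. norm ((w - v) $ i))" by (rule norm_vec_le_sum)
      also have "\<dots> \<le> (\<Sum>i\<in>UNIV. b i * \<delta>)"
        using vw small by (intro sum_mono) (auto simp: prod_set_def)
      also have "\<dots> = D * \<delta>" by (simp add: D_def sum_distrib_right)
      finally have near: "norm (w - v) \<le> D * \<delta>" .
      have "D * \<delta> \<le> D * (r / (2 * (D + 1)))"
        using D(1) order_trans[OF \<delta>(3) \<delta>1_le(2)] by (intro mult_left_mono)
      also have "\<dots> < r" using D(1) r by (simp add: field_simps add_pos_nonneg add_nonneg_pos)
      finally have "norm (w - v) < r" using near by simp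
      then have "c w \<le> c v + (\<Sum>i\<in>UNIV. c (vec_upd v i (w $ i)) - c v) + (1 + CARD('m)) * C * (norm (w - v))\<^sup>2"
        using vw KX by (intro taylor_on_split_increment[OF T]) auto
      also have "(1 + CARD('m)) * C * (norm (w - v))\<^sup>2 \<le> (1 + m) * C * (D * \<delta>)\<^sup>2"
        unfolding m_def using near C by (simp add: mult_left_mono power_mono)
      finally show "c w \<le> c v + (\<Sum>i\<in>UNIV. c (vec_upd v i (w $ i)) - c v) + (1 + m) * C * (D * \<delta>)\<^sup>2"
        by simp
    next
      fix v w assume vw: "v \<in> prod_set ?K" "w \<in> prod_set ?K" "\<And>i. norm (w $ i - v $ i) \<le> \<eta>"
      have "norm (w - v) \<le> (\<Sum>i\<in>UNIV. norm ((w - v) $ i))" by (rule norm_vec_le_sum)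
      also have "\<dots> \<le> (\<Sum>i\<in>(UNIV :: 'm set). \<eta>)" using vw(3) by (intro sum_mono) simp
      also have "\<dots> = m * \<eta>" by (simp add: m_def)
      finally have near: "norm (w - v) \<le> m * \<eta>" .
      have "norm (c w - c v) \<le> C * (1 + r) * norm (w - v)"
        using near \<eta>(2) vw KX r
        by (intro taylor_on_lipschitz[OF T[OF vw(1)]]) (auto simp: dist_norm norm_minus_commute)
      also have "\<dots> \<le> k * (m * \<eta>)"
        using near C r k by (intro mult_mono) (auto simp: k_def)
      also have "\<dots> \<le> \<epsilon>" by (rule \<eta>(3))
      finally show "c v \<le> c w + \<epsilon>" by (simp add: abs_le_iff)
    next
      fix i f assume f: "concave_wrt ((\<lambda>v y. c (vec_upd v i y)) ` prod_set ?K) (X i) f"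
      have le: "b i * \<delta>\<^sup>2 \<le> D * \<delta>\<^sup>2" using D(2) by (intro mult_right_mono) auto
      obtain \<omega> where \<omega>: "\<forall>l\<in>\<Lambda> i. 0 \<le> \<omega> l" "(\<Sum>l\<in>\<Lambda> i. measure (\<mu> i) {x \<in> X i. q i x = l} * \<omega> l) \<le> b i * \<delta>\<^sup>2"
        "\<forall>x\<in>?K i. \<forall>x'\<in>?K i. q i x = q i x' \<longrightarrow> (\<forall>h\<in>(\<lambda>v y. c (vec_upd v i y)) ` prod_set ?K. \<forall>s.
          (\<forall>y\<in>X i. f y - f x \<le> h y - h x + s) \<longrightarrow> h x' - h x - (f x' - f x) \<le> \<omega> (q i x) + s)"
        using good[of i] f unfolding good_def by blast
      show "\<exists>\<omega>. (\<forall>l\<in>\<Lambda> i. 0 \<le> \<omega> l) \<and>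
        (\<Sum>l\<in>\<Lambda> i. measure (\<mu> i) {x \<in> X i. q i x = l} * \<omega> l) \<le> D * \<delta>\<^sup>2 \<and>
        (\<forall>x\<in>?K i. \<forall>x'\<in>?K i. q i x = q i x' \<longrightarrow> (\<forall>h\<in>(\<lambda>v y. c (vec_upd v i y)) ` prod_set ?K. \<forall>s.
          (\<forall>y\<in>X i. f y - f x \<le> h y - h x + s) \<longrightarrow> h x' - h x - (f x' - f x) \<le> \<omega> (q i x) + s))"
        by (intro exI[of _ \<omega>] conjI \<omega>(1,3) order_trans[OF \<omega>(2) le])
    qed (use \<epsilon> in simp_all)
    then obtain \<gamma> where \<gamma>: "\<gamma> \<in> couplings X \<mu>"
      "rel_entropy \<gamma> (prod_measure X \<mu>) \<le> ereal (\<Sum>i\<in>UNIV - {j}. ln (card (\<Lambda> i)))"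
      "ext_integral \<gamma> c \<le> MOT0 X \<mu> c +
        ereal ((1 + m) * C * (D * \<delta>)\<^sup>2 + CARD('m) * (D * \<delta>\<^sup>2) + (3 * real CARD('m) + 1) * \<epsilon>)"
      by blast
    have ln_card: "ln (card (\<Lambda> i)) \<le> ln (max 1 (b i)) + real (d i) * (1 / 2 * ln (1 / \<epsilon>))" for i
    proof -
      have \<delta>le: "\<delta> \<le> 1" using \<delta>(3) \<delta>1_le(1) by simp
      have ln\<delta>: "1 / 2 * ln (1 / \<epsilon>) = - ln \<delta>"
        using \<delta>(1) unfolding \<delta>(2)[symmetric] by (simp add: ln_div ln_realpow)
      show ?thesis
      \<comment> \<open>The logarithm of the bound on the number of cells needs a positive argument;
        for an empty label set the convention \<open>ln 0 = 0\<close> gives the estimate, as the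
        right-hand side is nonnegative.\<close>
      proof (cases "card (\<Lambda> i) = 0")
        case True
        have "0 \<le> - ln \<delta>" using \<delta>le \<delta>(1) by simp
        then have "0 \<le> real (d i) * - ln \<delta>" by (intro mult_nonneg_nonneg) auto
        moreover have "0 \<le> ln (max 1 (b i))" by simp
        ultimately show ?thesis unfolding ln\<delta> True of_nat_0 ln_0 by (rule add_nonneg_nonneg[rotated])
      next
        case False
        then have "ln (card (\<Lambda> i) * \<delta> ^ d i) \<le> ln (max 1 (b i))"
          using card[of i] \<delta>(1) by (subst ln_le_cancel_iff) auto
        moreover have "ln (card (\<Lambda> i) * \<delta> ^ d i) = ln (card (\<Lambda> i)) + real (d i) * ln \<delta>"
          using False \<delta>(1) by (simp add: ln_mult ln_realpow)
        ultimately show ?thesis unfolding ln\<delta> by simp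
      qed
    qed
    have ent: "(\<Sum>i\<in>UNIV - {j}. ln (card (\<Lambda> i))) \<le> L + ((\<Sum>i\<in>UNIV. real (d i)) - real (MAX i. d i)) * (1 / 2 * ln (1 / \<epsilon>))"
    proof -
      have "(\<Sum>i\<in>UNIV - {j}. ln (card (\<Lambda> i))) \<le> (\<Sum>i\<in>UNIV - {j}. ln (max 1 (b i)) + real (d i) * (1 / 2 * ln (1 / \<epsilon>)))"
        by (intro sum_mono ln_card)
      also have "\<dots> = (\<Sum>i\<in>UNIV - {j}. ln (max 1 (b i))) + (\<Sum>i\<in>UNIV - {j}. real (d i)) * (1 / 2 * ln (1 / \<epsilon>))"
        by (simp only: sum.distrib sum_distrib_right)
      also have "(\<Sum>i\<in>UNIV - {j}. ln (max 1 (b i))) \<le> L"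
        unfolding L_def by (intro sum_mono2) auto
      also have "(\<Sum>i\<in>UNIV - {j}. real (d i)) = (\<Sum>i\<in>UNIV. real (d i)) - real (MAX i. d i)"
        unfolding j[symmetric] by (subst (2) sum.remove[of _ j]) auto
      finally show ?thesis by simp
    qed
    have "MOT X \<mu> c \<epsilon> \<le> ext_integral \<gamma> c + ereal \<epsilon> * rel_entropy \<gamma> (prod_measure X \<mu>)"
      unfolding MOT_def by (rule INF_lower[OF \<gamma>(1)])
    also have "\<dots> \<le> (MOT0 X \<mu> c +
        ereal ((1 + m) * C * (D * \<delta>)\<^sup>2 + CARD('m) * (D * \<delta>\<^sup>2) + (3 * real CARD('m) + 1) * \<epsilon>)) +
        ereal \<epsilon> * ereal (L + ((\<Sum>i\<in>UNIV. real (d i)) - real (MAX i. d i)) * (1 / 2 * ln (1 / \<epsilon>)))"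
      using \<gamma>(2,3) ent \<epsilon> by (intro add_mono ereal_mult_left_mono) (auto intro: order_trans)
    also have "\<dots> = MOT0 X \<mu> c +
        ereal (1 / 2 * ((\<Sum>i\<in>UNIV. real (d i)) - real (MAX i. d i)) * \<epsilon> * ln (1 / \<epsilon>) + C' * \<epsilon>)"
      unfolding add.assoc times_ereal.simps plus_ereal.simps power_mult_distrib \<delta>(2) m_def[symmetric] C'_def
      by (rule arg_cong[of _ _ "\<lambda>t. MOT0 X \<mu> c + ereal t"]) (simp add: algebra_simps)
    finally show "MOT X \<mu> c \<epsilon> \<le> MOT0 X \<mu> c +
        ereal (1 / 2 * ((\<Sum>i\<in>UNIV. real (d i)) - real (MAX i. d i)) * \<epsilon> * ln (1 / \<epsilon>) + C' * \<epsilon>)" .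
  qed
qed

end
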